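(* Let $f\in M_p$, $1<p<\infty$, $\alpha_1>0$, $\alpha_2>0$, $n_1\in\mathbb{N}$, $n_2\in\mathbb{N}$, and let $a_{\nu_1,\nu_2}$ be the cosine Fourier coefficients of $f$. Then $$\begin{aligned}\omega_{\alpha_1,\alpha_2}\Big(f,\frac1{n_1},\frac1{n_2}\Big)_{L_p(\mathbb{T}^2)}\asymp\;&\frac1{n_1^{\alpha_1}n_2^{\alpha_2}}\Big\{\sum_{\nu_1=1}^{n_1}\sum_{\nu_2=1}^{n_2}a_{\nu_1,\nu_2}^p\nu_1^{(\alpha_1+1)p-2}\nu_2^{(\alpha_2+1)p-2}\Big\}^{1/p}\\&+\frac1{n_1^{\alpha_1}}\Big\{\sum_{\nu_1=1}^{n_1}\sum_{\nu_2=n_2+1}^{\infty}a_{\nu_1,\nu_2}^p\nu_1^{(\alpha_1+1)p-2}\nu_2^{p-2}\Big\}^{1/p}\\&+\frac1{n_2^{\alpha_2}}\Big\{\sum_{\nu_1=n_1+1}^{\infty}\sum_{\nu_2=1}^{n_2}a_{\nu_1,\nu_2}^p\nu_1^{p-2}\nu_2^{(\alpha_2+1)p-2}\Big\}^{1/p}\\&+\Big\{\sum_{\nu_1=n_1+1}^{\infty}\sum_{\nu_2=n_2+1}^{\infty}a_{\nu_1,\nu_2}^p(\nu_1\nu_2)^{p-2}\Big\}^{1/p}.\end{aligned}$$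
   Context: $L_p(\mathbb{T}^2)$, $1<p<\infty$, is the space of measurable functions $f(x,y)$ that are $2\pi$-periodic in each variable with $\|f\|_{L_p(\mathbb{T}^2)}=\big(\int_0^{2\pi}\int_0^{2\pi}|f(x,y)|^p\,dx\,dy\big)^{1/p}<\infty$; $L_p^0(\mathbb{T}^2)$ is the set of $f\in L_p(\mathbb{T}^2)$ with $\int_0^{2\pi}f(x,y)\,dy=0$ for a.e. $x$ and $\int_0^{2\pi}f(x,y)\,dx=0$ for a.e. $y$. $\mathbb{N}=\{1,2,\ldots\}$. The class $M_p$, $1<p<\infty$, is the set of $f\in L_p^0(\mathbb{T}^2)$ whose Fourier series is $\sum_{\nu_1=1}^\infty\sum_{\nu_2=1}^\infty a_{\nu_1,\nu_2}\cos\nu_1x\cos\nu_2y$ with $a_{\nu_1,\nu_2}-a_{\nu_1+1,\nu_2}-a_{\nu_1,\nu_2+1}+a_{\nu_1+1,\nu_2+1}\ge0$ for all integers $\nu_1,\nu_2\ge1$. For $\alpha_1,\alpha_2>0$ the (fractional) differences are $\Delta_{h_1}^{\alpha_1}(f)=\sum_{\nu=0}^\infty(-1)^\nu\binom{\alpha_1}{\nu}f(x+(\alpha_1-\nu)h_1,y)$ and $\Delta_{h_2}^{\alpha_2}(f)=\sum_{\nu=0}^\infty(-1)^\nu\binom{\alpha_2}{\nu}f(x,y+(\alpha_2-\nu)h_2)$, where $\binom{\alpha}{0}=1$, $\binom{\alpha}{\nu}=\frac{\alpha(\alpha-1)\cdots(\alpha-\nu+1)}{\nu!}$ for $\nu\ge1$.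 The mixed modulus of smoothness is $\omega_{\alpha_1,\alpha_2}(f,\delta_1,\delta_2)_{L_p(\mathbb{T}^2)}=\sup_{|h_i|\le\delta_i,\,i=1,2}\|\Delta_{h_1}^{\alpha_1}(\Delta_{h_2}^{\alpha_2}(f))\|_{L_p(\mathbb{T}^2)}$. $A\asymp B$ means $C^{-1}B\le A\le CB$ with a constant $C>0$ independent of $f,n_1,n_2$ ($C$ may depend on $p,\alpha_1,\alpha_2$). *)

theory Defs
  imports "HOL-Analysis.Analysis"
begin

(* x powr r on [0, \<infinity>], with \<infinity> powr r = \<infinity>; it is used for r > 0 only. *)
definition ennreal_powr :: "ennreal \<Rightarrow> real \<Rightarrow> ennreal" where
  "ennreal_powr x r = (if x = top then top else ennreal (enn2real x powr r))"

definition torus :: "(real \<times> real) set" where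
  "torus = {0..2 * pi} \<times> {0..2 * pi}"

definition Lp_norm :: "real \<Rightarrow> (real \<times> real \<Rightarrow> real) \<Rightarrow> ennreal" where
  "Lp_norm p f = ennreal_powr (\<integral>\<^sup>+z\<in>torus. ennreal (\<bar>f z\<bar> powr p) \<partial>lebesgue) (1 / p)"

(* Elements of the L_p spaces are functions, not classes modulo null sets. *)
definition Lp :: "real \<Rightarrow> (real \<times> real \<Rightarrow> real) set" where
  "Lp p = {f. f \<in> borel_measurable lebesgue
            \<and> (\<forall>x y. f (x + 2 * pi, y) = f (x, y) \<and> f (x, y + 2 * pi) = f (x, y))
            \<and> Lp_norm p f < top}"

definition Lp0 :: "real \<Rightarrow> (real \<times> real \<Rightarrow> real) set" where
  "Lp0 p = {f \<in> Lp p.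
      (AE x in lebesgue. (LINT y:{0..2 * pi}|lebesgue. f (x, y)) = 0)
    \<and> (AE y in lebesgue. (LINT x:{0..2 * pi}|lebesgue. f (x, y)) = 0)}"

(* For u, v in {cos, sin}: the coefficient of u (i x) v (j y) in the double
   trigonometric Fourier series of f. *)
definition Fourier_coeff ::
  "(real \<Rightarrow> real) \<Rightarrow> (real \<Rightarrow> real) \<Rightarrow> (real \<times> real \<Rightarrow> real) \<Rightarrow> nat \<Rightarrow> nat \<Rightarrow> real" where
  "Fourier_coeff u v f i j =
     (if i = 0 then 1 / 2 else 1) * (if j = 0 then 1 / 2 else 1) / pi\<^sup>2 *
     (LINT z:torus|lebesgue. f z * u (real i * fst z) * v (real j * snd z))"

(* The Fourier series of f is the sum of a i j cos (i x) cos (j y) over i, j \<ge> 1: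
   all its other coefficients vanish.  Values of a at index 0 are irrelevant. *)
definition has_cosine_Fourier_series ::
  "(real \<times> real \<Rightarrow> real) \<Rightarrow> (nat \<Rightarrow> nat \<Rightarrow> real) \<Rightarrow> bool" where
  "has_cosine_Fourier_series f a \<longleftrightarrow>
     (\<forall>i j. Fourier_coeff cos cos f i j = (if i \<ge> 1 \<and> j \<ge> 1 then a i j else 0)
          \<and> Fourier_coeff cos sin f i j = 0
          \<and> Fourier_coeff sin cos f i j = 0
          \<and> Fourier_coeff sin sin f i j = 0)"

definition M_class :: "real \<Rightarrow> (real \<times> real \<Rightarrow> real) set" where
  "M_class p = {f \<in> Lp0 p. \<exists>a. has_cosine_Fourier_series f a
     \<and> (\<forall>i\<ge>1. \<forall>j\<ge>1. a i j - a (i + 1) j - a i (j + 1) + a (i + 1) (j + 1) \<ge> 0)}"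

(* The series defining the fractional differences are taken pointwise.  Since the binomial
   coefficients are absolutely summable, they converge absolutely almost everywhere for f in L_p,
   p \<ge> 1; the value of suminf on the exceptional null set does not affect norms. *)
definition frac_diff1 :: "real \<Rightarrow> real \<Rightarrow> (real \<times> real \<Rightarrow> real) \<Rightarrow> real \<times> real \<Rightarrow> real" where
  "frac_diff1 \<alpha> h f = (\<lambda>(x, y). \<Sum>\<nu>. (- 1) ^ \<nu> * (\<alpha> gchoose \<nu>) * f (x + (\<alpha> - real \<nu>) * h, y))"

definition frac_diff2 :: "real \<Rightarrow> real \<Rightarrow> (real \<times> real \<Rightarrow> real) \<Rightarrow> real \<times> real \<Rightarrow> real" where
  "frac_diff2 \<alpha> h f = (\<lambda>(x, y). \<Sum>\<nu>. (- 1) ^ \<nu> * (\<alpha> gchoose \<nu>) * f (x, y + (\<alpha> - real \<nu>) * h))"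

definition mixed_modulus ::
  "real \<Rightarrow> real \<Rightarrow> real \<Rightarrow> (real \<times> real \<Rightarrow> real) \<Rightarrow> real \<Rightarrow> real \<Rightarrow> ennreal" where
  "mixed_modulus p \<alpha>1 \<alpha>2 f \<delta>1 \<delta>2 =
     (SUP (h1, h2) \<in> {(h1, h2). \<bar>h1\<bar> \<le> \<delta>1 \<and> \<bar>h2\<bar> \<le> \<delta>2}.
        Lp_norm p (frac_diff1 \<alpha>1 h1 (frac_diff2 \<alpha>2 h2 f)))"

(* The right-hand side of the theorem.  Sums and powers are formed in [0, \<infinity>], so that
   convergence of the infinite sums is part of the claim.  For f in M_p the coefficients are
   nonnegative (sum the mixed differences; they tend to 0 by Riemann-Lebesgue), so powr is the
   usual power. *)
definition coeff_bound ::
  "real \<Rightarrow> real \<Rightarrow> real \<Rightarrow> (nat \<Rightarrow> nat \<Rightarrow> real) \<Rightarrow> nat \<Rightarrow> nat \<Rightarrow> ennreal" where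
  "coeff_bound p \<alpha>1 \<alpha>2 a n1 n2 =
     ennreal (1 / (real n1 powr \<alpha>1 * real n2 powr \<alpha>2)) *
       ennreal_powr (\<Sum>i=1..n1. \<Sum>j=1..n2.
         ennreal (a i j powr p * real i powr ((\<alpha>1 + 1) * p - 2) * real j powr ((\<alpha>2 + 1) * p - 2)))
         (1 / p)
   + ennreal (1 / real n1 powr \<alpha>1) *
       ennreal_powr (\<Sum>i=1..n1. \<Sum>\<^sub>\<infinity>j\<in>{n2+1..}.
         ennreal (a i j powr p * real i powr ((\<alpha>1 + 1) * p - 2) * real j powr (p - 2)))
         (1 / p)
   + ennreal (1 / real n2 powr \<alpha>2) *
       ennreal_powr (\<Sum>\<^sub>\<infinity>i\<in>{n1+1..}. \<Sum>j=1..n2.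
         ennreal (a i j powr p * real i powr (p - 2) * real j powr ((\<alpha>2 + 1) * p - 2)))
         (1 / p)
   + ennreal_powr (\<Sum>\<^sub>\<infinity>i\<in>{n1+1..}. \<Sum>\<^sub>\<infinity>j\<in>{n2+1..}.
         ennreal (a i j powr p * (real i * real j) powr (p - 2)))
         (1 / p)"

end

theory Submission
  imports Defs
begin

text \<open>
  Write \<open>K m x = min m (1 / \<bar>sin (x / 2)\<bar>)\<close> and \<open>d k = min 1 (k / n) powr \<alpha>\<close>.
  The right-hand side of the theorem is equivalent to the \<open>p\<close>-th root of
  \<open>S = \<Sum>k l. (a k l * d\<^sub>1 k * d\<^sub>2 l) powr p * (k * l) powr (p - 2)\<close>. Since \<open>K\<close>
  behaves like a homogeneous kernel of degree -1, the Schur test bounds the integral operator with kernel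
  \<open>K\<close> between \<open>L\<^sub>p\<close> of the circle and the weighted sequence space in both directions, also for products
  and translates of \<open>K\<close>.

  From below: the difference is tested against products of trigonometric polynomials whose phases match
  those of its coefficients. For low frequencies (\<open>m \<le> 4 n\<close>) the phases are linear in the frequency, so a translated Dirichlet
  kernel with a constant phase will do; for high frequencies the difference of a Dirichlet kernel itself
  is used. Both are bounded by averages of translates of \<open>K\<close>, and monotonicity bounds \<open>m a\<^sub>m d\<^sub>m\<close>
  by the resulting integral.

  From above: two summations by parts write \<open>f\<close> as a series of products of Dirichlet kernels with
  nonnegative coefficients. A difference of the \<open>k\<close>-th Dirichlet kernel is bounded by \<open>d k\<close> times an average of
  translates of \<open>K k\<close>, and summing by parts back leads to the Schur operator applied to \<open>k l a d\<^sub>1 d\<^sub>2\<close>.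
  The estimate from below with \<open>n\<^sub>1 = n\<^sub>2 = 1\<close> provides the integrable majorant needed to identify the sum of the series with \<open>f\<close>.
\<close>

section \<open>Weighted inequalities for positive kernels\<close>

text \<open>Nonnegative mixed differences reduce everything to positive kernels: after two
  summations by parts no cancellation between terms is needed, so the Schur test replaces conjugate
  functions and multiplier theorems. The obstacle is that a fractional difference multiplies
  frequency j by a complex number. While 0 < j h < 2 \<pi>, its argument is j \<alpha> h / 2 +
  \<alpha> \<pi> / 2, that is, a translation by \<alpha> h / 2 and a fixed phase; beyond that this
  law need not persist, and the modulus vanishes when j h is a multiple of 2 \<pi>. Hence the
  translate by \<alpha> h / 2 is kept beside those of the difference, and the estimate from below
  treats low and high frequencies differently. It uses the single step h = 1 / (4 n): then j h \<le>
  1 for j \<le> 4 n, and passing from j to j + n turns the half angle j h / 2 by 1 / 8, so the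
  moduli at j and j + n are not both small. Norms and coefficient sums live in [0, \<infinity>]; the
  finiteness that the estimate from above requires comes from the one from below, because the
  difference of an L_p function lies in L_p.\<close>

lemma ennreal_powr_top [simp]: "ennreal_powr top r = top"
  by (simp add: ennreal_powr_def)

lemma ennreal_powr_ennreal: "0 \<le> x \<Longrightarrow> ennreal_powr (ennreal x) r = ennreal (x powr r)"
  by (simp add: ennreal_powr_def)

lemma ennreal_powr_0 [simp]: "ennreal_powr 0 r = 0"
  by (simp add: ennreal_powr_def)

lemma ennreal_powr_mono: "0 < r \<Longrightarrow> x \<le> y \<Longrightarrow> ennreal_powr x r \<le> ennreal_powr y r"
  by (cases x; cases y) (auto simp: ennreal_powr_ennreal intro!: ennreal_leI powr_mono2 simp: top_unique)

lemma ennreal_powr_mult: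
  assumes "0 < r"
  shows "ennreal_powr (x * y) r = ennreal_powr x r * ennreal_powr y r"
proof (cases x)
  case x: (real x')
  show ?thesis
  proof (cases y)
    case (real y')
    with x show ?thesis
      by (simp add: ennreal_powr_ennreal powr_mult flip: ennreal_mult)
  next
    case top
    with x show ?thesis
      by (cases "x' = 0") (simp_all add: ennreal_powr_ennreal ennreal_mult_top)
  qed
next
  case top
  then show ?thesis
    by (cases y) (auto simp: ennreal_powr_ennreal ennreal_top_mult)
qed

lemma ennreal_powr_eq_0_iff [simp]: "ennreal_powr x r = 0 \<longleftrightarrow> x = 0"
  by (cases x) (auto simp: ennreal_powr_ennreal)

lemma ennreal_powr_eq_top_iff [simp]: "ennreal_powr x r = top \<longleftrightarrow> x = top"
  by (cases x) (auto simp: ennreal_powr_ennreal)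

lemma measurable_ennreal_powr [measurable]:
  assumes [measurable]: "f \<in> borel_measurable M"
  shows "(\<lambda>x. ennreal_powr (f x) r) \<in> borel_measurable M"
  unfolding ennreal_powr_def by measurable

text \<open>Convexity: the graph of x powr p lies above its tangent at \<open>l\<close>. Integrated,
  this gives Jensen's inequality; with l = 1 it is the Bernoulli inequality behind
  \<open>damp_peak_increment\<close>.\<close>

lemma Young_tangent:
  fixes x l p :: real
  assumes "1 < p" "0 \<le> x" "0 \<le> l"
  shows "p * l powr (p - 1) * x \<le> x powr p + (p - 1) * l powr p"
proof -
  define q where "q = p / (p - 1)"
  have q: "1 < q" "1 / p + 1 / q = 1"
    using assms by (auto simp: q_def field_simps)
  have "x * l powr (p - 1) \<le> x powr p / p + (l powr (p - 1)) powr q / q"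
    by (rule Youngs_inequality) (use assms q in auto)
  moreover have "(l powr (p - 1)) powr q = l powr p"
    using assms by (simp add: powr_powr q_def)
  ultimately have "p * (x * l powr (p - 1)) \<le> p * (x powr p / p + l powr p / q)"
    using assms by (intro mult_left_mono) auto
  also have "\<dots> = x powr p + (p - 1) * l powr p"
    using assms by (simp add: q_def field_simps)
  finally show ?thesis by (simp add: mult_ac)
qed

text \<open>Serves as the inclusion of L_p in L_1 over a finite measure.\<close>

lemma le_one_plus_ennreal_powr:
  assumes "1 < p" shows "x \<le> 1 + ennreal_powr x p"
proof (cases x)
  case (real r)
  have "r \<le> 1 + r powr p"
  proof (cases "r \<le> 1")
    case False
    then have "r powr 1 \<le> r powr p" using assms by (intro powr_mono) auto
    with False show ?thesis by simp
  qed (simp add: add_increasing2)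
  with real show ?thesis
    by (simp add: ennreal_powr_ennreal flip: ennreal_1 ennreal_plus del: ennreal_1)
qed auto

text \<open>Integrate the tangent inequality at the mean l = I / \<kappa> against the weight
  \<open>k\<close>. The weight is not normalised, so its mass enters to the power p - 1, as the
  Schur test wants it.\<close>

lemma nn_integral_powr_Jensen:
  assumes p: "1 < p" and [measurable]: "k \<in> borel_measurable M" "g \<in> borel_measurable M"
    and fin: "(\<integral>\<^sup>+s. k s \<partial>M) < top"
  shows "ennreal_powr (\<integral>\<^sup>+s. k s * g s \<partial>M) p
    \<le> ennreal_powr (\<integral>\<^sup>+s. k s \<partial>M) (p - 1) * (\<integral>\<^sup>+s. k s * ennreal_powr (g s) p \<partial>M)"
proof -
  define \<kappa> where "\<kappa> = enn2real (\<integral>\<^sup>+s. k s \<partial>M)"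
  have k: "(\<integral>\<^sup>+s. k s \<partial>M) = ennreal \<kappa>" using fin by (simp add: \<kappa>_def)
  have \<kappa>0: "0 \<le> \<kappa>" by (simp add: \<kappa>_def)
  consider "\<kappa> = 0" | "\<kappa> > 0" "(\<integral>\<^sup>+s. k s * ennreal_powr (g s) p \<partial>M) = top"
    | "\<kappa> > 0" "(\<integral>\<^sup>+s. k s * ennreal_powr (g s) p \<partial>M) < top"
    using \<kappa>0 by (force simp: top.not_eq_extremum)
  then show ?thesis
  proof cases
    case 1
    then have "AE s in M. k s = 0" using k by (simp add: nn_integral_0_iff_AE)
    then have "(\<integral>\<^sup>+s. k s * g s \<partial>M) = 0" by (subst nn_integral_0_iff_AE) auto
    then show ?thesis by simp
  next
    case 2
    then show ?thesis by (simp add: k ennreal_powr_ennreal ennreal_mult_top)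
  next
    \<comment> \<open>Finiteness of the mean comes first: it makes \<open>l\<close> a real number
      and permits the subtraction at the end.\<close>
    case 3
    have "(\<integral>\<^sup>+s. k s * g s \<partial>M) \<le> (\<integral>\<^sup>+s. k s + k s * ennreal_powr (g s) p \<partial>M)"
      using le_one_plus_ennreal_powr[OF p]
      by (intro nn_integral_mono) (metis distrib_left mult.right_neutral mult_left_mono zero_le)
    also have "\<dots> < top" using fin 3 by (simp add: nn_integral_add)
    finally obtain I where I: "0 \<le> I" "(\<integral>\<^sup>+s. k s * g s \<partial>M) = ennreal I"
      by (auto simp: less_top_ennreal)
    obtain J where J: "0 \<le> J" "(\<integral>\<^sup>+s. k s * ennreal_powr (g s) p \<partial>M) = ennreal J"
      using 3 by (auto simp: less_top_ennreal)
    define l where "l = I / \<kappa>"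
    have l: "0 \<le> l" using 3 I by (simp add: l_def)
    have pt: "ennreal (p * l powr (p - 1)) * x \<le> ennreal_powr x p + ennreal ((p - 1) * l powr p)" for x
    proof (cases x)
      case (real r)
      then show ?thesis
        using Young_tangent[OF p, of r l] p l
        by (simp add: ennreal_powr_ennreal flip: ennreal_mult ennreal_plus)
    qed auto
    have "ennreal (p * l powr (p - 1)) * (\<integral>\<^sup>+s. k s * g s \<partial>M)
        = (\<integral>\<^sup>+s. k s * (ennreal (p * l powr (p - 1)) * g s) \<partial>M)"
      by (subst nn_integral_cmult[symmetric]) (auto simp: mult_ac)
    also have "\<dots> \<le> (\<integral>\<^sup>+s. k s * ennreal_powr (g s) p + ennreal ((p - 1) * l powr p) * k s \<partial>M)"
      using pt by (intro nn_integral_mono) (metis distrib_left mult.commute mult_left_mono zero_le)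
    also have "\<dots> = ennreal J + ennreal ((p - 1) * l powr p) * ennreal \<kappa>"
      by (simp add: nn_integral_add nn_integral_cmult J k)
    finally have "p * l powr (p - 1) * I \<le> J + (p - 1) * l powr p * \<kappa>"
      using p l I J \<kappa>0 by (simp add: flip: ennreal_mult ennreal_plus)
    moreover have "l powr p * \<kappa> = l powr (p - 1) * I"
    proof (cases "l = 0")
      case False
      then have "l powr p = l powr (p - 1) * l" 
        using l by (simp add: powr_diff)
      then show ?thesis using 3 by (simp add: l_def)
    qed simp
    ultimately have "p * (l powr (p - 1) * I) \<le> J + (p - 1) * (l powr (p - 1) * I)"
      by (simp add: mult.assoc)
    then have "l powr (p - 1) * I \<le> J" by (simp add: left_diff_distrib)
    then have "\<kappa> powr (p - 1) * (l powr (p - 1) * I) \<le> \<kappa> powr (p - 1) * J"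
      by (intro mult_left_mono) auto
    moreover have "\<kappa> powr (p - 1) * (l powr (p - 1) * I) = I powr p"
    proof (cases "I = 0")
      case False
      then show ?thesis using 3 I by (simp add: l_def powr_divide powr_diff)
    qed (use p in simp)
    ultimately show ?thesis
      using I J \<kappa>0 p by (simp add: k ennreal_powr_ennreal flip: ennreal_mult)
  qed
qed

text \<open>Minkowski's inequality for a countable average, obtained from Jensen's inequality and
  Tonelli's theorem. It passes from a single translate to the weighted sums of translates that
  fractional differences produce.\<close>

lemma nn_integral_weighted_sum_powr:
  fixes w :: "'i \<Rightarrow> ennreal"
  assumes p: "1 < p" and "countable (UNIV :: 'i set)" and "sigma_finite_measure N" and "(\<integral>\<^sup>+i. w i \<partial>count_space UNIV) = W" "W < top"
    and [measurable]: "\<And>i. F i \<in> borel_measurable N"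
    and R: "\<And>i. (\<integral>\<^sup>+t. ennreal_powr (F i t) p \<partial>N) \<le> R"
  shows "(\<integral>\<^sup>+t. ennreal_powr (\<integral>\<^sup>+i. w i * F i t \<partial>count_space UNIV) p \<partial>N) \<le> ennreal_powr W p * R"
proof -
  interpret C: sigma_finite_measure "count_space (UNIV :: 'i set)"
    using assms by (intro sigma_finite_measure_count_space_countable)
  interpret N: sigma_finite_measure N by fact
  interpret pair_sigma_finite "count_space (UNIV :: 'i set)" N ..
  have [measurable]: "(\<lambda>(i, t). F i t) \<in> borel_measurable (count_space UNIV \<Otimes>\<^sub>M N)"
    using assms by (intro measurable_pair_measure_countable1) auto
  have [measurable]: "(\<lambda>z. F (snd z) (fst z)) \<in> borel_measurable (N \<Otimes>\<^sub>M count_space UNIV)"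
    using measurable_pair_swap[of "\<lambda>(i, t). F i t" "count_space UNIV" N borel] by (simp add: case_prod_beta')
  have [measurable]: "(\<lambda>z. F (fst z) (snd z)) \<in> borel_measurable (count_space UNIV \<Otimes>\<^sub>M N)"
    using assms by (intro measurable_pair_measure_countable1) auto
  have [measurable]: "(\<lambda>z. w (fst z)) \<in> borel_measurable (count_space UNIV \<Otimes>\<^sub>M N)"
    by (rule measurable_compose[OF measurable_fst]) simp
  have [measurable]: "(\<lambda>z. w (snd z)) \<in> borel_measurable (N \<Otimes>\<^sub>M count_space UNIV)"
    by (rule measurable_compose[OF measurable_snd]) simp
  have "(\<integral>\<^sup>+t. ennreal_powr (\<integral>\<^sup>+i. w i * F i t \<partial>count_space UNIV) p \<partial>N)
    \<le> (\<integral>\<^sup>+t. ennreal_powr W (p - 1) * (\<integral>\<^sup>+i. w i * ennreal_powr (F i t) p \<partial>count_space UNIV) \<partial>N)"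
    using nn_integral_powr_Jensen[OF p, of w "count_space UNIV"] assms
    by (intro nn_integral_mono) auto
  also have "\<dots> = ennreal_powr W (p - 1) * (\<integral>\<^sup>+t. (\<integral>\<^sup>+i. w i * ennreal_powr (F i t) p \<partial>count_space UNIV) \<partial>N)"
    by (intro nn_integral_cmult) measurable
  also have "(\<integral>\<^sup>+t. (\<integral>\<^sup>+i. w i * ennreal_powr (F i t) p \<partial>count_space UNIV) \<partial>N)
    = (\<integral>\<^sup>+i. (\<integral>\<^sup>+t. w i * ennreal_powr (F i t) p \<partial>N) \<partial>count_space UNIV)"
    by (intro Fubini') measurable
  also have "\<dots> = (\<integral>\<^sup>+i. w i * (\<integral>\<^sup>+t. ennreal_powr (F i t) p \<partial>N) \<partial>count_space UNIV)"
    by (simp add: nn_integral_cmult)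
  also have "\<dots> \<le> (\<integral>\<^sup>+i. w i * R \<partial>count_space UNIV)"
    by (intro nn_integral_mono mult_left_mono R) auto
  also have "\<dots> = W * R" using assms by (simp add: nn_integral_multc)
  also have "ennreal_powr W (p - 1) * (W * R) = ennreal_powr W p * R"
  proof -
    have "ennreal_powr W (p - 1) * W = ennreal_powr W p"
      using \<open>W < top\<close> p by (cases W) (auto simp: ennreal_powr_ennreal powr_diff simp flip: ennreal_mult)
    then show ?thesis by (simp flip: mult.assoc)
  qed
  finally show ?thesis by (simp add: mult_left_mono)
qed

text \<open>Factor g = \<phi> G and apply Jensen's inequality with the weight K \<phi>: hypothesis
  \<open>1\<close> bounds its mass by \<psi>, and after Tonelli's theorem hypothesis
  \<open>2\<close> bounds the remaining integral over \<open>t\<close>.\<close>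

lemma Schur_test:
  fixes \<phi> \<psi> :: "_ \<Rightarrow> ennreal"
  assumes p: "1 < p" and "sigma_finite_measure M" "sigma_finite_measure N"
    and K [measurable]: "(\<lambda>(t, s). K t s) \<in> borel_measurable (N \<Otimes>\<^sub>M M)"
    and [measurable]: "\<phi> \<in> borel_measurable M" "\<psi> \<in> borel_measurable N" "g \<in> borel_measurable M"
    and \<phi>: "AE s in M. 0 < \<phi> s \<and> \<phi> s < top" and \<psi>: "AE t in N. \<psi> t < top"
    and 1: "AE t in N. (\<integral>\<^sup>+s. K t s * \<phi> s \<partial>M) \<le> \<psi> t"
    and 2: "AE s in M. (\<integral>\<^sup>+t. K t s * ennreal_powr (\<psi> t) (p - 1) \<partial>N) \<le> B * ennreal_powr (\<phi> s) (p - 1)"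
  shows "(\<integral>\<^sup>+t. ennreal_powr (\<integral>\<^sup>+s. K t s * g s \<partial>M) p \<partial>N) \<le> B * (\<integral>\<^sup>+s. ennreal_powr (g s) p \<partial>M)"
proof -
  interpret M: sigma_finite_measure M by fact
  interpret N: sigma_finite_measure N by fact
  interpret pair_sigma_finite N M ..
  have [measurable]: "(\<lambda>s. K t s) \<in> borel_measurable M" if "t \<in> space N" for t
    using measurable_Pair2[OF K, of t] that by simp
  define G where "G s = g s / \<phi> s" for s
  have [measurable]: "G \<in> borel_measurable M" unfolding G_def by measurable
  have G: "\<phi> s * G s = g s" if "0 < \<phi> s \<and> \<phi> s < top" for s
    using that mult_divide_eq_ennreal[of "\<phi> s" "g s"] by (auto simp: G_def ennreal_times_divide mult.commute[of _ "g s"])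
  have "(\<integral>\<^sup>+t. ennreal_powr (\<integral>\<^sup>+s. K t s * g s \<partial>M) p \<partial>N)
    \<le> (\<integral>\<^sup>+t. ennreal_powr (\<psi> t) (p - 1) * (\<integral>\<^sup>+s. (K t s * \<phi> s) * ennreal_powr (G s) p \<partial>M) \<partial>N)"
  proof (rule nn_integral_mono_AE, use 1 \<psi> AE_space in eventually_elim)
    case (elim t)
    have "(\<integral>\<^sup>+s. K t s * g s \<partial>M) = (\<integral>\<^sup>+s. (K t s * \<phi> s) * G s \<partial>M)"
      by (rule nn_integral_cong_AE, use \<phi> in eventually_elim) (simp add: G mult.assoc)
    also have "ennreal_powr \<dots> p \<le> ennreal_powr (\<integral>\<^sup>+s. K t s * \<phi> s \<partial>M) (p - 1) * (\<integral>\<^sup>+s. (K t s * \<phi> s) * ennreal_powr (G s) p \<partial>M)"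
      using elim by (intro nn_integral_powr_Jensen p) auto
    also have "\<dots> \<le> ennreal_powr (\<psi> t) (p - 1) * (\<integral>\<^sup>+s. (K t s * \<phi> s) * ennreal_powr (G s) p \<partial>M)"
      using elim p by (intro mult_right_mono ennreal_powr_mono) auto
    finally show ?case .
  qed
  also have "\<dots> = (\<integral>\<^sup>+t. (\<integral>\<^sup>+s. ennreal_powr (\<psi> t) (p - 1) * ((K t s * \<phi> s) * ennreal_powr (G s) p) \<partial>M) \<partial>N)"
    by (intro nn_integral_cong nn_integral_cmult[symmetric]) simp
  also have "\<dots> = (\<integral>\<^sup>+s. (\<integral>\<^sup>+t. ennreal_powr (\<psi> t) (p - 1) * ((K t s * \<phi> s) * ennreal_powr (G s) p) \<partial>N) \<partial>M)"
    by (rule Fubini'[symmetric]) simp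
  also have "\<dots> = (\<integral>\<^sup>+s. (\<phi> s * ennreal_powr (G s) p) * (\<integral>\<^sup>+t. K t s * ennreal_powr (\<psi> t) (p - 1) \<partial>N) \<partial>M)"
    by (intro nn_integral_cong, subst nn_integral_cmult[symmetric]) (simp_all add: mult_ac)
  also have "\<dots> \<le> (\<integral>\<^sup>+s. B * ennreal_powr (g s) p \<partial>M)"
  proof (rule nn_integral_mono_AE, use 2 \<phi> in eventually_elim)
    case (elim s)
    obtain r where r: "\<phi> s = ennreal r" "0 < r" using elim by (cases "\<phi> s") auto
    have "\<phi> s * ennreal_powr (G s) p * (\<integral>\<^sup>+t. K t s * ennreal_powr (\<psi> t) (p - 1) \<partial>N)
      \<le> \<phi> s * ennreal_powr (G s) p * (B * ennreal_powr (\<phi> s) (p - 1))"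
      using elim by (intro mult_left_mono) auto
    also have "\<dots> = B * ((\<phi> s * ennreal_powr (\<phi> s) (p - 1)) * ennreal_powr (G s) p)"
      by (simp add: mult_ac)
    also have "\<phi> s * ennreal_powr (\<phi> s) (p - 1) = ennreal_powr (\<phi> s) p"
      using r by (simp add: ennreal_powr_ennreal powr_diff flip: ennreal_mult)
    also have "\<dots> * ennreal_powr (G s) p = ennreal_powr (g s) p"
      using elim p by (simp add: G flip: ennreal_powr_mult)
    finally show ?case .
  qed
  also have "\<dots> = B * (\<integral>\<^sup>+s. ennreal_powr (g s) p \<partial>M)" by (simp add: nn_integral_cmult)
  finally show ?thesis .
qed

lemma nn_integral_pair_mult:
  assumes "sigma_finite_measure N" and [measurable]: "f \<in> borel_measurable M" "g \<in> borel_measurable N"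
  shows "(\<integral>\<^sup>+z. f (fst z) * g (snd z) \<partial>(M \<Otimes>\<^sub>M N)) = (\<integral>\<^sup>+x. f x \<partial>M) * (\<integral>\<^sup>+y. g y \<partial>N)"
proof -
  interpret N: sigma_finite_measure N by fact
  have "(\<integral>\<^sup>+z. f (fst z) * g (snd z) \<partial>(M \<Otimes>\<^sub>M N)) = (\<integral>\<^sup>+x. \<integral>\<^sup>+y. f x * g y \<partial>N \<partial>M)"
    by (subst N.nn_integral_fst[symmetric]) auto
  then show ?thesis by (simp add: nn_integral_cmult nn_integral_multc)
qed

lemma AE_pair_conj:
  assumes "sigma_finite_measure N" and P: "AE x in M. P x" and Q: "AE y in N. Q y"
  shows "AE z in M \<Otimes>\<^sub>M N. P (fst z) \<and> Q (snd z)"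
proof -
  interpret N: sigma_finite_measure N by fact
  obtain A where A: "A \<in> null_sets M" "{x \<in> space M. \<not> P x} \<subseteq> A"
    using P by (auto simp: eventually_ae_filter)
  obtain B where B: "B \<in> null_sets N" "{x \<in> space N. \<not> Q x} \<subseteq> B"
    using Q by (auto simp: eventually_ae_filter)
  have "A \<times> space N \<in> null_sets (M \<Otimes>\<^sub>M N)" "space M \<times> B \<in> null_sets (M \<Otimes>\<^sub>M N)"
    using A B by (auto simp: null_sets_def N.emeasure_pair_measure_Times)
  then have "A \<times> space N \<union> space M \<times> B \<in> null_sets (M \<Otimes>\<^sub>M N)" by (rule null_sets.Un)
  then show ?thesis
    by (rule AE_I') (use A B in \<open>auto simp: space_pair_measure\<close>)
qed

text \<open>Products of test functions are test functions for the product kernel, because both test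
  integrals factor; \<open>g\<close> itself may be any function of two variables.\<close>

lemma Schur_test_product:
  assumes p: "1 < p"
    and sf: "sigma_finite_measure M1" "sigma_finite_measure N1" "sigma_finite_measure M2" "sigma_finite_measure N2"
    and K [measurable]: "(\<lambda>(t, s). K1 t s) \<in> borel_measurable (N1 \<Otimes>\<^sub>M M1)" "(\<lambda>(t, s). K2 t s) \<in> borel_measurable (N2 \<Otimes>\<^sub>M M2)"
    and [measurable]: "\<phi>1 \<in> borel_measurable M1" "\<psi>1 \<in> borel_measurable N1" "\<phi>2 \<in> borel_measurable M2" "\<psi>2 \<in> borel_measurable N2"
      "g \<in> borel_measurable (M1 \<Otimes>\<^sub>M M2)"
    and \<phi>: "AE s in M1. 0 < \<phi>1 s \<and> \<phi>1 s < top" "AE s in M2. 0 < \<phi>2 s \<and> \<phi>2 s < top"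
    and \<psi>: "AE t in N1. \<psi>1 t < top" "AE t in N2. \<psi>2 t < top"
    and 1: "AE t in N1. (\<integral>\<^sup>+s. K1 t s * \<phi>1 s \<partial>M1) \<le> \<psi>1 t" "AE t in N2. (\<integral>\<^sup>+s. K2 t s * \<phi>2 s \<partial>M2) \<le> \<psi>2 t"
    and 2: "AE s in M1. (\<integral>\<^sup>+t. K1 t s * ennreal_powr (\<psi>1 t) (p - 1) \<partial>N1) \<le> B1 * ennreal_powr (\<phi>1 s) (p - 1)"
      "AE s in M2. (\<integral>\<^sup>+t. K2 t s * ennreal_powr (\<psi>2 t) (p - 1) \<partial>N2) \<le> B2 * ennreal_powr (\<phi>2 s) (p - 1)"
  shows "(\<integral>\<^sup>+t. ennreal_powr (\<integral>\<^sup>+s. K1 (fst t) (fst s) * K2 (snd t) (snd s) * g s \<partial>(M1 \<Otimes>\<^sub>M M2)) p \<partial>(N1 \<Otimes>\<^sub>M N2))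
    \<le> B1 * B2 * (\<integral>\<^sup>+s. ennreal_powr (g s) p \<partial>(M1 \<Otimes>\<^sub>M M2))"
proof (rule Schur_test[OF p, where \<phi>="\<lambda>s. \<phi>1 (fst s) * \<phi>2 (snd s)" and \<psi>="\<lambda>t. \<psi>1 (fst t) * \<psi>2 (snd t)"])
  interpret N1: sigma_finite_measure N1 by fact
  interpret N2: sigma_finite_measure N2 by fact
  interpret M1: sigma_finite_measure M1 by fact
  interpret M2: sigma_finite_measure M2 by fact
  interpret N: pair_sigma_finite N1 N2 ..
  interpret M: pair_sigma_finite M1 M2 ..
  show "sigma_finite_measure (M1 \<Otimes>\<^sub>M M2)" "sigma_finite_measure (N1 \<Otimes>\<^sub>M N2)" by unfold_locales
  have m1 [measurable]: "(\<lambda>t. K1 t s) \<in> borel_measurable N1" if "s \<in> space M1" for s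
    using measurable_Pair1[OF K(1), of s] that by simp
  have m2 [measurable]: "(\<lambda>t. K2 t s) \<in> borel_measurable N2" if "s \<in> space M2" for s
    using measurable_Pair1[OF K(2), of s] that by simp
  have m3 [measurable]: "(\<lambda>s. K1 t s) \<in> borel_measurable M1" if "t \<in> space N1" for t
    using measurable_Pair2[OF K(1), of t] that by simp
  have m4 [measurable]: "(\<lambda>s. K2 t s) \<in> borel_measurable M2" if "t \<in> space N2" for t
    using measurable_Pair2[OF K(2), of t] that by simp
  have "(\<lambda>z. (\<lambda>(t, s). K1 t s) (fst (fst z), fst (snd z)) * (\<lambda>(t, s). K2 t s) (snd (fst z), snd (snd z)))
     \<in> borel_measurable ((N1 \<Otimes>\<^sub>M N2) \<Otimes>\<^sub>M M1 \<Otimes>\<^sub>M M2)" by measurable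
  then show "(\<lambda>(t, s). K1 (fst t) (fst s) * K2 (snd t) (snd s)) \<in> borel_measurable ((N1 \<Otimes>\<^sub>M N2) \<Otimes>\<^sub>M M1 \<Otimes>\<^sub>M M2)"
    by (simp add: case_prod_beta')
  show "AE s in M1 \<Otimes>\<^sub>M M2. 0 < \<phi>1 (fst s) * \<phi>2 (snd s) \<and> \<phi>1 (fst s) * \<phi>2 (snd s) < top"
    using AE_pair_conj[OF sf(3) \<phi>] by eventually_elim (auto simp: ennreal_mult_less_top ennreal_zero_less_mult_iff)
  show "AE t in N1 \<Otimes>\<^sub>M N2. \<psi>1 (fst t) * \<psi>2 (snd t) < top"
    using AE_pair_conj[OF sf(4) \<psi>] by eventually_elim (auto simp: ennreal_mult_less_top)
  show "AE t in N1 \<Otimes>\<^sub>M N2. (\<integral>\<^sup>+ s. K1 (fst t) (fst s) * K2 (snd t) (snd s) * (\<phi>1 (fst s) * \<phi>2 (snd s)) \<partial>(M1 \<Otimes>\<^sub>M M2))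
        \<le> \<psi>1 (fst t) * \<psi>2 (snd t)"
    using AE_pair_conj[OF sf(4) 1] AE_space
  proof eventually_elim
    case (elim t)
    then have t: "fst t \<in> space N1" "snd t \<in> space N2" by (auto simp: space_pair_measure)
    have "(\<integral>\<^sup>+ s. K1 (fst t) (fst s) * K2 (snd t) (snd s) * (\<phi>1 (fst s) * \<phi>2 (snd s)) \<partial>(M1 \<Otimes>\<^sub>M M2))
      = (\<integral>\<^sup>+ s. (K1 (fst t) (fst s) * \<phi>1 (fst s)) * (K2 (snd t) (snd s) * \<phi>2 (snd s)) \<partial>(M1 \<Otimes>\<^sub>M M2))"
      by (simp add: mult_ac)
    also have "\<dots> = (\<integral>\<^sup>+ s. K1 (fst t) s * \<phi>1 s \<partial>M1) * (\<integral>\<^sup>+ s. K2 (snd t) s * \<phi>2 s \<partial>M2)"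
      by (rule nn_integral_pair_mult) (use sf t in auto)
    also have "\<dots> \<le> \<psi>1 (fst t) * \<psi>2 (snd t)" using elim by (intro mult_mono) auto
    finally show ?case .
  qed
  show "AE s in M1 \<Otimes>\<^sub>M M2. (\<integral>\<^sup>+ t. K1 (fst t) (fst s) * K2 (snd t) (snd s) * ennreal_powr (\<psi>1 (fst t) * \<psi>2 (snd t)) (p - 1) \<partial>(N1 \<Otimes>\<^sub>M N2))
        \<le> B1 * B2 * ennreal_powr (\<phi>1 (fst s) * \<phi>2 (snd s)) (p - 1)"
    using AE_pair_conj[OF sf(3) 2] AE_space
  proof eventually_elim
    case (elim s)
    then have s: "fst s \<in> space M1" "snd s \<in> space M2" by (auto simp: space_pair_measure)
    have "(\<integral>\<^sup>+ t. K1 (fst t) (fst s) * K2 (snd t) (snd s) * ennreal_powr (\<psi>1 (fst t) * \<psi>2 (snd t)) (p - 1) \<partial>(N1 \<Otimes>\<^sub>M N2))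
      = (\<integral>\<^sup>+ t. (K1 (fst t) (fst s) * ennreal_powr (\<psi>1 (fst t)) (p - 1)) * (K2 (snd t) (snd s) * ennreal_powr (\<psi>2 (snd t)) (p - 1)) \<partial>(N1 \<Otimes>\<^sub>M N2))"
      using p by (simp add: mult_ac ennreal_powr_mult)
    also have "\<dots> = (\<integral>\<^sup>+ t. K1 t (fst s) * ennreal_powr (\<psi>1 t) (p - 1) \<partial>N1) * (\<integral>\<^sup>+ t. K2 t (snd s) * ennreal_powr (\<psi>2 t) (p - 1) \<partial>N2)"
      by (rule nn_integral_pair_mult) (use sf s in auto)
    also have "\<dots> \<le> (B1 * ennreal_powr (\<phi>1 (fst s)) (p - 1)) * (B2 * ennreal_powr (\<phi>2 (snd s)) (p - 1))"
      using elim by (intro mult_mono) auto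
    also have "\<dots> = B1 * B2 * ennreal_powr (\<phi>1 (fst s) * \<phi>2 (snd s)) (p - 1)"
      using p by (simp add: ennreal_powr_mult mult_ac)
    finally show ?case .
  qed
qed (use assms in measurable)

section \<open>Hardy-type inequalities for the kernel min(m, 1 / |sin (x / 2)|)\<close>

text \<open>A density instead of a restricted space keeps the whole real line as the space, so that
  periodic functions can be translated freely.\<close>

definition circ :: "real measure" where
  "circ = density lborel (indicator {0..2 * pi})"

text \<open>Index 0 has weight 0, because \<open>1 / 0 = 0\<close>.\<close>

definition wnat :: "nat measure" where
  "wnat = density (count_space UNIV) (\<lambda>m. ennreal (1 / (real m)\<^sup>2))"

text \<open>For \<open>m \<ge> 1\<close> this is \<open>min m (1 / \<bar>sin (x / 2)\<bar>)\<close>, but with the value \<open>m\<close> where the sine vanishes.\<close>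

definition peak :: "nat \<Rightarrow> real \<Rightarrow> real" where
  "peak m x = inverse (max (1 / real m) \<bar>sin (x / 2)\<bar>)"

lemma sets_circ [simp, measurable_cong]: "sets circ = sets borel"
  by (simp add: circ_def)

lemma space_circ [simp]: "space circ = UNIV"
  by (simp add: circ_def)

lemma sets_wnat [simp, measurable_cong]: "sets wnat = sets (count_space UNIV)"
  by (simp add: wnat_def)

lemma space_wnat [simp]: "space wnat = UNIV"
  by (simp add: wnat_def)

lemma sigma_finite_circ: "sigma_finite_measure circ"
  unfolding circ_def by (subst sigma_finite_measure.sigma_finite_iff_density_finite[OF sigma_finite_lborel]) (auto simp: indicator_def)

lemma sigma_finite_wnat: "sigma_finite_measure wnat"
proof -
  interpret C: sigma_finite_measure "count_space (UNIV :: nat set)"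
    by (rule sigma_finite_measure_count_space_countable) simp
  show ?thesis unfolding wnat_def by (subst C.sigma_finite_iff_density_finite) auto
qed

lemma nn_integral_circ: "f \<in> borel_measurable borel \<Longrightarrow>
    (\<integral>\<^sup>+x. f x \<partial>circ) = (\<integral>\<^sup>+x. f x * indicator {0..2 * pi} x \<partial>lborel)"
  by (simp add: circ_def nn_integral_density mult.commute)

lemma nn_integral_wnat: "(\<integral>\<^sup>+m. f m \<partial>wnat) = (\<Sum>m. ennreal (1 / (real m)\<^sup>2) * f m)"
  by (simp add: wnat_def nn_integral_density nn_integral_count_space_nat)

lemma AE_wnat: "AE m in wnat. 0 < m"
  unfolding wnat_def by (subst AE_density) (auto simp: AE_count_space)

lemma AE_circ: "(AE x in lborel. P x) \<Longrightarrow> AE x in circ. P x"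
  unfolding circ_def by (subst AE_density) auto

lemma nn_integral_lborel_shift:
  fixes f :: "real \<Rightarrow> ennreal"
  assumes "f \<in> borel_measurable borel"
  shows "(\<integral>\<^sup>+x. f (x + t) \<partial>lborel) = (\<integral>\<^sup>+x. f x \<partial>lborel)"
  using nn_integral_real_affine[OF assms, of 1 t] by (simp add: add.commute)

lemma periodic_int_multiple:
  fixes g :: "real \<Rightarrow> 'a"
  assumes "\<And>x. g (x + c) = g x"
  shows "g (x + of_int k * c) = g x"
proof -
  have nat: "g (x + of_nat n * c) = g x" for n x
  proof (induction n)
    case (Suc n)
    then show ?case using assms[of "x + of_nat n * c"] by (simp add: algebra_simps)
  qed simp
  show ?thesis
  proof (cases "k \<ge> 0")
    case True
    then show ?thesis using nat[of x "nat k"] by simp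
  next
    case False
    then show ?thesis using nat[of "x + of_int k * c" "nat (- k)"] by simp
  qed
qed

text \<open>Reduce the shift to [0, 2 \<pi>), cut the shifted period at 2 \<pi> and move the
  overhang back by one period.\<close>

lemma nn_integral_circ_shift:
  assumes [measurable]: "g \<in> borel_measurable borel" and per: "\<And>x. g (x + 2 * pi) = g x"
  shows "(\<integral>\<^sup>+x. g (x + t) \<partial>circ) = (\<integral>\<^sup>+x. g x \<partial>circ)"
proof -
  define s where "s = t - of_int \<lfloor>t / (2 * pi)\<rfloor> * (2 * pi)"
  have s: "0 \<le> s" "s < 2 * pi"
    using floor_divide_lower[of "2 * pi" t] floor_divide_upper[of "2 * pi" t]
    by (simp_all add: s_def algebra_simps)
  have gs: "g (x + t) = g (x + s)" for x
    using periodic_int_multiple[of g "2 * pi", OF per, of "x + s" "\<lfloor>t / (2 * pi)\<rfloor>"]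
    by (simp add: s_def algebra_simps)
  \<comment> \<open>Half-open intervals make the pieces fit together without overlap; the endpoint
    is a null set.\<close>
  have half_open: "(\<integral>\<^sup>+x. f x \<partial>circ) = (\<integral>\<^sup>+x. f x * indicator {0..<2 * pi} x \<partial>lborel)"
    if [measurable]: "f \<in> borel_measurable borel" for f
    unfolding nn_integral_circ[OF that]
    using AE_lborel_singleton[of "2 * pi"]
    by (intro nn_integral_cong_AE, eventually_elim) (auto simp: indicator_def)
  have "(\<integral>\<^sup>+x. g (x + t) \<partial>circ) = (\<integral>\<^sup>+x. g (x + s) * indicator {s..<2 * pi + s} (x + s) \<partial>lborel)"
    unfolding gs by (subst half_open) (auto simp: indicator_def intro!: nn_integral_cong)
  also have "\<dots> = (\<integral>\<^sup>+x. g x * indicator {s..<2 * pi + s} x \<partial>lborel)"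
    by (rule nn_integral_lborel_shift) simp
  also have "\<dots> = (\<integral>\<^sup>+x. g x * indicator {s..<2 * pi} x + g x * indicator {2 * pi..<2 * pi + s} x \<partial>lborel)"
    using s by (intro nn_integral_cong) (auto simp: indicator_def)
  also have "\<dots> = (\<integral>\<^sup>+x. g x * indicator {s..<2 * pi} x \<partial>lborel) + (\<integral>\<^sup>+x. g x * indicator {2 * pi..<2 * pi + s} x \<partial>lborel)"
    by (rule nn_integral_add) auto
  also have "(\<integral>\<^sup>+x. g x * indicator {2 * pi..<2 * pi + s} x \<partial>lborel)
     = (\<integral>\<^sup>+x. g (x + 2 * pi) * indicator {2 * pi..<2 * pi + s} (x + 2 * pi) \<partial>lborel)"
    by (rule nn_integral_lborel_shift[symmetric]) simp
  also have "\<dots> = (\<integral>\<^sup>+x. g x * indicator {0..<s} x \<partial>lborel)"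
    by (intro nn_integral_cong) (auto simp: per indicator_def)
  also have "(\<integral>\<^sup>+x. g x * indicator {s..<2 * pi} x \<partial>lborel) + (\<integral>\<^sup>+x. g x * indicator {0..<s} x \<partial>lborel)
    = (\<integral>\<^sup>+x. g x * indicator {s..<2 * pi} x + g x * indicator {0..<s} x \<partial>lborel)"
    by (rule nn_integral_add[symmetric]) auto
  also have "\<dots> = (\<integral>\<^sup>+x. g x * indicator {0..<2 * pi} x \<partial>lborel)"
    using s by (intro nn_integral_cong) (auto simp: indicator_def)
  also have "\<dots> = (\<integral>\<^sup>+x. g x \<partial>circ)" by (rule half_open[symmetric]) simp
  finally show ?thesis .
qed

section \<open>Size of the kernel and its weighted integrals\<close>

lemma sin_ge_Jordan:
  assumes "0 \<le> y" "y \<le> pi / 2" shows "2 * y / pi \<le> sin y"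
proof -
  have "concave_on {0..pi / 2} sin"
    by (rule f''_le0_imp_concave[where f' = cos and f'' = "\<lambda>x. - sin x"])
       (auto intro!: derivative_eq_intros sin_ge_zero)
  then have "(1 - 2 * y / pi) * sin 0 + (2 * y / pi) * sin (pi / 2) \<le> sin ((1 - 2 * y / pi) *\<^sub>R 0 + (2 * y / pi) *\<^sub>R (pi / 2))"
    using assms by (intro concave_onD) (auto simp: field_simps)
  then show ?thesis by simp
qed

lemma abs_sin_half_ge:
  assumes "0 \<le> x" "x \<le> 2 * pi" shows "min x (2 * pi - x) / pi \<le> \<bar>sin (x / 2)\<bar>"
proof (cases "x \<le> pi")
  case True
  then show ?thesis using sin_ge_Jordan[of "x / 2"] assms by (simp add: min_def)
next
  case False
  have "sin ((2 * pi - x) / 2) = sin (x / 2)" by (simp add: diff_divide_distrib)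
  then show ?thesis using False sin_ge_Jordan[of "(2 * pi - x) / 2"] assms
      abs_ge_self[of "sin (x / 2)"] by (simp add: min_def diff_divide_distrib)
qed

lemma peak_nonneg [simp]: "0 \<le> peak m x"
  by (simp add: peak_def le_max_iff_disj)

lemma peak_le_nat: "0 < m \<Longrightarrow> peak m x \<le> real m"
  using le_imp_inverse_le[of "1 / real m" "max (1 / real m) \<bar>sin (x / 2)\<bar>"]
  by (simp add: peak_def)

lemma peak_le_inverse: "sin (x / 2) \<noteq> 0 \<Longrightarrow> peak m x \<le> 1 / \<bar>sin (x / 2)\<bar>"
  using le_imp_inverse_le[of "\<bar>sin (x / 2)\<bar>" "max (1 / real m) \<bar>sin (x / 2)\<bar>"]
  by (simp add: peak_def inverse_eq_divide)

text \<open>A bound by \<open>peak\<close> becomes two estimates free of division, so that zeros of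
  the sine need no separate treatment.\<close>

lemma peak_le_iff: "0 < m \<Longrightarrow> c \<le> peak m x \<longleftrightarrow> c \<le> real m \<and> c * \<bar>sin (x / 2)\<bar> \<le> 1"
proof -
  assume m: "0 < m"
  define M where "M = max (1 / real m) \<bar>sin (x / 2)\<bar>"
  have M: "0 < M" using m by (simp add: M_def less_max_iff_disj)
  have "c \<le> peak m x \<longleftrightarrow> c * M \<le> 1"
    using M by (simp add: peak_def M_def[symmetric] field_simps)
  also have "\<dots> \<longleftrightarrow> c / real m \<le> 1 \<and> c * \<bar>sin (x / 2)\<bar> \<le> 1"
  proof (cases "0 \<le> c")
    case True
    then have "c * M = max (c / real m) (c * \<bar>sin (x / 2)\<bar>)"
      by (simp add: M_def max_mult_distrib_left)
    then show ?thesis by simp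
  next
    case False
    then have "c * M \<le> 0" "c / real m \<le> 0" "c * \<bar>sin (x / 2)\<bar> \<le> 0"
      using M by (auto simp: mult_nonpos_nonneg divide_nonpos_nonneg)
    then show ?thesis by linarith
  qed
  also have "c / real m \<le> 1 \<longleftrightarrow> c \<le> real m" using m by (simp add: field_simps)
  finally show "c \<le> peak m x \<longleftrightarrow> c \<le> real m \<and> c * \<bar>sin (x / 2)\<bar> \<le> 1" .
qed

lemma sin_half_periodic: "\<bar>sin ((x + 2 * pi) / 2)\<bar> = \<bar>sin (x / 2)\<bar>"
  by (simp add: add_divide_distrib)

lemma peak_periodic [simp]: "peak m (x + 2 * pi) = peak m x"
  by (simp add: peak_def sin_half_periodic)

lemma measurable_peak [measurable]:
  assumes [measurable]: "m \<in> measurable M (count_space UNIV)" "f \<in> borel_measurable M"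
  shows "(\<lambda>z. peak (m z) (f z)) \<in> borel_measurable M"
  unfolding peak_def by measurable

text \<open>Scaling: at distance d \<le> \<pi> / m from the peak the kernel is about m, farther out
  about 1 / d. Integrating m d powr (- \<eta>) and d powr (- 1 - \<eta>) over these ranges gives the
  order m powr \<eta> twice; the first integral converges as \<eta> < 1, the second as \<eta> >
  0.\<close>

lemma nn_integral_peak:
  fixes \<eta> :: real
  assumes \<eta>: "0 < \<eta>" "\<eta> < 1" and m: "0 < m"
  shows "(\<integral>\<^sup>+x. ennreal (peak m (x + t) * \<bar>sin ((x + t) / 2)\<bar> powr (- \<eta>)) \<partial>circ)
    \<le> ennreal (2 * pi * (1 / (1 - \<eta>) + 1 / \<eta>) * real m powr \<eta>)"
proof -
  \<comment> \<open>A majorant in terms of the distance d to the nearer end of the period, from |sin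
    (x / 2)| \<ge> d / \<pi>. Extended to the half-line it has explicit integrals; it is used once
    for each end, whence the factor 2.\<close>
  define u where "u d = real m * pi powr \<eta> * (if d \<in> {0..pi / m} then d powr (- \<eta>) else 0)
      + pi powr (1 + \<eta>) * (if d \<in> {pi / m..} then d powr (- 1 - \<eta>) else 0)" for d :: real
  have u0: "0 \<le> u d" for d by (simp add: u_def)
  have [measurable]: "u \<in> borel_measurable borel" unfolding u_def by measurable
  have "((\<lambda>d. if d \<in> {0..pi / m} then d powr (- \<eta>) else 0) has_integral ((pi / m) powr (1 - \<eta>) / (1 - \<eta>))) UNIV"
    using has_integral_powr_from_0[of "- \<eta>" "pi / m"] \<eta> by (subst has_integral_restrict_UNIV) simp
  moreover have "((\<lambda>d. if d \<in> {pi / m..} then d powr (- 1 - \<eta>) else 0) has_integral ((pi / m) powr (- \<eta>) / \<eta>)) UNIV"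
    using has_integral_powr_to_inf[of "- 1 - \<eta>" "pi / m"] \<eta> m by (subst has_integral_restrict_UNIV) simp
  ultimately have "(u has_integral (real m * pi powr \<eta> * ((pi / m) powr (1 - \<eta>) / (1 - \<eta>)) + pi powr (1 + \<eta>) * ((pi / m) powr (- \<eta>) / \<eta>))) UNIV"
    unfolding u_def by (intro has_integral_add has_integral_mult_right)
  also have "real m * pi powr \<eta> * ((pi / m) powr (1 - \<eta>) / (1 - \<eta>)) + pi powr (1 + \<eta>) * ((pi / m) powr (- \<eta>) / \<eta>)
      = pi * (1 / (1 - \<eta>) + 1 / \<eta>) * real m powr \<eta>"
    using m \<eta> by (simp add: powr_divide powr_diff powr_add powr_minus field_simps)
  finally have "(\<integral>\<^sup>+d. ennreal (u d) \<partial>lborel) = ennreal (pi * (1 / (1 - \<eta>) + 1 / \<eta>) * real m powr \<eta>)"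
    by (intro nn_integral_has_integral_lborel u0) auto
  note int_u = this
  have bound: "peak m x * \<bar>sin (x / 2)\<bar> powr (- \<eta>) \<le> u x + u (2 * pi - x)" if x: "0 < x" "x < 2 * pi" for x
  proof -
    define d where "d = min x (2 * pi - x)"
    define s where "s = \<bar>sin (x / 2)\<bar>"
    have d: "0 < d" "d / pi \<le> s" using x abs_sin_half_ge[of x] by (auto simp: d_def s_def)
    then have s: "0 < s" by (smt (verit) divide_pos_pos pi_gt_zero)
    have *: "s powr (- \<eta>) \<le> (d / pi) powr (- \<eta>)"
      using d \<eta> by (intro powr_mono2') auto
    have "peak m x * s powr (- \<eta>) \<le> u d"
    proof (cases "d \<le> pi / m")
      case True
      have "peak m x * s powr (- \<eta>) \<le> real m * (d / pi) powr (- \<eta>)"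
        using * m peak_le_nat[of m x] by (intro mult_mono) auto
      also have "\<dots> = real m * pi powr \<eta> * d powr (- \<eta>)"
        using d by (simp add: powr_divide powr_minus field_simps)
      also have "\<dots> \<le> u d" using True d by (simp add: u_def)
      finally show ?thesis .
    next
      case False
      have "peak m x \<le> 1 / s" using peak_le_inverse[of x m] s by (simp add: s_def)
      also have "\<dots> \<le> 1 / (d / pi)" using d s by (intro divide_left_mono) auto
      finally have "peak m x * s powr (- \<eta>) \<le> 1 / (d / pi) * (d / pi) powr (- \<eta>)"
        using * d by (intro mult_mono) auto
      also have "\<dots> = pi powr (1 + \<eta>) * d powr (- 1 - \<eta>)"
        using d by (simp add: powr_divide powr_minus powr_add powr_diff field_simps)
      also have "\<dots> \<le> u d" using False d by (simp add: u_def)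
      finally show ?thesis .
    qed
    also have "u d \<le> u x + u (2 * pi - x)" using u0 by (auto simp: d_def min_def)
    finally show ?thesis by (simp add: s_def)
  qed
  have "(\<integral>\<^sup>+x. ennreal (peak m (x + t) * \<bar>sin ((x + t) / 2)\<bar> powr (- \<eta>)) \<partial>circ)
    = (\<integral>\<^sup>+x. ennreal (peak m x * \<bar>sin (x / 2)\<bar> powr (- \<eta>)) \<partial>circ)"
    by (rule nn_integral_circ_shift) (use sin_half_periodic in auto)
  also have "\<dots> = (\<integral>\<^sup>+x. ennreal (peak m x * \<bar>sin (x / 2)\<bar> powr (- \<eta>)) * indicator {0..2 * pi} x \<partial>lborel)"
    by (rule nn_integral_circ) simp
  also have "\<dots> \<le> (\<integral>\<^sup>+x. ennreal (u x) + ennreal (u (2 * pi + (-1) * x)) \<partial>lborel)"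
  proof (rule nn_integral_mono_AE, use AE_lborel_singleton[of 0] AE_lborel_singleton[of "2 * pi"] in eventually_elim)
    case (elim x)
    then show ?case
      using bound[of x] u0 by (auto simp: indicator_def less_le simp flip: ennreal_plus intro!: ennreal_leI)
  qed
  also have "\<dots> = (\<integral>\<^sup>+x. ennreal (u x) \<partial>lborel) + (\<integral>\<^sup>+x. ennreal (u (2 * pi + (-1) * x)) \<partial>lborel)"
    by (rule nn_integral_add) auto
  also have "(\<integral>\<^sup>+x. ennreal (u (2 * pi + (-1) * x)) \<partial>lborel) = (\<integral>\<^sup>+x. ennreal (u x) \<partial>lborel)"
    using nn_integral_real_affine[of "\<lambda>x. ennreal (u x)" "-1" "2 * pi"] by simp
  also have "(\<integral>\<^sup>+x. ennreal (u x) \<partial>lborel) + (\<integral>\<^sup>+x. ennreal (u x) \<partial>lborel)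
     = ennreal (2 * pi * (1 / (1 - \<eta>) + 1 / \<eta>) * real m powr \<eta>)"
    unfolding int_u using \<eta> by (subst ennreal_plus[symmetric]) (auto simp: algebra_simps)
  finally show ?thesis .
qed

section \<open>Weighted sums of the kernel over frequencies\<close>

lemma powr_Bernoulli_upper:
  fixes u :: real
  assumes "0 \<le> u" "u < 1" "0 \<le> \<eta>" "\<eta> \<le> 1" shows "(1 - u) powr \<eta> \<le> 1 - \<eta> * u"
  using Youngs_inequality_0[of \<eta> "1 - \<eta>" "1 - u" 1] assms by (simp add: algebra_simps)

lemma powr_Bernoulli_lower:
  fixes u :: real
  assumes "0 \<le> u" "u < 1" "0 \<le> \<theta>" "\<theta> \<le> 1" shows "1 + \<theta> * u \<le> (1 - u) powr (- \<theta>)"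
proof -
  have "0 < (1 - u) powr \<theta>" using assms by simp
  moreover have "(1 + \<theta> * u) * (1 - u) powr \<theta> \<le> (1 + \<theta> * u) * (1 - \<theta> * u)"
    using assms by (intro mult_left_mono powr_Bernoulli_upper) auto
  moreover have "(1 + \<theta> * u) * (1 - \<theta> * u) \<le> 1" using assms by (simp add: algebra_simps)
  ultimately show ?thesis by (simp add: powr_minus field_simps)
qed

text \<open>Comparison with a primitive: the terms are at most m powr (\<eta> - 1) up to the
  crossover N and m powr (\<eta> - 2) / s beyond it. By Bernoulli's inequality the increments of
  \<open>b\<close> dominate them, and the sum telescopes.\<close>

lemma sum_peak_le:
  fixes \<eta> s :: real
  assumes \<eta>: "0 < \<eta>" "\<eta> < 1" and s: "0 < s" "1 \<le> real N * s"
  shows "(\<Sum>m=1..M. 1 / (real m)\<^sup>2 * (min (real m) (1 / s) * real m powr \<eta>))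
    \<le> real N powr \<eta> / \<eta> + real N powr (\<eta> - 1) / s / (1 - \<eta>)"
proof -
  have N: "0 < N" using s by (cases N) auto
  \<comment> \<open>The two branches agree at M = N, which the induction step from N to N + 1
    uses.\<close>
  define b where "b M = (if M \<le> N then real M powr \<eta> / \<eta> else real N powr \<eta> / \<eta> + (real N powr (\<eta> - 1) - real M powr (\<eta> - 1)) / s / (1 - \<eta>))" for M
  have "(\<Sum>m=1..M. 1 / (real m)\<^sup>2 * (min (real m) (1 / s) * real m powr \<eta>)) \<le> b M"
  proof (induction M)
    case 0
    then show ?case using \<eta> by (simp add: b_def)
  next
    case (Suc M)
    define m where "m = real (Suc M)"
    have m: "1 \<le> m" "real M = m - 1" "real M = m * (1 - 1 / m)" by (auto simp: m_def field_simps)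
    have "1 / m\<^sup>2 * (min m (1 / s) * m powr \<eta>) \<le> b (Suc M) - b M"
    proof (cases "Suc M \<le> N")
      case True
      have "1 / m\<^sup>2 * (min m (1 / s) * m powr \<eta>) \<le> 1 / m\<^sup>2 * (m * m powr \<eta>)"
        using m by (intro mult_left_mono mult_right_mono) auto
      also have "\<dots> = m powr \<eta> * (\<eta> * (1 / m)) / \<eta>"
        using m \<eta> by (simp add: power2_eq_square)
      also have "\<dots> \<le> m powr \<eta> * (1 - (1 - 1 / m) powr \<eta>) / \<eta>"
      proof (cases "m = 1")
        case False
        then show ?thesis using powr_Bernoulli_upper[of "1 / m" \<eta>] m \<eta>
          by (intro divide_right_mono mult_left_mono) auto
      qed (use \<eta> in auto)
      also have "\<dots> = b (Suc M) - b M"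
      proof -
        have "real M powr \<eta> = m powr \<eta> * (1 - 1 / m) powr \<eta>"
          unfolding m(3) by (rule powr_mult)
        moreover have "b (Suc M) = m powr \<eta> / \<eta>" "b M = real M powr \<eta> / \<eta>"
          using True by (simp_all add: b_def m_def)
        ultimately show ?thesis by (simp add: right_diff_distrib diff_divide_distrib)
      qed
      finally show ?thesis .
    next
      case False
      then have M: "N \<le> M" by simp
      then have m1: "1 < m" using N by (simp add: m_def)
      have "1 / m\<^sup>2 * (min m (1 / s) * m powr \<eta>) \<le> 1 / m\<^sup>2 * (1 / s * m powr \<eta>)"
        using m by (intro mult_left_mono mult_right_mono) auto
      also have "\<dots> = m powr (\<eta> - 1) * ((1 - \<eta>) * (1 / m)) / s / (1 - \<eta>)"
        using m \<eta> by (simp add: power2_eq_square powr_diff)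
      also have "\<dots> \<le> m powr (\<eta> - 1) * ((1 - 1 / m) powr (\<eta> - 1) - 1) / s / (1 - \<eta>)"
        using powr_Bernoulli_lower[of "1 / m" "1 - \<eta>"] m1 \<eta> s
        by (intro divide_right_mono mult_left_mono) auto
      also have "\<dots> = (real M powr (\<eta> - 1) - m powr (\<eta> - 1)) / s / (1 - \<eta>)"
      proof -
        have "real M powr (\<eta> - 1) = m powr (\<eta> - 1) * (1 - 1 / m) powr (\<eta> - 1)"
          unfolding m(3) by (rule powr_mult)
        then show ?thesis by (simp add: right_diff_distrib)
      qed
      also have "\<dots> = b (Suc M) - b M"
      proof -
        have "b (Suc M) = real N powr \<eta> / \<eta> + (real N powr (\<eta> - 1) - m powr (\<eta> - 1)) / s / (1 - \<eta>)"
          using M by (simp add: b_def m_def)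
        moreover have "b M = real N powr \<eta> / \<eta> + (real N powr (\<eta> - 1) - real M powr (\<eta> - 1)) / s / (1 - \<eta>)"
          using M by (auto simp: b_def)
        ultimately show ?thesis by (simp add: diff_divide_distrib)
      qed
      finally show ?thesis .
    qed
    with Suc show ?case by (simp add: m_def)
  qed
  also have "b M \<le> real N powr \<eta> / \<eta> + real N powr (\<eta> - 1) / s / (1 - \<eta>)"
  proof (cases "M \<le> N")
    case True
    then have "real M powr \<eta> \<le> real N powr \<eta>" using \<eta> by (intro powr_mono2) auto
    with True show ?thesis using \<eta> s by (simp add: b_def add_increasing2 divide_right_mono)
  next
    case False
    then show ?thesis using \<eta> s by (simp add: b_def divide_right_mono)
  qed
  finally show ?thesis .
qed

lemma nn_integral_peak_wnat:
  fixes \<eta> :: real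
  assumes \<eta>: "0 < \<eta>" "\<eta> < 1" and x: "sin (x / 2) \<noteq> 0"
  shows "(\<integral>\<^sup>+m. ennreal (peak m x * real m powr \<eta>) \<partial>wnat)
    \<le> ennreal ((2 / \<eta> + 1 / (1 - \<eta>)) * \<bar>sin (x / 2)\<bar> powr (- \<eta>))"
proof -
  define s where "s = \<bar>sin (x / 2)\<bar>"
  have s: "0 < s" "s \<le> 1" using x by (auto simp: s_def)
  \<comment> \<open>The crossover 1 / s rounded up; s \<le> 1 keeps it below 2 / s, which costs the
    factor 2 in 2 / \<eta>.\<close>
  define N where "N = nat \<lceil>1 / s\<rceil>"
  have N: "1 / s \<le> real N" "real N \<le> 2 / s"
  proof -
    show "1 / s \<le> real N" unfolding N_def by linarith
    have "0 \<le> \<lceil>1 / s\<rceil>" using s by (simp add: order_less_le_trans[of "-1" 0])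
    then have "real N = of_int \<lceil>1 / s\<rceil>" by (simp add: N_def)
    then have "real N \<le> 1 / s + 1" by linarith
    also have "\<dots> \<le> 2 / s" using s by (simp add: field_simps)
    finally show "real N \<le> 2 / s" .
  qed
  have "(\<Sum>m<M. ennreal (1 / (real m)\<^sup>2) * ennreal (peak m x * real m powr \<eta>))
    \<le> ennreal ((2 / \<eta> + 1 / (1 - \<eta>)) * s powr (- \<eta>))" for M
  proof -
    have "(\<Sum>m<M. ennreal (1 / (real m)\<^sup>2) * ennreal (peak m x * real m powr \<eta>))
      = ennreal (\<Sum>m<M. 1 / (real m)\<^sup>2 * (peak m x * real m powr \<eta>))"
      by (subst sum_ennreal[symmetric]) (auto simp flip: ennreal_mult)
    also have "\<dots> \<le> ennreal ((2 / \<eta> + 1 / (1 - \<eta>)) * s powr (- \<eta>))"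
    proof (rule ennreal_leI)
      have "(\<Sum>m<M. 1 / (real m)\<^sup>2 * (peak m x * real m powr \<eta>)) \<le> (\<Sum>m\<in>{1..M}. 1 / (real m)\<^sup>2 * (peak m x * real m powr \<eta>))"
      proof -
        have "(\<Sum>m<M. 1 / (real m)\<^sup>2 * (peak m x * real m powr \<eta>)) = (\<Sum>m\<in>{1..<M}. 1 / (real m)\<^sup>2 * (peak m x * real m powr \<eta>))"
          by (rule sum.mono_neutral_right) auto
        also have "\<dots> \<le> (\<Sum>m\<in>{1..M}. 1 / (real m)\<^sup>2 * (peak m x * real m powr \<eta>))"
          by (rule sum_mono2) auto
        finally show ?thesis .
      qed
      also have "\<dots> \<le> (\<Sum>m=1..M. 1 / (real m)\<^sup>2 * (min (real m) (1 / s) * real m powr \<eta>))"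
        using peak_le_nat peak_le_inverse[OF x]
        by (intro sum_mono mult_left_mono mult_right_mono) (auto simp: s_def)
      also have "\<dots> \<le> real N powr \<eta> / \<eta> + real N powr (\<eta> - 1) / s / (1 - \<eta>)"
        using \<eta> s N by (intro sum_peak_le) (auto simp: field_simps)
      also have "\<dots> \<le> (2 / s) powr \<eta> / \<eta> + (1 / s) powr (\<eta> - 1) / s / (1 - \<eta>)"
        using \<eta> s N by (intro add_mono divide_right_mono powr_mono2 powr_mono2') auto
      also have "\<dots> \<le> (2 / \<eta> + 1 / (1 - \<eta>)) * s powr (- \<eta>)"
      proof -
        have "2 powr \<eta> \<le> 2 powr (1::real)" using \<eta> by (intro powr_mono) auto
        then have "2 powr \<eta> * s powr (- \<eta>) \<le> 2 * s powr (- \<eta>)" by (intro mult_right_mono) auto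
        moreover have "(2 / s) powr \<eta> = 2 powr \<eta> * s powr (- \<eta>)" 
          using s by (simp add: powr_divide powr_minus field_simps)
        moreover have "(1 / s) powr (\<eta> - 1) / s = s powr (- \<eta>)"
          using s by (simp add: powr_divide powr_minus powr_diff field_simps)
        ultimately show ?thesis using \<eta> by (simp add: distrib_right divide_right_mono)
      qed
      finally show "(\<Sum>m<M. 1 / (real m)\<^sup>2 * (peak m x * real m powr \<eta>)) \<le> (2 / \<eta> + 1 / (1 - \<eta>)) * s powr (- \<eta>)" .
    qed
    finally show ?thesis .
  qed
  then show ?thesis
    unfolding nn_integral_wnat s_def[symmetric] by (intro suminf_le_const) (auto simp: )
qed


section \<open>The Schur test for the kernel\<close>

lemma AE_sin_half_nonzero: "AE x in circ. sin ((x + t) / 2) \<noteq> 0"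
proof (rule AE_circ)
  have "countable ((\<lambda>k. 2 * (of_int k * pi) - t) ` (UNIV :: int set))" by simp
  then have "AE x in lborel. x \<notin> (\<lambda>k. 2 * (of_int k * pi) - t) ` (UNIV :: int set)"
    by (intro AE_not_in countable_imp_null_set_lborel)
  then show "AE x in lborel. sin ((x + t) / 2) \<noteq> 0"
  proof eventually_elim
    case (elim x)
    show ?case
    proof
      assume "sin ((x + t) / 2) = 0"
      then obtain i :: int where "(x + t) / 2 = of_int i * pi" by (auto simp: sin_zero_iff_int2)
      then have "x = 2 * (of_int i * pi) - t" by simp
      with elim show False by blast
    qed
  qed
qed

text \<open>With \<phi> and \<psi> the powers \<open>m powr (1 / p)\<close> and \<open>\<bar>sin (x / 2)\<bar> powr (- 1 / p)\<close>, the kernel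
  \<^const>\<open>peak\<close> passes the Schur test in both directions.\<close>

lemma Schur_down:
  fixes p :: real
  assumes p: "1 < p"
  obtains B :: real where "0 < B" and "\<And>t1 t2 g. g \<in> borel_measurable (circ \<Otimes>\<^sub>M circ) \<Longrightarrow>
    (\<integral>\<^sup>+k. ennreal_powr (\<integral>\<^sup>+z. ennreal (peak (fst k) (fst z + t1)) * ennreal (peak (snd k) (snd z + t2)) * g z
        \<partial>(circ \<Otimes>\<^sub>M circ)) p \<partial>(wnat \<Otimes>\<^sub>M wnat))
     \<le> ennreal B * (\<integral>\<^sup>+z. ennreal_powr (g z) p \<partial>(circ \<Otimes>\<^sub>M circ))"
proof -
  \<comment> \<open>This exponent makes \<eta> (p - 1) = 1 - \<eta>, so a test function raised to p
    - 1 again has an exponent in (0, 1), and both kernel estimates apply.\<close>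
  define \<eta> where "\<eta> = 1 / p"
  have \<eta>: "0 < \<eta>" "\<eta> < 1" "0 < 1 - \<eta>" "1 - \<eta> < 1" "\<eta> * (p - 1) = 1 - \<eta>"
    using p by (auto simp: \<eta>_def field_simps)
  define A where "A = 2 * pi * (1 / (1 - \<eta>) + 1 / \<eta>)"
  have A: "0 < A" using \<eta> by (simp add: A_def add_pos_pos)
  define B where "B = A powr (p - 1) * (2 / (1 - \<eta>) + 1 / \<eta>)"
  have B: "0 < B" using \<eta> A by (simp add: B_def add_pos_pos)
  define \<phi> where "\<phi> t x = ennreal (\<bar>sin ((x + t) / 2)\<bar> powr (- \<eta>))" for t x :: real
  define \<psi> where "\<psi> m = ennreal (A * real m powr \<eta>)" for m :: nat
  have [measurable]: "\<phi> t \<in> borel_measurable circ" for t unfolding \<phi>_def by measurable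
  have nz: "AE x in circ. sin ((x + t) / 2) \<noteq> 0" for t
    by (rule AE_sin_half_nonzero)
  have 1: "AE m in wnat. (\<integral>\<^sup>+x. ennreal (peak m (x + t)) * \<phi> t x \<partial>circ) \<le> \<psi> m" for t
    using AE_wnat
  proof eventually_elim
    case (elim m)
    then show ?case
      using nn_integral_peak[OF \<eta>(1,2) elim, of t] by (simp add: \<phi>_def \<psi>_def A_def ennreal_mult)
  qed
  have 2: "AE x in circ. (\<integral>\<^sup>+m. ennreal (peak m (x + t)) * ennreal_powr (\<psi> m) (p - 1) \<partial>wnat) 
      \<le> ennreal B * ennreal_powr (\<phi> t x) (p - 1)" for t
    using nz[of t]
  proof eventually_elim
    case (elim x)
    have "(\<integral>\<^sup>+m. ennreal (peak m (x + t)) * ennreal_powr (\<psi> m) (p - 1) \<partial>wnat)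
      = (\<integral>\<^sup>+m. ennreal (A powr (p - 1)) * ennreal (peak m (x + t) * real m powr (1 - \<eta>)) \<partial>wnat)"
      using A \<eta> p by (intro nn_integral_cong)
        (simp add: \<psi>_def ennreal_powr_ennreal powr_mult powr_powr mult_ac flip: ennreal_mult)
    also have "\<dots> = ennreal (A powr (p - 1)) * (\<integral>\<^sup>+m. ennreal (peak m (x + t) * real m powr (1 - \<eta>)) \<partial>wnat)"
      by (rule nn_integral_cmult) simp
    also have "\<dots> \<le> ennreal (A powr (p - 1)) * ennreal ((2 / (1 - \<eta>) + 1 / \<eta>) * \<bar>sin ((x + t) / 2)\<bar> powr (- (1 - \<eta>)))"
      using nn_integral_peak_wnat[OF \<eta>(3,4) elim] by (intro mult_left_mono) auto
    also have "\<dots> = ennreal B * ennreal_powr (\<phi> t x) (p - 1)"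
    proof -
      have "- (1 - \<eta>) = - \<eta> * (p - 1)" using \<eta>(5) by simp
      then show ?thesis using B \<eta>
        by (simp only: \<phi>_def) (simp add: ennreal_powr_ennreal powr_powr B_def mult_ac flip: ennreal_mult)
    qed
    finally show ?case .
  qed
  show thesis
  proof (rule that[of "B * B"])
    show "0 < B * B" using B by simp
    fix t1 t2 and g :: "real \<times> real \<Rightarrow> ennreal" assume [measurable]: "g \<in> borel_measurable (circ \<Otimes>\<^sub>M circ)"
    have [simp]: "ennreal (B * B) = ennreal B * ennreal B" using B by (simp add: ennreal_mult)
    show "(\<integral>\<^sup>+k. ennreal_powr (\<integral>\<^sup>+z. ennreal (peak (fst k) (fst z + t1)) * ennreal (peak (snd k) (snd z + t2)) * g z
        \<partial>(circ \<Otimes>\<^sub>M circ)) p \<partial>(wnat \<Otimes>\<^sub>M wnat))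
     \<le> ennreal (B * B) * (\<integral>\<^sup>+z. ennreal_powr (g z) p \<partial>(circ \<Otimes>\<^sub>M circ))"
      unfolding \<open>ennreal (B * B) = ennreal B * ennreal B\<close>
    proof (rule Schur_test_product[OF p sigma_finite_circ sigma_finite_wnat sigma_finite_circ sigma_finite_wnat,
        where ?\<phi>1.0 = "\<phi> t1" and ?\<phi>2.0 = "\<phi> t2" and ?\<psi>1.0 = \<psi> and ?\<psi>2.0 = \<psi> and ?K1.0 = "\<lambda>m x. ennreal (peak m (x + t1))"
        and ?K2.0 = "\<lambda>m x. ennreal (peak m (x + t2))"])
      have "AE x in circ. 0 < \<phi> t x \<and> \<phi> t x < top" for t
        using nz[of t] by eventually_elim (simp add: \<phi>_def)
      then show "AE x in circ. 0 < \<phi> t1 x \<and> \<phi> t1 x < top" "AE x in circ. 0 < \<phi> t2 x \<and> \<phi> t2 x < top" by auto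
    qed (use 1 2 in \<open>simp_all add: \<psi>_def case_prod_beta'\<close>)
  qed
qed

text \<open>\<open>B\<close> is fixed before the translations \<open>t1\<close> and
  \<open>t2\<close>; this uniformity permits averaging over infinitely many translates.\<close>

lemma Schur_up:
  fixes p :: real
  assumes p: "1 < p"
  obtains B :: real where "0 < B" and "\<And>t1 t2 g. g \<in> borel_measurable (wnat \<Otimes>\<^sub>M wnat) \<Longrightarrow>
    (\<integral>\<^sup>+z. ennreal_powr (\<integral>\<^sup>+k. ennreal (peak (fst k) (fst z + t1)) * ennreal (peak (snd k) (snd z + t2)) * g k
        \<partial>(wnat \<Otimes>\<^sub>M wnat)) p \<partial>(circ \<Otimes>\<^sub>M circ))
     \<le> ennreal B * (\<integral>\<^sup>+k. ennreal_powr (g k) p \<partial>(wnat \<Otimes>\<^sub>M wnat))"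
proof -
  define \<eta> where "\<eta> = 1 / p"
  have \<eta>: "0 < \<eta>" "\<eta> < 1" "0 < 1 - \<eta>" "1 - \<eta> < 1" "\<eta> * (p - 1) = 1 - \<eta>"
    using p by (auto simp: \<eta>_def field_simps)
  define A where "A = 2 / \<eta> + 1 / (1 - \<eta>)"
  have A: "0 < A" using \<eta> by (simp add: A_def add_pos_pos)
  define B where "B = A powr (p - 1) * (2 * pi * (1 / \<eta> + 1 / (1 - \<eta>)))"
  have B: "0 < B" using \<eta> A by (simp add: B_def add_pos_pos)
  define \<psi> where "\<psi> t x = ennreal (A * \<bar>sin ((x + t) / 2)\<bar> powr (- \<eta>))" for t x :: real
  define \<phi> where "\<phi> m = ennreal (real m powr \<eta>)" for m :: nat
  have [measurable]: "\<psi> t \<in> borel_measurable circ" for t unfolding \<psi>_def by measurable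
  have nz: "AE x in circ. sin ((x + t) / 2) \<noteq> 0" for t
    by (rule AE_sin_half_nonzero)
  have 1: "AE x in circ. (\<integral>\<^sup>+m. ennreal (peak m (x + t)) * \<phi> m \<partial>wnat) \<le> \<psi> t x" for t
    using nz[of t]
  proof eventually_elim
    case (elim x)
    then show ?case
      using nn_integral_peak_wnat[OF \<eta>(1,2) elim] by (simp add: \<phi>_def \<psi>_def A_def ennreal_mult)
  qed
  have 2: "AE m in wnat. (\<integral>\<^sup>+x. ennreal (peak m (x + t)) * ennreal_powr (\<psi> t x) (p - 1) \<partial>circ) 
      \<le> ennreal B * ennreal_powr (\<phi> m) (p - 1)" for t
    using AE_wnat
  proof eventually_elim
    case (elim m)
    have e: "- \<eta> * (p - 1) = - (1 - \<eta>)" using \<eta>(5) by simp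
    have "(\<integral>\<^sup>+x. ennreal (peak m (x + t)) * ennreal_powr (\<psi> t x) (p - 1) \<partial>circ)
      = (\<integral>\<^sup>+x. ennreal (A powr (p - 1)) * ennreal (peak m (x + t) * \<bar>sin ((x + t) / 2)\<bar> powr (- (1 - \<eta>))) \<partial>circ)"
      using A \<eta> p by (intro nn_integral_cong)
        (simp only: \<psi>_def flip: e, simp add: ennreal_powr_ennreal powr_mult powr_powr mult_ac flip: ennreal_mult)
    also have "\<dots> = ennreal (A powr (p - 1)) * (\<integral>\<^sup>+x. ennreal (peak m (x + t) * \<bar>sin ((x + t) / 2)\<bar> powr (- (1 - \<eta>))) \<partial>circ)"
      by (rule nn_integral_cmult) simp
    also have "\<dots> \<le> ennreal (A powr (p - 1)) * ennreal (2 * pi * (1 / (1 - (1 - \<eta>)) + 1 / (1 - \<eta>)) * real m powr (1 - \<eta>))"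
      using nn_integral_peak[OF \<eta>(3,4) elim, of t] by (intro mult_left_mono) auto
    also have "\<dots> = ennreal B * ennreal_powr (\<phi> m) (p - 1)"
      using B \<eta> by (simp add: \<phi>_def ennreal_powr_ennreal powr_powr B_def mult_ac flip: ennreal_mult)
    finally show ?case .
  qed
  show thesis
  proof (rule that[of "B * B"])
    show "0 < B * B" using B by simp
    fix t1 t2 and g :: "nat \<times> nat \<Rightarrow> ennreal" assume [measurable]: "g \<in> borel_measurable (wnat \<Otimes>\<^sub>M wnat)"
    have [simp]: "ennreal (B * B) = ennreal B * ennreal B" using B by (simp add: ennreal_mult)
    show "(\<integral>\<^sup>+z. ennreal_powr (\<integral>\<^sup>+k. ennreal (peak (fst k) (fst z + t1)) * ennreal (peak (snd k) (snd z + t2)) * g k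
        \<partial>(wnat \<Otimes>\<^sub>M wnat)) p \<partial>(circ \<Otimes>\<^sub>M circ))
     \<le> ennreal (B * B) * (\<integral>\<^sup>+k. ennreal_powr (g k) p \<partial>(wnat \<Otimes>\<^sub>M wnat))"
      unfolding \<open>ennreal (B * B) = ennreal B * ennreal B\<close>
    proof (rule Schur_test_product[OF p sigma_finite_wnat sigma_finite_circ sigma_finite_wnat sigma_finite_circ,
        where ?\<psi>1.0 = "\<psi> t1" and ?\<psi>2.0 = "\<psi> t2" and ?\<phi>1.0 = \<phi> and ?\<phi>2.0 = \<phi> and ?K1.0 = "\<lambda>x m. ennreal (peak m (x + t1))"
        and ?K2.0 = "\<lambda>x m. ennreal (peak m (x + t2))"])
      have "AE m in wnat. 0 < \<phi> m \<and> \<phi> m < top"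
        using AE_wnat by eventually_elim (simp add: \<phi>_def)
      then show "AE m in wnat. 0 < \<phi> m \<and> \<phi> m < top" "AE m in wnat. 0 < \<phi> m \<and> \<phi> m < top" by auto
    qed (use 1 2 in \<open>simp_all add: \<psi>_def case_prod_beta'\<close>)
  qed
qed

section \<open>Fractional differences of Dirichlet kernels\<close>

text \<open>The coefficients of the power series of (1 - z) powr \<alpha>.\<close>

definition binc :: "real \<Rightarrow> nat \<Rightarrow> real" where
  "binc \<alpha> \<nu> = (- 1) ^ \<nu> * (\<alpha> gchoose \<nu>)"

lemma binc_Suc: "real (Suc \<nu>) * binc \<alpha> (Suc \<nu>) = (real \<nu> - \<alpha>) * binc \<alpha> \<nu>"
proof -
  have "real (Suc \<nu>) * (\<alpha> gchoose Suc \<nu>) = (\<alpha> - real \<nu>) * (\<alpha> gchoose \<nu>)"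
    using gbinomial_mult_1[of \<alpha> \<nu>] by (simp add: algebra_simps)
  moreover have "real (Suc \<nu>) * binc \<alpha> (Suc \<nu>) = - ((- 1) ^ \<nu> * (real (Suc \<nu>) * (\<alpha> gchoose Suc \<nu>)))"
    by (simp add: binc_def)
  ultimately show ?thesis by (simp only: binc_def) (simp add: algebra_simps)
qed

text \<open>Past \<alpha> the recursion makes \<nu> |binc \<alpha> \<nu>| decrease by exactly
  \<alpha> |binc \<alpha> \<nu>| at each step, so the tail telescopes.\<close>

lemma summable_binc:
  assumes \<alpha>: "0 < \<alpha>" shows "summable (\<lambda>\<nu>. \<bar>binc \<alpha> \<nu>\<bar>)"
proof -
  define N where "N = nat \<lceil>\<alpha>\<rceil>"
  have N: "\<alpha> \<le> real N" unfolding N_def by linarith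
  define d where "d k = real (k + N) * \<bar>binc \<alpha> (k + N)\<bar>" for k
  have d: "d (Suc k) = d k - \<alpha> * \<bar>binc \<alpha> (k + N)\<bar>" for k
  proof -
    have "d (Suc k) = \<bar>real (Suc (k + N)) * binc \<alpha> (Suc (k + N))\<bar>"
      by (simp add: d_def abs_mult)
    also have "\<dots> = (real (k + N) - \<alpha>) * \<bar>binc \<alpha> (k + N)\<bar>"
      unfolding binc_Suc using N by (simp add: abs_mult)
    finally show ?thesis by (simp add: d_def algebra_simps)
  qed
  have "(\<Sum>k<n. \<bar>binc \<alpha> (k + N)\<bar>) = (d 0 - d n) / \<alpha>" for n
    using \<alpha> by (induction n) (auto simp: d field_simps)
  moreover have "0 \<le> d n" for n by (simp add: d_def)
  ultimately have "(\<Sum>k<n. \<bar>binc \<alpha> (k + N)\<bar>) \<le> d 0 / \<alpha>" for n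
    using \<alpha> by (simp add: divide_right_mono)
  then have "summable (\<lambda>k. \<bar>binc \<alpha> (k + N)\<bar>)"
    by (intro summableI_nonneg_bounded) auto
  then show ?thesis by (simp only: summable_iff_shift[of "\<lambda>\<nu>. \<bar>binc \<alpha> \<nu>\<bar>"])
qed

lemma binc_sums_interior:
  fixes z :: complex
  assumes "norm z < 1"
  shows "(\<lambda>\<nu>. of_real (binc \<alpha> \<nu>) * z ^ \<nu>) sums ((1 - z) powr of_real \<alpha>)"
proof -
  have "(of_real \<alpha> gchoose n :: complex) = of_real (\<alpha> gchoose n)" for n
    by (simp add: gbinomial_prod_rev)
  then show ?thesis
    using gen_binomial_complex[of "- z" "of_real \<alpha>"] assms
    by (simp add: binc_def power_minus[of z] mult_ac)
qed

text \<open>Abel summation extends the binomial series to the unit circle, where it still converges absolutely.\<close>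

lemma suminf_binc_cis:
  assumes \<alpha>: "0 < \<alpha>"
  shows "(\<Sum>\<nu>. of_real (binc \<alpha> \<nu>) * cis \<theta> ^ \<nu>) = (1 - cis \<theta>) powr of_real \<alpha>"
proof -
  have ev: "eventually (\<lambda>r. r \<in> {0<..<1::real}) (at_left 1)"
    by (rule eventually_at_left_real) simp
  have "((\<lambda>r. \<Sum>\<nu>. of_real (binc \<alpha> \<nu>) * (of_real r * cis \<theta>) ^ \<nu>) \<longlongrightarrow>
      (\<Sum>\<nu>. of_real (binc \<alpha> \<nu>) * cis \<theta> ^ \<nu>)) (at_left 1)"
  proof (rule conjunct2[OF conjunct2[OF tannerys_theorem[where M="\<lambda>\<nu>. \<bar>binc \<alpha> \<nu>\<bar>"]]])
    show "((\<lambda>r. of_real (binc \<alpha> \<nu>) * (of_real r * cis \<theta>) ^ \<nu>) \<longlongrightarrow> of_real (binc \<alpha> \<nu>) * cis \<theta> ^ \<nu>) (at_left 1)" for \<nu>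
      by (auto intro!: tendsto_eq_intros)
    have "\<forall>\<^sub>F x in at_top \<times>\<^sub>F at_left 1. snd x \<in> {0<..<1::real}"
      by (rule eventually_compose_filterlim[OF ev filterlim_snd])
    then show "\<forall>\<^sub>F (k, r) in at_top \<times>\<^sub>F at_left 1. norm (complex_of_real (binc \<alpha> k) * (of_real r * cis \<theta>) ^ k) \<le> \<bar>binc \<alpha> k\<bar>"
    proof eventually_elim
      case (elim x)
      then have "\<bar>binc \<alpha> (fst x)\<bar> * snd x ^ fst x \<le> \<bar>binc \<alpha> (fst x)\<bar>"
        by (intro mult_left_le power_le_one) auto
      with elim show ?case by (simp add: case_prod_beta norm_mult norm_power)
    qed
  qed (use summable_binc[OF \<alpha>] in auto)
  moreover have "((\<lambda>r. \<Sum>\<nu>. of_real (binc \<alpha> \<nu>) * (of_real r * cis \<theta>) ^ \<nu>) \<longlongrightarrow> (1 - cis \<theta>) powr of_real \<alpha>) (at_left 1)"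
  proof (rule Lim_transform_eventually)
    show "\<forall>\<^sub>F r in at_left 1. (1 - of_real r * cis \<theta>) powr of_real \<alpha> = (\<Sum>\<nu>. of_real (binc \<alpha> \<nu>) * (of_real r * cis \<theta>) ^ \<nu>)"
      using ev
    proof eventually_elim
      case (elim r)
      then show ?case
        using binc_sums_interior[of "of_real r * cis \<theta>" \<alpha>] by (simp add: norm_mult sums_iff)
    qed
    show "((\<lambda>r. (1 - of_real r * cis \<theta>) powr of_real \<alpha>) \<longlongrightarrow> (1 - cis \<theta>) powr of_real \<alpha>) (at_left 1)"
    \<comment> \<open>At cis \<theta> = 1 the base tends to 0, and \<alpha> > 0 gives the limit;
      elsewhere a positive real part keeps the base off the branch cut.\<close>
    proof (cases "cis \<theta> = 1")
      case True
      have "((\<lambda>r. 1 - complex_of_real r) \<longlongrightarrow> 0) (at_left 1)" by (auto intro!: tendsto_eq_intros)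
      then have "((\<lambda>r. (1 - complex_of_real r) powr of_real \<alpha>) \<longlongrightarrow> 0) (at_left 1)"
        using \<alpha> by (intro tendsto_powr_complex_0[where b = "of_real \<alpha>"]) auto
      with True show ?thesis by simp
    next
      case False
      have "cos \<theta> \<noteq> 1"
      proof
        assume "cos \<theta> = 1"
        moreover from this have "sin \<theta> = 0" using sin_cos_squared_add[of \<theta>] by simp
        ultimately show False using False by (simp add: complex_eq_iff)
      qed
      then have "0 < Re (1 - cis \<theta>)" using cos_le_one[of \<theta>] by (simp del: cos_le_one)
      then have "1 - cis \<theta> \<notin> \<real>\<^sub>\<le>\<^sub>0" by (auto simp: complex_nonpos_Reals_iff)
      then show ?thesis by (intro tendsto_powr_complex) (auto intro!: tendsto_eq_intros)
    qed
  qed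
  ultimately show ?thesis by (intro tendsto_unique) auto
qed

section \<open>The Fourier multiplier of the fractional difference\<close>

definition diff_mult :: "real \<Rightarrow> real \<Rightarrow> nat \<Rightarrow> complex" where
  "diff_mult \<alpha> h j = (\<Sum>\<nu>. of_real (binc \<alpha> \<nu>) * cis (real j * ((\<alpha> - real \<nu>) * h)))"

lemma summable_binc_mult:
  fixes g :: "nat \<Rightarrow> 'a::{real_normed_algebra_1, banach}"
  assumes "0 < \<alpha>" "\<And>\<nu>. norm (g \<nu>) \<le> B"
  shows "summable (\<lambda>\<nu>. of_real (binc \<alpha> \<nu>) * g \<nu>)"
proof (rule summable_comparison_test)
  show "\<exists>N. \<forall>n\<ge>N. norm (of_real (binc \<alpha> n) * g n) \<le> \<bar>binc \<alpha> n\<bar> * B"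
    using assms(2) by (auto intro!: exI[of _ 0] order.trans[OF norm_mult_ineq] mult_left_mono)
  show "summable (\<lambda>n. \<bar>binc \<alpha> n\<bar> * B)" by (intro summable_mult2 summable_binc assms)
qed

lemma diff_mult_eq:
  assumes "0 < \<alpha>"
  shows "diff_mult \<alpha> h j = cis (real j * \<alpha> * h) * (1 - cis (- (real j * h))) powr of_real \<alpha>"
proof -
  have "(of_real (binc \<alpha> \<nu>) * cis (real j * ((\<alpha> - real \<nu>) * h)))
      = cis (real j * \<alpha> * h) * (of_real (binc \<alpha> \<nu>) * cis (- (real j * h)) ^ \<nu>)" for \<nu>
  proof -
    have "cis (- (real j * h)) ^ \<nu> = cis (- (real \<nu> * (real j * h)))" by (simp add: Complex.DeMoivre)
    moreover have "cis (real j * ((\<alpha> - real \<nu>) * h)) = cis (real j * \<alpha> * h) * cis (- (real \<nu> * (real j * h)))"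
      by (simp add: cis_mult algebra_simps)
    ultimately show ?thesis by (simp add: mult_ac)
  qed
  moreover have "summable (\<lambda>\<nu>. of_real (binc \<alpha> \<nu>) * cis (- (real j * h)) ^ \<nu>)"
    by (rule summable_binc_mult[OF assms, of _ 1]) (simp add: norm_power)
  ultimately show ?thesis
    unfolding diff_mult_def by (simp only: suminf_mult suminf_binc_cis[OF assms])
qed

lemma cis_add_cnj_diff: "1 - cis (- x) = of_real (2 * sin (x / 2)) * cis (pi / 2 - x / 2)"
  using sin_cos_squared_add[of "x / 2"]
  by (simp add: complex_eq_iff cos_diff sin_diff power2_eq_square cos_double[of "x / 2", simplified] sin_double[of "x / 2", simplified])

text \<open>Inside one period the principal argument of 1 - cis (- x) is \<pi> / 2 - x / 2, and the
  power multiplies it by \<alpha>. Together with the leading factor the phase becomes affine in j: a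
  translation by \<alpha> h / 2 and the constant \<alpha> \<pi> / 2.\<close>

lemma diff_mult_pos:
  assumes \<alpha>: "0 < \<alpha>" and jh: "0 < real j * h" "real j * h < 2 * pi"
  shows "diff_mult \<alpha> h j = of_real ((2 * sin (real j * h / 2)) powr \<alpha>) * cis (real j * \<alpha> * h / 2 + \<alpha> * pi / 2)"
proof -
  define x where "x = real j * h"
  have s: "0 < 2 * sin (x / 2)" using jh by (simp add: x_def sin_gt_zero)
  have "1 - cis (- x) = exp (of_real (ln (2 * sin (x / 2))) + \<i> * of_real (pi / 2 - x / 2))"
  proof -
    have "exp (complex_of_real (ln (2 * sin (x / 2)))) = of_real (2 * sin (x / 2))"
      using s by (simp add: exp_of_real)
    then show ?thesis unfolding cis_add_cnj_diff exp_add by (simp only: cis_conv_exp)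
  qed
  then have "Ln (1 - cis (- x)) = of_real (ln (2 * sin (x / 2))) + \<i> * of_real (pi / 2 - x / 2)"
    using jh by (simp add: x_def)
  moreover have "1 - cis (- x) \<noteq> 0" using s unfolding cis_add_cnj_diff by simp
  ultimately have "(1 - cis (- x)) powr of_real \<alpha> = exp (of_real \<alpha> * (of_real (ln (2 * sin (x / 2))) + \<i> * of_real (pi / 2 - x / 2)))"
    by (simp add: powr_def)
  also have "\<dots> = exp (of_real (\<alpha> * ln (2 * sin (x / 2)))) * exp (\<i> * of_real (\<alpha> * (pi / 2 - x / 2)))"
    by (simp add: exp_add[symmetric] algebra_simps)
  also have "\<dots> = of_real ((2 * sin (x / 2)) powr \<alpha>) * cis (\<alpha> * (pi / 2 - x / 2))"
    using s by (simp only: exp_of_real powr_def cis_conv_exp) simp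
  finally have "(1 - cis (- x)) powr of_real \<alpha> = of_real ((2 * sin (x / 2)) powr \<alpha>) * cis (\<alpha> * (pi / 2 - x / 2))" .
  moreover have "cis (real j * \<alpha> * h) * cis (\<alpha> * (pi / 2 - x / 2)) = cis (real j * \<alpha> * h / 2 + \<alpha> * pi / 2)"
    by (simp add: cis_mult x_def field_simps)
  ultimately show ?thesis
    unfolding diff_mult_eq[OF \<alpha>] x_def by (simp add: mult_ac)
qed

lemma norm_diff_mult:
  assumes "0 < \<alpha>" shows "norm (diff_mult \<alpha> h j) = (2 * \<bar>sin (real j * h / 2)\<bar>) powr \<alpha>"
  unfolding diff_mult_eq[OF assms] cis_add_cnj_diff
  by (simp add: norm_mult norm_powr_real_powr' abs_mult)

lemma diff_mult_0: "0 < \<alpha> \<Longrightarrow> diff_mult \<alpha> 0 j = 0"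
  using norm_diff_mult[of \<alpha> 0 j] by simp

text \<open>The first form describes the difference of a cosine; the second, with the conjugate
  multiplier, arises when the shifts are moved to a test function.\<close>

lemma suminf_binc_cos:
  assumes "0 < \<alpha>"
  shows "(\<Sum>\<nu>. binc \<alpha> \<nu> * cos (y + real j * ((\<alpha> - real \<nu>) * h))) = Re (cis y * diff_mult \<alpha> h j)"
    and "(\<Sum>\<nu>. binc \<alpha> \<nu> * cos (y - real j * ((\<alpha> - real \<nu>) * h))) = Re (cis y * cnj (diff_mult \<alpha> h j))"
proof -
  have Re_plus: "Re (cis y * (complex_of_real b * cis t)) = b * cos (y + t)" for b t
    by (simp add: cos_add algebra_simps)
  have Re_minus: "Re (cis y * cnj (complex_of_real b * cis t)) = b * cos (y - t)" for b t
    by (simp add: cos_diff algebra_simps)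
  have "summable (\<lambda>\<nu>. complex_of_real (binc \<alpha> \<nu>) * cis (real j * ((\<alpha> - real \<nu>) * h)))"
    by (rule summable_binc_mult[OF assms, of _ 1]) simp
  then have *: "(\<lambda>\<nu>. complex_of_real (binc \<alpha> \<nu>) * cis (real j * ((\<alpha> - real \<nu>) * h))) sums diff_mult \<alpha> h j"
    by (simp add: diff_mult_def summable_sums)
  have "(\<lambda>\<nu>. Re (cis y * (complex_of_real (binc \<alpha> \<nu>) * cis (real j * ((\<alpha> - real \<nu>) * h))))) sums Re (cis y * diff_mult \<alpha> h j)"
    by (intro sums_Re sums_mult *)
  moreover have "Re (cis y * (complex_of_real (binc \<alpha> \<nu>) * cis (real j * ((\<alpha> - real \<nu>) * h)))) = binc \<alpha> \<nu> * cos (y + real j * ((\<alpha> - real \<nu>) * h))" for \<nu>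
    by (rule Re_plus)
  ultimately show "(\<Sum>\<nu>. binc \<alpha> \<nu> * cos (y + real j * ((\<alpha> - real \<nu>) * h))) = Re (cis y * diff_mult \<alpha> h j)"
    by (simp add: sums_iff)
  have "(\<lambda>\<nu>. Re (cis y * cnj (complex_of_real (binc \<alpha> \<nu>) * cis (real j * ((\<alpha> - real \<nu>) * h))))) sums Re (cis y * cnj (diff_mult \<alpha> h j))"
    using * by (intro sums_Re sums_mult) (simp only: sums_cnj)
  moreover have "Re (cis y * cnj (complex_of_real (binc \<alpha> \<nu>) * cis (real j * ((\<alpha> - real \<nu>) * h)))) = binc \<alpha> \<nu> * cos (y - real j * ((\<alpha> - real \<nu>) * h))" for \<nu>
    by (rule Re_minus)
  ultimately show "(\<Sum>\<nu>. binc \<alpha> \<nu> * cos (y - real j * ((\<alpha> - real \<nu>) * h))) = Re (cis y * cnj (diff_mult \<alpha> h j))"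
    by (simp add: sums_iff)
qed

section \<open>Bounds for Dirichlet kernels and their differences\<close>

lemma sum_cos_times_sin:
  "2 * sin (z / 2) * (\<Sum>j=1..q. cos (real j * z + \<theta>)) = sin ((real q + 1 / 2) * z + \<theta>) - sin (z / 2 + \<theta>)"
proof (induction q)
  case (Suc q)
  have "2 * sin (z / 2) * cos (real (Suc q) * z + \<theta>) = sin ((real (Suc q) + 1 / 2) * z + \<theta>) - sin ((real q + 1 / 2) * z + \<theta>)"
  proof -
    have "(real (Suc q) + 1 / 2) * z + \<theta> = (real (Suc q) * z + \<theta>) + z / 2"
      and "(real q + 1 / 2) * z + \<theta> = (real (Suc q) * z + \<theta>) - z / 2" by (simp_all add: algebra_simps)
    then show ?thesis by (simp only: sin_add sin_diff) simp
  qed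
  with Suc show ?case by (simp add: algebra_simps)
qed simp

text \<open>The phase is free because the multiplier contributes \<alpha> \<pi> / 2: unless this is
  a multiple of \<pi>, conjugate Dirichlet kernels enter too, and they obey the same bound.\<close>

lemma abs_sum_cos_le_peak:
  assumes "0 < q" shows "\<bar>\<Sum>j=1..q. cos (real j * z + \<theta>)\<bar> \<le> peak q z"
proof -
  have "\<bar>\<Sum>j=1..q. cos (real j * z + \<theta>)\<bar> \<le> (\<Sum>j=1..q. 1)"
    by (intro order.trans[OF sum_abs] sum_mono) simp
  moreover have "\<bar>2 * sin (z / 2) * (\<Sum>j=1..q. cos (real j * z + \<theta>))\<bar> \<le> 2"
    unfolding sum_cos_times_sin
    using abs_sin_le_one[of "(real q + 1 / 2) * z + \<theta>"] abs_sin_le_one[of "z / 2 + \<theta>"] by linarith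
  ultimately show ?thesis using assms by (simp add: peak_le_iff abs_mult mult.commute)
qed

lemma peak_mono: "0 < q \<Longrightarrow> q \<le> k \<Longrightarrow> peak q x \<le> peak k x"
  unfolding peak_def by (intro le_imp_inverse_le max.mono divide_left_mono) (auto simp: less_max_iff_disj)

text \<open>Abel's inequality. For increasing weights, summation by parts leaves (u k - u 1) B
  besides the end term u k B, whence the factor 2.\<close>

lemma abs_sum_mult_mono_le:
  fixes u b :: "nat \<Rightarrow> real"
  assumes "1 \<le> k" and mono: "\<And>i j. 1 \<le> i \<Longrightarrow> i \<le> j \<Longrightarrow> j \<le> k \<Longrightarrow> u i \<le> u j" and "0 \<le> u 1"
    and B: "\<And>q. 1 \<le> q \<Longrightarrow> q \<le> k \<Longrightarrow> \<bar>\<Sum>j=1..q. b j\<bar> \<le> B"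
  shows "\<bar>\<Sum>j=1..k. u j * b j\<bar> \<le> 2 * u k * B"
proof -
  have B0: "0 \<le> B" using B[of 1] \<open>1 \<le> k\<close> by linarith
  have "q \<le> k \<Longrightarrow> \<bar>(\<Sum>j=1..q. u j * b j) - u q * (\<Sum>j=1..q. b j)\<bar> \<le> (u q - u 1) * B" if "1 \<le> q" for q
    using that
  proof (induction q rule: dec_induct)
    case base
    then show ?case by simp
  next
    case (step q)
    have "(\<Sum>j=1..Suc q. u j * b j) - u (Suc q) * (\<Sum>j=1..Suc q. b j)
      = ((\<Sum>j=1..q. u j * b j) - u q * (\<Sum>j=1..q. b j)) - (u (Suc q) - u q) * (\<Sum>j=1..q. b j)"
      by (simp add: algebra_simps)
    moreover have "\<bar>(u (Suc q) - u q) * (\<Sum>j=1..q. b j)\<bar> \<le> (u (Suc q) - u q) * B"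
      using step mono[of q "Suc q"] B[of q] by (simp add: abs_mult mult_left_mono)
    ultimately show ?case using step by (simp add: algebra_simps)
  qed
  from this[of k] have "\<bar>(\<Sum>j=1..k. u j * b j) - u k * (\<Sum>j=1..k. b j)\<bar> \<le> (u k - u 1) * B"
    using \<open>1 \<le> k\<close> by simp
  moreover have "\<bar>u k * (\<Sum>j=1..k. b j)\<bar> \<le> u k * B"
    using mono[of 1 k] \<open>0 \<le> u 1\<close> \<open>1 \<le> k\<close> B[of k] by (simp add: abs_mult mult_left_mono)
  moreover have "0 \<le> u 1 * B" using B0 \<open>0 \<le> u 1\<close> by simp
  ultimately show ?thesis by (simp add: algebra_simps)
qed

text \<open>The sequences \<open>shift_weight\<close> and \<open>shift_pos\<close> enlarge the list of translations occurring in a fractional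
  difference by the one by \<open>\<alpha> h / 2\<close>, about which the difference is centred.\<close>

definition shift_weight :: "real \<Rightarrow> nat \<Rightarrow> real" where
  "shift_weight \<alpha> \<nu> = (case \<nu> of 0 \<Rightarrow> 1 | Suc \<mu> \<Rightarrow> \<bar>binc \<alpha> \<mu>\<bar>)"

definition shift_pos :: "real \<Rightarrow> real \<Rightarrow> nat \<Rightarrow> real" where
  "shift_pos \<alpha> h \<nu> = (case \<nu> of 0 \<Rightarrow> \<alpha> * h / 2 | Suc \<mu> \<Rightarrow> (\<alpha> - real \<mu>) * h)"

text \<open>Up to constants, the largest modulus that the multiplier of frequency \<open>k\<close>
  attains over all steps |h| \<le> 1 / n.\<close>

definition damp :: "real \<Rightarrow> nat \<Rightarrow> nat \<Rightarrow> real" where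
  "damp \<alpha> n k = min 1 (real k / real n) powr \<alpha>"

definition diff_dirichlet :: "real \<Rightarrow> real \<Rightarrow> nat \<Rightarrow> real \<Rightarrow> real" where
  "diff_dirichlet \<alpha> h k x = (\<Sum>\<nu>. binc \<alpha> \<nu> * (\<Sum>j=1..k. cos (real j * (x + (\<alpha> - real \<nu>) * h))))"

definition peak_sum :: "real \<Rightarrow> real \<Rightarrow> nat \<Rightarrow> real \<Rightarrow> real" where
  "peak_sum \<alpha> h k x = (\<Sum>\<nu>. shift_weight \<alpha> \<nu> * peak k (x + shift_pos \<alpha> h \<nu>))"

lemma shift_weight_nonneg [simp]: "0 \<le> shift_weight \<alpha> \<nu>"
  by (simp add: shift_weight_def split: nat.split)

lemma summable_shift_weight: "0 < \<alpha> \<Longrightarrow> summable (shift_weight \<alpha>)"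
  by (subst summable_Suc_iff[symmetric]) (simp add: shift_weight_def summable_binc)

lemma damp_bounds: "0 \<le> damp \<alpha> n k" "0 < \<alpha> \<Longrightarrow> damp \<alpha> n k \<le> 1"
  by (auto simp: damp_def intro!: powr_le1)

lemma summable_peak_sum:
  assumes "0 < \<alpha>" "0 < k"
  shows "summable (\<lambda>\<nu>. shift_weight \<alpha> \<nu> * peak k (x + shift_pos \<alpha> h \<nu>))"
proof (rule summable_comparison_test)
  show "\<exists>N. \<forall>\<nu>\<ge>N. norm (shift_weight \<alpha> \<nu> * peak k (x + shift_pos \<alpha> h \<nu>)) \<le> shift_weight \<alpha> \<nu> * real k"
    using assms by (auto intro!: exI[of _ 0] mult_left_mono peak_le_nat)
  show "summable (\<lambda>\<nu>. shift_weight \<alpha> \<nu> * real k)"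
    by (intro summable_mult2 summable_shift_weight assms)
qed

lemma peak_sum_split:
  assumes "0 < \<alpha>" "0 < k"
  shows "peak_sum \<alpha> h k x = peak k (x + \<alpha> * h / 2) + (\<Sum>\<nu>. \<bar>binc \<alpha> \<nu>\<bar> * peak k (x + (\<alpha> - real \<nu>) * h))"
  using suminf_split_head[OF summable_peak_sum[OF assms, of x h]]
  by (simp add: peak_sum_def shift_weight_def shift_pos_def)

lemma summable_binc_peak:
  assumes "0 < \<alpha>" "0 < k"
  shows "summable (\<lambda>\<nu>. \<bar>binc \<alpha> \<nu>\<bar> * peak k (x + (\<alpha> - real \<nu>) * h))"
  using summable_peak_sum[OF assms, of x h]
  by (subst (asm) summable_Suc_iff[symmetric]) (simp add: shift_weight_def shift_pos_def)

lemma diff_dirichlet_eq: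
  assumes "0 < \<alpha>"
  shows "diff_dirichlet \<alpha> h k x = (\<Sum>j=1..k. Re (cis (real j * x) * diff_mult \<alpha> h j))"
proof -
  have "diff_dirichlet \<alpha> h k x = (\<Sum>\<nu>. \<Sum>j=1..k. binc \<alpha> \<nu> * cos (real j * x + real j * ((\<alpha> - real \<nu>) * h)))"
    by (simp add: diff_dirichlet_def sum_distrib_left algebra_simps)
  also have "\<dots> = (\<Sum>j=1..k. \<Sum>\<nu>. binc \<alpha> \<nu> * cos (real j * x + real j * ((\<alpha> - real \<nu>) * h)))"
    using summable_binc_mult[OF assms, of "\<lambda>\<nu>. cos (_ + real _ * ((\<alpha> - real \<nu>) * h))" 1]
    by (intro suminf_sum) simp
  finally show ?thesis by (simp add: suminf_binc_cos(1)[OF assms])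
qed

text \<open>A bound term by term, without any gain in h. It is good enough for k > n, where
  \<open>damp\<close> equals 1.\<close>

lemma abs_diff_dirichlet_le_suminf:
  assumes "0 < \<alpha>" "0 < k"
  shows "\<bar>diff_dirichlet \<alpha> h k x\<bar> \<le> (\<Sum>\<nu>. \<bar>binc \<alpha> \<nu>\<bar> * peak k (x + (\<alpha> - real \<nu>) * h))"
proof -
  have le: "\<bar>binc \<alpha> \<nu> * (\<Sum>j=1..k. cos (real j * (x + (\<alpha> - real \<nu>) * h)))\<bar> \<le> \<bar>binc \<alpha> \<nu>\<bar> * peak k (x + (\<alpha> - real \<nu>) * h)" for \<nu>
    using abs_sum_cos_le_peak[OF assms(2), of "x + (\<alpha> - real \<nu>) * h" 0]
    by (simp add: abs_mult mult_left_mono)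
  have s: "summable (\<lambda>\<nu>. \<bar>binc \<alpha> \<nu> * (\<Sum>j=1..k. cos (real j * (x + (\<alpha> - real \<nu>) * h)))\<bar>)"
    by (rule summable_comparison_test[OF _ summable_binc_peak[OF assms, of x h]]) (use le in auto)
  then show ?thesis
    unfolding diff_dirichlet_def
    by (intro order.trans[OF summable_rabs] suminf_le le summable_binc_peak assms) auto
qed

text \<open>For k |h| \<le> 1 the phases are affine, so the difference is a cosine sum in x +
  \<alpha> h / 2 with increasing weights (2 sin (j h / 2)) powr \<alpha>; Abel's inequality extracts
  the largest weight.\<close>

lemma abs_diff_dirichlet_le_low:
  assumes \<alpha>: "0 < \<alpha>" and k: "0 < k" and h: "real k * \<bar>h\<bar> \<le> 1"
  shows "\<bar>diff_dirichlet \<alpha> h k x\<bar> \<le> 2 * (real k * \<bar>h\<bar>) powr \<alpha> * peak k (x + \<alpha> * h / 2)"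
proof -
  have pos: "\<bar>diff_dirichlet \<alpha> h k x\<bar> \<le> 2 * (real k * h) powr \<alpha> * peak k (x + \<alpha> * h / 2)"
    if h: "0 < h" "real k * h \<le> 1" for h x
  proof -
    define u where "u j = (2 * sin (real j * h / 2)) powr \<alpha>" for j :: nat
    have jh: "real j * h \<le> 1" if "j \<le> k" for j
    proof -
      have "real j * h \<le> real k * h" using that h by (intro mult_right_mono) auto
      then show ?thesis using h(2) by linarith
    qed
    have D: "Re (cis (real j * x) * diff_mult \<alpha> h j) = u j * cos (real j * (x + \<alpha> * h / 2) + \<alpha> * pi / 2)" if "j \<in> {1..k}" for j
    proof -
      have "diff_mult \<alpha> h j = of_real (u j) * cis (real j * \<alpha> * h / 2 + \<alpha> * pi / 2)"
        unfolding u_def using jh[of j] that h pi_gt3 by (intro diff_mult_pos \<alpha>) auto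
      moreover have "cis (real j * x) * (of_real (u j) * cis (real j * \<alpha> * h / 2 + \<alpha> * pi / 2))
        = of_real (u j) * (cis (real j * x) * cis (real j * \<alpha> * h / 2 + \<alpha> * pi / 2))" by (simp only: mult_ac)
      moreover have "cis (real j * x) * cis (real j * \<alpha> * h / 2 + \<alpha> * pi / 2) = cis (real j * (x + \<alpha> * h / 2) + \<alpha> * pi / 2)"
        by (simp add: cis_mult algebra_simps)
      ultimately show ?thesis by (simp only: times_complex.sel Re_complex_of_real Im_complex_of_real cis.sel)
    qed
    have "diff_dirichlet \<alpha> h k x = (\<Sum>j=1..k. u j * cos (real j * (x + \<alpha> * h / 2) + \<alpha> * pi / 2))"
      unfolding diff_dirichlet_eq[OF \<alpha>] by (intro sum.cong D) auto
    also have "\<bar>\<dots>\<bar> \<le> 2 * u k * peak k (x + \<alpha> * h / 2)"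
    proof (rule abs_sum_mult_mono_le)
      show "u i \<le> u j" if "1 \<le> i" "i \<le> j" "j \<le> k" for i j
      proof -
        have "real i * h / 2 \<le> real j * h / 2" using that h by simp
        then have "sin (real i * h / 2) \<le> sin (real j * h / 2)"
        proof -
          have "0 \<le> real i * h" "real i * h / 2 \<le> real j * h / 2" "real j * h \<le> 1"
            using that h jh[of j] by auto
          then show ?thesis using pi_gt3 by (intro sin_monotone_2pi_le) linarith+
        qed
        moreover have "0 \<le> sin (real i * h / 2)"
          using that h jh[of i] pi_gt3 by (intro sin_ge_zero) auto
        ultimately show ?thesis using \<alpha> unfolding u_def by (intro powr_mono2) auto
      qed
      show "\<bar>\<Sum>j=1..q. cos (real j * (x + \<alpha> * h / 2) + \<alpha> * pi / 2)\<bar> \<le> peak k (x + \<alpha> * h / 2)" if "1 \<le> q" "q \<le> k" for q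
        using that by (intro order.trans[OF abs_sum_cos_le_peak peak_mono]) auto
    qed (use k in \<open>auto simp: u_def\<close>)
    also have "\<dots> \<le> 2 * (real k * h) powr \<alpha> * peak k (x + \<alpha> * h / 2)"
    proof -
      have "2 * sin (real k * h / 2) \<le> real k * h" using sin_x_le_x[of "real k * h / 2"] h by simp
      moreover have "0 \<le> sin (real k * h / 2)" using h pi_gt3 by (intro sin_ge_zero) auto
      ultimately have "u k \<le> (real k * h) powr \<alpha>" using \<alpha> unfolding u_def by (intro powr_mono2) auto
      then show ?thesis by (intro mult_right_mono) auto
    qed
    finally show ?thesis .
  qed
  \<comment> \<open>Negative steps are reduced to positive ones by reflecting x.\<close>
  have neg: "diff_dirichlet \<alpha> (- h) k (- x) = diff_dirichlet \<alpha> h k x" for h x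
  proof -
    have "cos (real j * (- x + (\<alpha> - real \<nu>) * - h)) = cos (real j * (x + (\<alpha> - real \<nu>) * h))" for j \<nu>
      by (subst cos_minus[symmetric]) (simp add: algebra_simps)
    then show ?thesis by (simp add: diff_dirichlet_def)
  qed
  have peak_neg: "peak k (- x + \<alpha> * - h / 2) = peak k (x + \<alpha> * h / 2)" for h x
  proof -
    have "(- x + \<alpha> * - h / 2) / 2 = - ((x + \<alpha> * h / 2) / 2)" by (simp add: field_simps)
    then show ?thesis unfolding peak_def by (simp only: sin_minus abs_minus_cancel)
  qed
  consider "0 < h" | "h = 0" | "h < 0" by linarith
  then show ?thesis
  proof cases
    case 1
    with pos[of h] h show ?thesis by simp
  next
    case 2
    then show ?thesis using \<alpha> by (simp add: diff_dirichlet_eq diff_mult_0)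
  next
    case 3
    with pos[of "- h" "- x"] h show ?thesis unfolding neg peak_neg by simp
  qed
qed

lemma abs_diff_dirichlet_le:
  assumes \<alpha>: "0 < \<alpha>" and k: "0 < k" and n: "0 < n" and h: "\<bar>h\<bar> \<le> 1 / real n"
  shows "\<bar>diff_dirichlet \<alpha> h k x\<bar> \<le> 2 * damp \<alpha> n k * peak_sum \<alpha> h k x"
proof -
  have s: "0 \<le> (\<Sum>\<nu>. \<bar>binc \<alpha> \<nu>\<bar> * peak k (x + (\<alpha> - real \<nu>) * h))"
    by (intro suminf_nonneg summable_binc_peak \<alpha> k) simp
  show ?thesis
  proof (cases "k \<le> n")
    case True
    have kh: "real k * \<bar>h\<bar> \<le> real k / real n" using mult_left_mono[OF h, of "real k"] by simp
    also have "\<dots> \<le> 1" using True n by simp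
    finally have "\<bar>diff_dirichlet \<alpha> h k x\<bar> \<le> 2 * (real k * \<bar>h\<bar>) powr \<alpha> * peak k (x + \<alpha> * h / 2)"
      by (intro abs_diff_dirichlet_le_low \<alpha> k)
    also have "\<dots> \<le> 2 * damp \<alpha> n k * peak_sum \<alpha> h k x"
    proof (intro mult_mono)
      show "(real k * \<bar>h\<bar>) powr \<alpha> \<le> damp \<alpha> n k"
      proof -
        have "damp \<alpha> n k = (real k / real n) powr \<alpha>" using True n by (simp add: damp_def min_absorb2)
        then show ?thesis using kh \<alpha> by (auto intro!: powr_mono2)
      qed
      show "peak k (x + \<alpha> * h / 2) \<le> peak_sum \<alpha> h k x"
        using s by (simp add: peak_sum_split \<alpha> k)
    qed (auto simp: damp_bounds)
    finally show ?thesis .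
  next
    case False
    then have "damp \<alpha> n k = 1" using n by (simp add: damp_def min_def field_simps)
    moreover have "\<bar>diff_dirichlet \<alpha> h k x\<bar> \<le> peak_sum \<alpha> h k x"
      using abs_diff_dirichlet_le_suminf[OF \<alpha> k, of h x] by (simp add: peak_sum_split \<alpha> k add_increasing)
    moreover have "0 \<le> peak_sum \<alpha> h k x" using s by (simp add: peak_sum_split \<alpha> k)
    ultimately show ?thesis by simp
  qed
qed


text \<open>If \<theta> j is the argument of the multiplier, pairing with frequency j yields v j
  times its modulus, so nothing cancels. It remains to make the sum of these moduli of order m times
  \<open>damp\<close> with a polynomial that the kernel still bounds.\<close>

lemma lower_polynomial:
  assumes \<alpha>: "0 < \<alpha>"
  obtains C where "0 < C" and "\<And>n m. 0 < n \<Longrightarrow> 0 < m \<Longrightarrow> \<exists>v \<theta>.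
    (\<forall>x. \<bar>\<Sum>j=1..m. v j * cos (real j * x + \<theta> j)\<bar> \<le> peak_sum \<alpha> (1 / (4 * real n)) m x) \<and>
    (\<forall>j. 0 \<le> v j) \<and>
    (\<forall>j\<in>{1..m}. 0 \<le> (\<Sum>\<nu>. binc \<alpha> \<nu> * cos (\<theta> j - real j * ((\<alpha> - real \<nu>) * (1 / (4 * real n)))))) \<and>
    real m * damp \<alpha> n m \<le>
      C * (\<Sum>j=1..m. v j * (\<Sum>\<nu>. binc \<alpha> \<nu> * cos (\<theta> j - real j * ((\<alpha> - real \<nu>) * (1 / (4 * real n))))))"
proof -
  \<comment> \<open>For high frequencies, a lower bound for the sum of the squared moduli at j and j
    + n.\<close>
  define c where "c = sin (1 / 8 :: real) powr (2 * \<alpha>)"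
  have s8: "0 < sin (1 / 8 :: real)" using pi_gt3 by (intro sin_gt_zero) auto
  then have c: "0 < c" by (simp add: c_def)
  \<comment> \<open>The first summand serves m \<le> 4 n: there m / n = 16 (m h / 4), and half of
    the indices are kept. The second serves m > 4 n: twice the sum of the squared moduli is at least
    (m - n) c \<ge> 3 m c / 4.\<close>
  define C where "C = 2 * 16 powr \<alpha> + 8 / 3 / c"
  have C: "0 < C" using c by (simp add: C_def add_pos_pos)
  show thesis
  proof (rule that[OF C], goal_cases)
    case (1 n m)
    define h where "h = 1 / (4 * real n)"
    have h: "0 < h" using 1 by (simp add: h_def)
    define \<rho> where "\<rho> j = norm (diff_mult \<alpha> h j)" for j
    have \<rho>: "\<rho> j = (2 * \<bar>sin (real j * h / 2)\<bar>) powr \<alpha>" for j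
      by (simp add: \<rho>_def norm_diff_mult \<alpha>)
    have \<kappa>: "(\<Sum>\<nu>. binc \<alpha> \<nu> * cos (\<theta> - real j * ((\<alpha> - real \<nu>) * h))) = \<rho> j" if "diff_mult \<alpha> h j = of_real (\<rho> j) * cis \<theta>" for j \<theta>
    proof -
      have trig: "cos \<theta> * (cos \<theta> * r) + sin \<theta> * (sin \<theta> * r) = r" for r
        using sin_cos_squared_add3[of \<theta>] by (simp flip: mult.assoc distrib_right)
      then show ?thesis unfolding suminf_binc_cos(2)[OF \<alpha>] that by (simp add: algebra_simps trig)
    qed
    have S0: "0 \<le> (\<Sum>\<nu>. \<bar>binc \<alpha> \<nu>\<bar> * peak m (x + (\<alpha> - real \<nu>) * h))" for x
      using 1 by (intro suminf_nonneg summable_binc_peak \<alpha>) auto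
    show ?case
    proof (cases "m \<le> 4 * n")
      case True
      then have mh: "real m * h \<le> 1" using 1 by (simp add: h_def)
      have jh: "0 < real j * h" "real j * h \<le> 1" if "j \<in> {1..m}" for j
      proof -
        have "real j * h \<le> real m * h" using that h by (intro mult_right_mono) auto
        then show "real j * h \<le> 1" using mh by linarith
        show "0 < real j * h" using that h by simp
      qed
      define \<theta> where "\<theta> j = real j * \<alpha> * h / 2 + \<alpha> * pi / 2" for j :: nat
      have \<kappa>': "(\<Sum>\<nu>. binc \<alpha> \<nu> * cos (\<theta> j - real j * ((\<alpha> - real \<nu>) * h))) = \<rho> j" if "j \<in> {1..m}" for j
      proof (rule \<kappa>)
        have "0 \<le> sin (real j * h / 2)" using jh[OF that] pi_gt3 by (intro sin_ge_zero) auto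
        then show "diff_mult \<alpha> h j = of_real (\<rho> j) * cis (\<theta> j)"
          unfolding \<rho> \<theta>_def using jh[OF that] pi_gt3 by (subst diff_mult_pos[OF \<alpha>]) auto
      qed
      show ?thesis unfolding h_def[symmetric]
      proof (rule exI[of _ "\<lambda>_. 1"], rule exI[of _ \<theta>], intro conjI allI ballI)
        fix x
        have eq: "(\<Sum>j=1..m. 1 * cos (real j * x + \<theta> j)) = (\<Sum>j=1..m. cos (real j * (x + \<alpha> * h / 2) + \<alpha> * pi / 2))"
          by (simp add: \<theta>_def algebra_simps)
        have "\<bar>\<Sum>j=1..m. 1 * cos (real j * x + \<theta> j)\<bar> \<le> peak m (x + \<alpha> * h / 2)"
          unfolding eq using 1 by (intro abs_sum_cos_le_peak) simp
        also have "\<dots> \<le> peak_sum \<alpha> h m x" using S0[of x] 1 by (simp add: peak_sum_split \<alpha>)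
        finally show "\<bar>\<Sum>j=1..m. 1 * cos (real j * x + \<theta> j)\<bar> \<le> peak_sum \<alpha> h m x" .
      next
        fix j assume "j \<in> {1..m}"
        then show "0 \<le> (\<Sum>\<nu>. binc \<alpha> \<nu> * cos (\<theta> j - real j * ((\<alpha> - real \<nu>) * h)))"
          by (simp add: \<kappa>' \<rho>)
      next
        \<comment> \<open>Only the upper half of the indices is kept: at least m / 2 of them, each
          with j \<ge> m / 2, so that every modulus has the full order (m h) powr \<alpha>.\<close>
        define q where "q = (m + 1) div 2"
        have q: "real m / 2 \<le> real q" "1 \<le> q" "q \<le> m" "real m / 2 \<le> real (m + 1 - q)"
          using 1 unfolding q_def by linarith+
        have \<rho>_ge: "(real m * h / 4) powr \<alpha> \<le> \<rho> j" if "j \<in> {q..m}" for j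
        proof -
          have j: "j \<in> {1..m}" using that q by auto
          have "2 * (real j * h / 2) / pi \<le> sin (real j * h / 2)"
            using jh[OF j] pi_gt3 by (intro sin_ge_Jordan) auto
          moreover have "real j * h / 4 \<le> 2 * (real j * h / 2) / pi"
            using mult_left_mono[of pi 4 "real j * h"] jh[OF j] pi_less_4 by (simp add: field_simps)
          moreover have "real m * h / 4 \<le> 2 * (real j * h / 4)"
          proof -
            have "real m / 2 * h \<le> real j * h" using that q h by (intro mult_right_mono) auto
            then show ?thesis by linarith
          qed
          ultimately have "real m * h / 4 \<le> 2 * \<bar>sin (real j * h / 2)\<bar>" by linarith
          then show ?thesis unfolding \<rho> using h \<alpha> by (intro powr_mono2) auto
        qed
        have "real m * damp \<alpha> n m \<le> real m * (real m / real n) powr \<alpha>"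
          using \<alpha> unfolding damp_def by (intro mult_left_mono powr_mono2) auto
        also have "\<dots> = 2 * 16 powr \<alpha> * (real m / 2 * (real m * h / 4) powr \<alpha>)"
          using 1 h by (simp add: h_def powr_divide powr_mult)
        also have "\<dots> \<le> C * (real m / 2 * (real m * h / 4) powr \<alpha>)"
          using c h by (intro mult_right_mono) (auto simp: C_def)
        also have "real m / 2 * (real m * h / 4) powr \<alpha> \<le> real (card {q..m}) * (real m * h / 4) powr \<alpha>"
          using q by (intro mult_right_mono) auto
        also have "\<dots> \<le> (\<Sum>j\<in>{q..m}. \<rho> j)" using \<rho>_ge by (intro sum_bounded_below) auto
        also have "\<dots> \<le> (\<Sum>j=1..m. \<rho> j)" using q by (intro sum_mono2) (auto simp: \<rho>)
        also have "\<dots> = (\<Sum>j=1..m. 1 * (\<Sum>\<nu>. binc \<alpha> \<nu> * cos (\<theta> j - real j * ((\<alpha> - real \<nu>) * h))))"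
          by (intro sum.cong refl) (simp add: \<kappa>')
        finally show "real m * damp \<alpha> n m \<le> C * (\<Sum>j=1..m. 1 * (\<Sum>\<nu>. binc \<alpha> \<nu> * cos (\<theta> j - real j * ((\<alpha> - real \<nu>) * h))))"
          using C by simp
      qed simp
    next
      case False
      define \<theta> where "\<theta> j = Arg (diff_mult \<alpha> h j)" for j
      have polar: "diff_mult \<alpha> h j = of_real (\<rho> j) * cis (\<theta> j)" for j
        using rcis_cmod_Arg[of "diff_mult \<alpha> h j"] by (simp add: \<rho>_def \<theta>_def rcis_def)
      show ?thesis unfolding h_def[symmetric]
      \<comment> \<open>With the moduli as weights the test polynomial is the difference of a
        Dirichlet kernel, and its bound needs no knowledge of the phases. The pairing then yields
        squared moduli.\<close>
      proof (rule exI[of _ \<rho>], rule exI[of _ \<theta>], intro conjI allI ballI)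
        fix x
        have "(\<Sum>j=1..m. \<rho> j * cos (real j * x + \<theta> j)) = diff_dirichlet \<alpha> h m x"
          unfolding diff_dirichlet_eq[OF \<alpha>] polar by (simp add: cos_add algebra_simps)
        also have "\<bar>\<dots>\<bar> \<le> peak_sum \<alpha> h m x"
          using abs_diff_dirichlet_le_suminf[OF \<alpha>, of m h x] 1 by (simp add: peak_sum_split \<alpha> add_increasing)
        finally show "\<bar>\<Sum>j=1..m. \<rho> j * cos (real j * x + \<theta> j)\<bar> \<le> peak_sum \<alpha> h m x" .
      next
        fix j
        show "0 \<le> (\<Sum>\<nu>. binc \<alpha> \<nu> * cos (\<theta> j - real j * ((\<alpha> - real \<nu>) * h)))"
          by (simp add: \<kappa>[OF polar] \<rho>)
      next
        \<comment> \<open>The half angles t and t + 1 / 8 cannot both be close to zeros of the sine: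
          sin (1 / 8) is a combination of sin t and sin (t + 1 / 8) with coefficients of absolute
          value at most 1.\<close>
        have pair: "c \<le> \<rho> j * \<rho> j + \<rho> (j + n) * \<rho> (j + n)" for j
        proof -
          define t where "t = real j * h / 2"
          have jn: "real (j + n) * h / 2 = t + 1 / 8"
            using 1 by (simp add: t_def h_def field_simps)
          moreover have "sin (1 / 8) \<le> \<bar>sin t\<bar> + \<bar>sin (t + 1 / 8)\<bar>"
          proof -
            have "sin (1 / 8) = sin (t + 1 / 8) * cos t - cos (t + 1 / 8) * sin t"
              using sin_diff[of "t + 1 / 8" t] by simp
            also have "\<dots> \<le> \<bar>sin (t + 1 / 8)\<bar> * \<bar>cos t\<bar> + \<bar>cos (t + 1 / 8)\<bar> * \<bar>sin t\<bar>"
            proof -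
              have "sin (t + 1 / 8) * cos t \<le> \<bar>sin (t + 1 / 8)\<bar> * \<bar>cos t\<bar>" by (metis abs_ge_self abs_mult)
              moreover have "- (cos (t + 1 / 8) * sin t) \<le> \<bar>cos (t + 1 / 8)\<bar> * \<bar>sin t\<bar>" by (metis abs_ge_minus_self abs_mult)
              ultimately show ?thesis by linarith
            qed
            also have "\<dots> \<le> \<bar>sin (t + 1 / 8)\<bar> * 1 + 1 * \<bar>sin t\<bar>"
              by (intro add_mono mult_mono) auto
            finally show ?thesis by simp
          qed
          ultimately have "sin (1 / 8) \<le> 2 * \<bar>sin (real j * h / 2)\<bar> \<or> sin (1 / 8) \<le> 2 * \<bar>sin (real (j + n) * h / 2)\<bar>"
            unfolding jn t_def[symmetric] by linarith
          then have "sin (1 / 8) powr \<alpha> \<le> \<rho> j \<or> sin (1 / 8) powr \<alpha> \<le> \<rho> (j + n)"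
            unfolding \<rho> using s8 \<alpha> by (auto intro!: powr_mono2)
          moreover have "c = sin (1 / 8) powr \<alpha> * sin (1 / 8) powr \<alpha>"
            using s8 by (simp add: c_def flip: powr_add)
          moreover have "sin (1 / 8) powr \<alpha> * sin (1 / 8) powr \<alpha> \<le> r * r" if "sin (1 / 8) powr \<alpha> \<le> r" for r
            using that by (intro mult_mono) (auto intro: order.trans[OF powr_ge_zero])
          moreover have "0 \<le> \<rho> j * \<rho> j" "0 \<le> \<rho> (j + n) * \<rho> (j + n)" by auto
          ultimately have "c \<le> \<rho> j * \<rho> j \<or> c \<le> \<rho> (j + n) * \<rho> (j + n)"
            by metis
          then show ?thesis using \<open>0 \<le> \<rho> j * \<rho> j\<close> \<open>0 \<le> \<rho> (j + n) * \<rho> (j + n)\<close> by linarith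
        qed
        have "real m * damp \<alpha> n m \<le> real m"
          using damp_bounds(2)[OF \<alpha>, of n m] by (simp add: mult_left_le)
        also have "\<dots> = 8 / 3 / c * (real m * 3 / 4 * c / 2)" using c by simp
        also have "\<dots> \<le> C * (real m * 3 / 4 * c / 2)"
          using c by (intro mult_right_mono) (auto simp: C_def)
        also have "real m * 3 / 4 * c / 2 \<le> real (card {1..m - n}) * c / 2"
          using False c by (intro divide_right_mono mult_right_mono) auto
        also have "real (card {1..m - n}) * c \<le> (\<Sum>j=1..m - n. \<rho> j * \<rho> j + \<rho> (j + n) * \<rho> (j + n))"
          using pair by (intro sum_bounded_below) auto
        \<comment> \<open>After the shift of the second sum every index is counted at most
          twice.\<close>
        also have "\<dots> = (\<Sum>j=1..m - n. \<rho> j * \<rho> j) + (\<Sum>j=1 + n..(m - n) + n. \<rho> j * \<rho> j)"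
          by (simp only: sum.distrib sum.shift_bounds_cl_nat_ivl)
        also have "\<dots> \<le> (\<Sum>j=1..m. \<rho> j * \<rho> j) + (\<Sum>j=1..m. \<rho> j * \<rho> j)"
          using False by (intro add_mono sum_mono2) auto
        finally show "real m * damp \<alpha> n m \<le> C * (\<Sum>j=1..m. \<rho> j * (\<Sum>\<nu>. binc \<alpha> \<nu> * cos (\<theta> j - real j * ((\<alpha> - real \<nu>) * h))))"
          using C by (simp add: \<kappa>[OF polar])
      qed (simp add: \<rho>)
    qed
  qed
qed

section \<open>Summation by parts for kernel sums\<close>

lemma sum_diff_mult_le:
  fixes b \<phi> :: "nat \<Rightarrow> real"
  assumes "0 \<le> b (Suc N)" "0 \<le> \<phi> N" "\<phi> 0 = 0"
  shows "(\<Sum>k=1..N. (b k - b (Suc k)) * \<phi> k) \<le> (\<Sum>k=1..N. b k * (\<phi> k - \<phi> (k - 1)))"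
proof -
  have "(\<Sum>k=1..N. (b k - b (Suc k)) * \<phi> k) = (\<Sum>k=1..N. b k * (\<phi> k - \<phi> (k - 1))) - b (Suc N) * \<phi> N"
    using assms(3) by (induction N) (auto simp: algebra_simps)
  then show ?thesis using assms by simp
qed

definition mixed_diff :: "(nat \<Rightarrow> nat \<Rightarrow> real) \<Rightarrow> nat \<Rightarrow> nat \<Rightarrow> real" where
  "mixed_diff a k l = a k l - a (Suc k) l - a k (Suc l) + a (Suc k) (Suc l)"

text \<open>Summation by parts in \<open>l\<close> and then in \<open>k\<close>. The boundary terms
  have a favourable sign and are dropped, so the estimate holds for every N without any decay of
  \<open>a\<close>.\<close>

lemma sum_mixed_diff_le:
  assumes a0: "\<And>k l. 1 \<le> k \<Longrightarrow> 1 \<le> l \<Longrightarrow> 0 \<le> a k l"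
    and a1: "\<And>k l. 1 \<le> k \<Longrightarrow> 1 \<le> l \<Longrightarrow> a (Suc k) l \<le> a k l"
    and \<phi>: "\<phi> 0 = 0" "\<And>k. 0 \<le> \<phi> k" and \<psi>: "\<psi> 0 = 0" "\<And>k. 0 \<le> \<psi> k" "\<And>k. \<psi> (k - 1) \<le> \<psi> k"
  shows "(\<Sum>k=1..N. \<Sum>l=1..N. mixed_diff a k l * \<phi> k * \<psi> l)
    \<le> (\<Sum>k=1..N. \<Sum>l=1..N. a k l * (\<phi> k - \<phi> (k - 1)) * (\<psi> l - \<psi> (l - 1)))"
proof -
  have "(\<Sum>k=1..N. \<Sum>l=1..N. mixed_diff a k l * \<phi> k * \<psi> l)
     = (\<Sum>k=1..N. \<phi> k * (\<Sum>l=1..N. ((a k l - a (Suc k) l) - (a k (Suc l) - a (Suc k) (Suc l))) * \<psi> l))"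
    by (simp add: mixed_diff_def sum_distrib_left algebra_simps)
  also have "\<dots> \<le> (\<Sum>k=1..N. \<phi> k * (\<Sum>l=1..N. (a k l - a (Suc k) l) * (\<psi> l - \<psi> (l - 1))))"
    using a1 \<phi> \<psi> by (intro sum_mono mult_left_mono sum_diff_mult_le) auto
  also have "\<dots> = (\<Sum>k=1..N. \<Sum>l=1..N. (\<psi> l - \<psi> (l - 1)) * ((a k l - a (Suc k) l) * \<phi> k))"
    by (simp add: sum_distrib_left mult_ac)
  also have "\<dots> = (\<Sum>l=1..N. (\<psi> l - \<psi> (l - 1)) * (\<Sum>k=1..N. (a k l - a (Suc k) l) * \<phi> k))"
    by (subst sum.swap) (simp add: sum_distrib_left)
  also have "\<dots> \<le> (\<Sum>l=1..N. (\<psi> l - \<psi> (l - 1)) * (\<Sum>k=1..N. a k l * (\<phi> k - \<phi> (k - 1))))"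
    using a0 \<phi> \<psi> by (intro sum_mono mult_left_mono sum_diff_mult_le) auto
  also have "\<dots> = (\<Sum>k=1..N. \<Sum>l=1..N. a k l * (\<phi> k - \<phi> (k - 1)) * (\<psi> l - \<psi> (l - 1)))"
    unfolding sum_distrib_left by (subst sum.swap) (simp add: mult_ac)
  finally show ?thesis .
qed

lemma damp_peak_mono:
  assumes "0 < \<alpha>" shows "damp \<alpha> n (k - 1) * peak (k - 1) x \<le> damp \<alpha> n k * peak k x"
proof (cases "k \<le> 1")
  case True
  then show ?thesis by (auto simp: damp_def)
next
  case False
  have "min 1 (real (k - 1) / real n) \<le> min 1 (real k / real n)"
    by (intro min.mono divide_right_mono) auto
  then show ?thesis using False assms unfolding damp_def
    by (intro mult_mono powr_mono2 peak_mono) auto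
qed

text \<open>The product grows at most like k powr (1 + \<alpha>): one power from \<open>peak\<close>
  and \<alpha> from \<open>damp\<close>. Stepping back to k - 1 thus costs at most the factor (1 - 1
  / k) powr (1 + \<alpha>), which is at least 1 - (1 + \<alpha>) / k by Bernoulli's
  inequality.\<close>

lemma damp_peak_increment:
  assumes \<alpha>: "0 < \<alpha>" and k: "1 \<le> k"
  shows "damp \<alpha> n k * peak k x - damp \<alpha> n (k - 1) * peak (k - 1) x \<le> (1 + \<alpha>) / real k * (damp \<alpha> n k * peak k x)"
proof (cases "k = 1")
  case True
  then show ?thesis using \<alpha> by (simp add: damp_def mult_right_mono distrib_right)
next
  case False
  define u where "u = 1 - 1 / real k"
  have k1: "1 < k" using False k by simp
  have u: "0 < u" "u \<le> 1" "real (k - 1) = u * real k" using k1 by (auto simp: u_def field_simps)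
  have P: "u * peak k x \<le> peak (k - 1) x"
  proof -
    have "peak k x \<le> real k" "peak k x * \<bar>sin (x / 2)\<bar> \<le> 1"
      using peak_le_iff[of k "peak k x" x] k by auto
    moreover from this(2) have "u * (peak k x * \<bar>sin (x / 2)\<bar>) \<le> 1"
      using u mult_mono[of u 1 "peak k x * \<bar>sin (x / 2)\<bar>" 1] by auto
    ultimately show ?thesis using k1 u by (subst peak_le_iff) (auto simp: mult.assoc)
  qed
  have D: "u powr \<alpha> * damp \<alpha> n k \<le> damp \<alpha> n (k - 1)"
  proof -
    have "u * min 1 (real k / real n) \<le> min 1 (real (k - 1) / real n)"
      using u by (simp add: min_mult_distrib_left min.coboundedI1)
    then have "(u * min 1 (real k / real n)) powr \<alpha> \<le> min 1 (real (k - 1) / real n) powr \<alpha>"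
      using u \<alpha> by (intro powr_mono2) auto
    then show ?thesis using u by (simp add: damp_def powr_mult)
  qed
  have "1 - (1 + \<alpha>) / real k \<le> u powr (1 + \<alpha>)"
    using Young_tangent[of "1 + \<alpha>" u 1] \<alpha> u by (simp add: u_def algebra_simps)
  also have "\<dots> = u powr \<alpha> * u" using u by (simp add: powr_add)
  finally have "(1 - (1 + \<alpha>) / real k) * (damp \<alpha> n k * peak k x) \<le> (u powr \<alpha> * u) * (damp \<alpha> n k * peak k x)"
    by (intro mult_right_mono) (auto simp: damp_bounds)
  also have "\<dots> = (u powr \<alpha> * damp \<alpha> n k) * (u * peak k x)" by simp
  also have "\<dots> \<le> damp \<alpha> n (k - 1) * peak (k - 1) x"
    using P D u by (intro mult_mono) (auto simp: damp_bounds)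
  finally show ?thesis by (simp add: algebra_simps)
qed

text \<open>The increments in the two variables bring the factor 1 / (k l), so the mixed differences
  are traded for coefficients divided by k l, the form that \<open>majorant\<close>
  represents.\<close>

lemma sum_mixed_diff_peak_le:
  assumes \<alpha>: "0 < \<alpha>1" "0 < \<alpha>2"
    and a0: "\<And>k l. 1 \<le> k \<Longrightarrow> 1 \<le> l \<Longrightarrow> 0 \<le> a k l"
    and a1: "\<And>k l. 1 \<le> k \<Longrightarrow> 1 \<le> l \<Longrightarrow> a (Suc k) l \<le> a k l"
  shows "(\<Sum>k=1..N. \<Sum>l=1..N. mixed_diff a k l * (damp \<alpha>1 n1 k * peak k x) * (damp \<alpha>2 n2 l * peak l y))
    \<le> (1 + \<alpha>1) * (1 + \<alpha>2) * (\<Sum>k=1..N. \<Sum>l=1..N. a k l * (damp \<alpha>1 n1 k * peak k x) * (damp \<alpha>2 n2 l * peak l y) / (real k * real l))"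
proof -
  have "(\<Sum>k=1..N. \<Sum>l=1..N. mixed_diff a k l * (damp \<alpha>1 n1 k * peak k x) * (damp \<alpha>2 n2 l * peak l y))
    \<le> (\<Sum>k=1..N. \<Sum>l=1..N. a k l * (damp \<alpha>1 n1 k * peak k x - damp \<alpha>1 n1 (k - 1) * peak (k - 1) x)
        * (damp \<alpha>2 n2 l * peak l y - damp \<alpha>2 n2 (l - 1) * peak (l - 1) y))"
    by (rule sum_mixed_diff_le[where a = a])
       (use a0 a1 damp_peak_mono[OF \<alpha>(2)] in \<open>auto simp: damp_bounds\<close>, auto simp: damp_def)
  also have "\<dots> \<le> (\<Sum>k=1..N. \<Sum>l=1..N. a k l * ((1 + \<alpha>1) / real k * (damp \<alpha>1 n1 k * peak k x))
        * ((1 + \<alpha>2) / real l * (damp \<alpha>2 n2 l * peak l y)))"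
    using damp_peak_mono[OF \<alpha>(1)] damp_peak_mono[OF \<alpha>(2)] a0 \<alpha>
    by (intro sum_mono mult_mono damp_peak_increment \<alpha>) (auto simp: damp_bounds)
  also have "\<dots> = (1 + \<alpha>1) * (1 + \<alpha>2) * (\<Sum>k=1..N. \<Sum>l=1..N. a k l * (damp \<alpha>1 n1 k * peak k x) * (damp \<alpha>2 n2 l * peak l y) / (real k * real l))"
    unfolding sum_distrib_left by (intro sum.cong refl) simp
  finally show ?thesis .
qed

section \<open>The torus\<close>

abbreviation tor :: "(real \<times> real) measure" where "tor \<equiv> circ \<Otimes>\<^sub>M circ"

interpretation circ: sigma_finite_measure circ by (rule sigma_finite_circ)
interpretation tor: pair_sigma_finite circ circ ..

lemma sets_tor [measurable_cong]: "sets tor = sets borel"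
proof -
  have "sets tor = sets ((borel :: real measure) \<Otimes>\<^sub>M (borel :: real measure))"
    by (rule sets_pair_measure_cong) simp_all
  also have "\<dots> = sets borel" unfolding borel_prod ..
  finally show ?thesis .
qed

lemma measurable_fst_borel [measurable]: "fst \<in> borel_measurable (borel :: (real \<times> real) measure)"
  and measurable_snd_borel [measurable]: "snd \<in> borel_measurable (borel :: (real \<times> real) measure)"
  by (intro borel_measurable_continuous_onI continuous_intros)+

lemma borel_measurable_tor: "borel_measurable tor = borel_measurable borel"
  by (rule measurable_cong_sets[OF sets_tor refl])

lemma tor_eq_density: "tor = density lborel (indicator torus)"
proof -
  have "tor = density (lborel \<Otimes>\<^sub>M lborel) (\<lambda>(x, y). indicator {0..2 * pi} x * indicator {0..2 * pi} y)"
    unfolding circ_def by (intro pair_measure_density) (use sigma_finite_circ sigma_finite_lborel in \<open>auto simp: circ_def\<close>)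
  also have "(\<lambda>(x, y). indicator {0..2 * pi} x * indicator {0..2 * pi} y) = (indicator torus :: real \<times> real \<Rightarrow> ennreal)"
    by (auto simp: fun_eq_iff torus_def indicator_def)
  finally show ?thesis by (simp add: lborel_prod)
qed

lemma torus_borel [measurable]: "torus \<in> sets borel"
  unfolding torus_def by (auto simp flip: borel_prod)

lemma emeasure_tor: "emeasure tor UNIV < top"
proof -
  have "emeasure circ UNIV = ennreal (2 * pi)"
    by (simp add: circ_def emeasure_density)
  then have "emeasure tor (UNIV \<times> UNIV) = ennreal (2 * pi) * ennreal (2 * pi)"
    by (subst circ.emeasure_pair_measure_Times) auto
  then show ?thesis by (simp add: ennreal_mult_less_top)
qed

interpretation finite_tor: finite_measure tor
  by standard (use emeasure_tor in \<open>simp add: space_pair_measure less_top\<close>)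

section \<open>Periodic functions and translations on the torus\<close>

lemma AE_lborel_shift:
  fixes c :: "'a :: euclidean_space"
  assumes "AE z in lborel. P z" shows "AE z in lborel. P (z + c)"
proof -
  have "AE z in distr lborel borel ((+) c). P z" unfolding lborel_distr_plus by (rule assms)
  from AE_distrD[OF _ this] have "AE z in lborel. P (c + z)" by simp
  then show ?thesis by (simp add: add.commute)
qed

text \<open>The type of values is arbitrary because the notion is also applied to predicates in
  almost-everywhere statements.\<close>

definition periodic2 :: "(real \<times> real \<Rightarrow> 'a) \<Rightarrow> bool" where
  "periodic2 f \<longleftrightarrow> (\<forall>x y. f (x + 2 * pi, y) = f (x, y) \<and> f (x, y + 2 * pi) = f (x, y))"

lemma periodic2_int:
  assumes "periodic2 f" shows "f (x + of_int i * (2 * pi), y + of_int j * (2 * pi)) = f (x, y)"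
proof -
  have "f (x + of_int i * (2 * pi), y + of_int j * (2 * pi)) = f (x, y + of_int j * (2 * pi))"
    using assms by (intro periodic_int_multiple[of "\<lambda>x. f (x, y + of_int j * (2 * pi))"]) (simp add: periodic2_def)
  also have "\<dots> = f (x, y)"
    using assms by (intro periodic_int_multiple[of "\<lambda>y. f (x, y)"]) (simp add: periodic2_def)
  finally show ?thesis .
qed

text \<open>Reduction modulo 2 \<pi>. It extends data on one period to functions whose periodicity
  is exact, not only almost everywhere.\<close>

definition wrap :: "real \<Rightarrow> real" where
  "wrap x = x - of_int \<lfloor>x / (2 * pi)\<rfloor> * (2 * pi)"

lemma wrap_bounds: "0 \<le> wrap x" "wrap x \<le> 2 * pi"
  using floor_divide_lower[of "2 * pi" x] floor_divide_upper[of "2 * pi" x]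
  by (simp_all add: wrap_def algebra_simps)

lemma wrap_eq: "wrap x = x + of_int (- \<lfloor>x / (2 * pi)\<rfloor>) * (2 * pi)"
  by (simp add: wrap_def)

lemma wrap_periodic: "wrap (x + 2 * pi) = wrap x"
  by (simp add: wrap_def add_divide_distrib algebra_simps)

lemma measurable_wrap [measurable]: "wrap \<in> borel_measurable borel"
  unfolding wrap_def by measurable

lemma periodic2_wrap: "periodic2 f \<Longrightarrow> f (wrap x, wrap y) = f (x, y)"
  unfolding wrap_eq by (rule periodic2_int)

text \<open>Countably many translates of the torus cover the plane, so the exceptional set is a
  countable union of null sets.\<close>

lemma AE_lborel_wrap:
  assumes "AE z in tor. P z" shows "AE z in lborel. P (wrap (fst z), wrap (snd z))"
proof -
  have P: "AE z in lborel. z \<in> torus \<longrightarrow> P z"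
    using assms unfolding tor_eq_density by (subst (asm) AE_density) (auto simp: indicator_def elim: AE_mp)
  have "AE z in lborel. \<forall>i j :: int. z + (of_int i * (2 * pi), of_int j * (2 * pi)) \<in> torus \<longrightarrow> P (z + (of_int i * (2 * pi), of_int j * (2 * pi)))"
    unfolding AE_all_countable by (intro allI AE_lborel_shift[OF P])
  then show ?thesis
  proof eventually_elim
    case (elim z)
    then show ?case
      using elim[rule_format, of "- \<lfloor>fst z / (2 * pi)\<rfloor>" "- \<lfloor>snd z / (2 * pi)\<rfloor>"] wrap_bounds[of "fst z"] wrap_bounds[of "snd z"]
      by (cases z) (simp add: torus_def wrap_eq)
  qed
qed

lemma AE_tor_of_lborel: "AE z in lborel. P z \<Longrightarrow> AE z in tor. P z"
  unfolding tor_eq_density by (subst AE_density) (auto elim: AE_mp)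

lemma AE_lborel_of_tor:
  assumes "AE z in tor. P z" "periodic2 P" shows "AE z in lborel. P z"
  using AE_lborel_wrap[OF assms(1)] by (simp add: periodic2_wrap[OF assms(2)])

lemma AE_tor_shift:
  assumes "AE z in tor. P z" "periodic2 P" shows "AE z in tor. P (z + c)"
  by (rule AE_tor_of_lborel[OF AE_lborel_shift[OF AE_lborel_of_tor[OF assms]]])

lemma nn_integral_tor_shift:
  assumes [measurable]: "F \<in> borel_measurable borel" and per: "periodic2 F"
  shows "(\<integral>\<^sup>+z. F (z + c) \<partial>tor) = (\<integral>\<^sup>+z. F z \<partial>tor)"
proof -
  obtain s t where c: "c = (s, t)" by (cases c)
  have "(\<integral>\<^sup>+z. F (z + c) \<partial>tor) = (\<integral>\<^sup>+x. \<integral>\<^sup>+y. F (x + s, y + t) \<partial>circ \<partial>circ)"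
    by (subst circ.nn_integral_fst[symmetric]) (auto simp: c sets_tor borel_measurable_tor)
  also have "\<dots> = (\<integral>\<^sup>+x. \<integral>\<^sup>+y. F (x + s, y) \<partial>circ \<partial>circ)"
    using per by (intro nn_integral_cong nn_integral_circ_shift) (auto simp: periodic2_def)
  also have "\<dots> = (\<integral>\<^sup>+y. \<integral>\<^sup>+x. F (x + s, y) \<partial>circ \<partial>circ)"
    by (rule tor.Fubini'[symmetric]) (simp add: case_prod_beta')
  also have "\<dots> = (\<integral>\<^sup>+y. \<integral>\<^sup>+x. F (x, y) \<partial>circ \<partial>circ)"
    using per by (intro nn_integral_cong nn_integral_circ_shift) (auto simp: periodic2_def)
  also have "\<dots> = (\<integral>\<^sup>+z. F z \<partial>tor)"
    by (subst tor.nn_integral_snd) (auto simp: borel_measurable_tor)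
  finally show ?thesis .
qed

lemma integrable_tor_shift:
  fixes f :: "real \<times> real \<Rightarrow> real"
  assumes [measurable]: "f \<in> borel_measurable borel" and per: "periodic2 f" and "integrable tor f"
  shows "integrable tor (\<lambda>z. f (z + c))" and "(\<integral>z. f (z + c) \<partial>tor) = (\<integral>z. f z \<partial>tor)"
proof -
  have sh: "(\<integral>\<^sup>+z. ennreal (g (f (z + c))) \<partial>tor) = (\<integral>\<^sup>+z. ennreal (g (f z)) \<partial>tor)"
    if [measurable]: "g \<in> borel_measurable borel" for g :: "real \<Rightarrow> real"
    using per by (intro nn_integral_tor_shift[of "\<lambda>z. ennreal (g (f z))"]) (auto simp: periodic2_def)
  show int: "integrable tor (\<lambda>z. f (z + c))"
    using assms(3) sh[of abs] by (simp add: integrable_iff_bounded sets_tor)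
  show "(\<integral>z. f (z + c) \<partial>tor) = (\<integral>z. f z \<partial>tor)"
    using sh[of "\<lambda>x. x"] sh[of "\<lambda>x. - x"] by (simp add: real_lebesgue_integral_def int assms(3))
qed

text \<open>Both partial differences have this form, so measurability, periodicity and norm bounds
  are proved once for arbitrary shifts in the plane.\<close>

definition shift_series :: "real \<Rightarrow> (nat \<Rightarrow> real \<times> real) \<Rightarrow> (real \<times> real \<Rightarrow> real) \<Rightarrow> real \<times> real \<Rightarrow> real" where
  "shift_series \<alpha> s f z = (\<Sum>\<nu>. binc \<alpha> \<nu> * f (z + s \<nu>))"

lemma frac_diff1_eq: "frac_diff1 \<alpha> h f = shift_series \<alpha> (\<lambda>\<nu>. ((\<alpha> - real \<nu>) * h, 0)) f"
  by (auto simp: frac_diff1_def shift_series_def binc_def)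

lemma frac_diff2_eq: "frac_diff2 \<alpha> h f = shift_series \<alpha> (\<lambda>\<nu>. (0, (\<alpha> - real \<nu>) * h)) f"
  by (auto simp: frac_diff2_def shift_series_def binc_def)

lemma measurable_shift_series [measurable]:
  assumes [measurable]: "f \<in> borel_measurable borel"
  shows "shift_series \<alpha> s f \<in> borel_measurable borel"
  unfolding shift_series_def by measurable

lemma periodic2_shift_series:
  assumes "periodic2 f" shows "periodic2 (shift_series \<alpha> s f)"
proof -
  have "f ((x + 2 * pi, y) + c) = f ((x, y) + c)" "f ((x, y + 2 * pi) + c) = f ((x, y) + c)" for x y c
  proof -
    obtain s t where c: "c = (s, t)" by (cases c)
    have "(x + 2 * pi, y) + c = ((x + s) + 2 * pi, y + t)" "(x, y + 2 * pi) + c = (x + s, (y + t) + 2 * pi)"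
      by (simp_all add: c)
    moreover have "(x, y) + c = (x + s, y + t)" by (simp add: c)
    ultimately show "f ((x + 2 * pi, y) + c) = f ((x, y) + c)" "f ((x, y + 2 * pi) + c) = f ((x, y) + c)"
      using assms unfolding periodic2_def by metis+
  qed
  then show ?thesis by (simp add: periodic2_def shift_series_def)
qed

text \<open>All translates of a periodic function have the same L_1 norm and the binomial
  coefficients are absolutely summable; so the norms of the terms are summable, and series and
  integral may be exchanged.\<close>

lemma shift_series_integral:
  assumes \<alpha>: "0 < \<alpha>" and f [measurable]: "f \<in> borel_measurable borel" and per: "periodic2 f" and int: "integrable tor f"
    and w [measurable]: "w \<in> borel_measurable borel" and bnd: "\<And>z. \<bar>w z\<bar> \<le> 1"
  shows "integrable tor (\<lambda>z. shift_series \<alpha> s f z * w z)"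
    and "(\<integral>z. shift_series \<alpha> s f z * w z \<partial>tor) = (\<Sum>\<nu>. binc \<alpha> \<nu> * (\<integral>z. f (z + s \<nu>) * w z \<partial>tor))"
proof -
  have int_s: "integrable tor (\<lambda>z. f (z + c))" for c
    by (rule integrable_tor_shift(1)[OF f per int])
  have norm_s: "(\<integral>z. \<bar>f (z + c)\<bar> \<partial>tor) = (\<integral>z. \<bar>f z\<bar> \<partial>tor)" for c
    using per int by (intro integrable_tor_shift(2)[of "\<lambda>z. \<bar>f z\<bar>"]) (auto simp: periodic2_def)
  have ae: "AE z in tor. summable (\<lambda>\<nu>. \<bar>binc \<alpha> \<nu> * f (z + s \<nu>)\<bar>)"
  proof -
    have "(\<integral>\<^sup>+z. (\<Sum>\<nu>. ennreal \<bar>binc \<alpha> \<nu> * f (z + s \<nu>)\<bar>) \<partial>tor) = (\<Sum>\<nu>. \<integral>\<^sup>+z. ennreal \<bar>binc \<alpha> \<nu> * f (z + s \<nu>)\<bar> \<partial>tor)"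
      by (rule nn_integral_suminf) (simp add: borel_measurable_tor)
    also have "\<dots> = (\<Sum>\<nu>. ennreal (\<bar>binc \<alpha> \<nu>\<bar> * (\<integral>z. \<bar>f z\<bar> \<partial>tor)))"
      by (intro suminf_cong, subst nn_integral_eq_integral) (auto simp: int_s abs_mult norm_s)
    also have "\<dots> < top"
    proof -
      have "0 \<le> \<bar>binc \<alpha> \<nu>\<bar> * (\<integral>z. \<bar>f z\<bar> \<partial>tor)" for \<nu> by simp
      from ennreal_suminf_neq_top[OF summable_mult2[OF summable_binc[OF \<alpha>]] this]
      show ?thesis by (subst less_top[symmetric]) assumption
    qed
    finally have "AE z in tor. (\<Sum>\<nu>. ennreal \<bar>binc \<alpha> \<nu> * f (z + s \<nu>)\<bar>) \<noteq> top"
      by (intro nn_integral_PInf_AE[unfolded infinity_ennreal_def]) (auto simp: borel_measurable_tor)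
    then show ?thesis
      by eventually_elim (auto intro: summable_suminf_not_top)
  qed
  define F where "F \<nu> z = binc \<alpha> \<nu> * f (z + s \<nu>) * w z" for \<nu> z
  have [measurable]: "F \<nu> \<in> borel_measurable borel" for \<nu> unfolding F_def by measurable
  have intF: "integrable tor (F \<nu>)" for \<nu>
  proof (rule Bochner_Integration.integrable_bound[where f = "\<lambda>z. binc \<alpha> \<nu> * f (z + s \<nu>)"])
    show "AE z in tor. norm (F \<nu> z) \<le> norm (binc \<alpha> \<nu> * f (z + s \<nu>))"
      using bnd by (auto simp: F_def abs_mult mult_left_le)
  qed (auto simp: int_s borel_measurable_tor)
  have sumF: "AE z in tor. summable (\<lambda>\<nu>. norm (F \<nu> z))"
    using ae
  proof eventually_elim
    case (elim z)
    show ?case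
      by (rule summable_comparison_test[OF _ elim]) (use bnd in \<open>auto simp: F_def abs_mult mult_left_le intro!: exI[of _ 0]\<close>)
  qed
  have norms: "summable (\<lambda>\<nu>. \<integral>z. norm (F \<nu> z) \<partial>tor)"
  proof (rule summable_comparison_test)
    have "(\<integral>z. norm (F \<nu> z) \<partial>tor) \<le> (\<integral>z. \<bar>binc \<alpha> \<nu>\<bar> * \<bar>f (z + s \<nu>)\<bar> \<partial>tor)" for \<nu>
      using bnd by (intro integral_mono integrable_norm intF) (auto simp: F_def abs_mult mult_left_le int_s)
    then show "\<exists>N. \<forall>\<nu>\<ge>N. norm (\<integral>z. norm (F \<nu> z) \<partial>tor) \<le> \<bar>binc \<alpha> \<nu>\<bar> * (\<integral>z. \<bar>f z\<bar> \<partial>tor)"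
      by (simp add: norm_s int_s)
    show "summable (\<lambda>\<nu>. \<bar>binc \<alpha> \<nu>\<bar> * (\<integral>z. \<bar>f z\<bar> \<partial>tor))"
      by (intro summable_mult2 summable_binc \<alpha>)
  qed
  \<comment> \<open>Where the series diverges \<open>suminf\<close> is unspecified; by
    \<open>ae\<close> such points form a null set.\<close>
  have eq: "AE z in tor. (\<Sum>\<nu>. F \<nu> z) = shift_series \<alpha> s f z * w z"
    using ae
  proof eventually_elim
    case (elim z)
    then have "summable (\<lambda>\<nu>. binc \<alpha> \<nu> * f (z + s \<nu>))" by (rule summable_rabs_cancel)
    then show ?case by (simp add: F_def shift_series_def suminf_mult2)
  qed
  have [measurable]: "(\<lambda>z. shift_series \<alpha> s f z * w z) \<in> borel_measurable tor"
    by (simp add: borel_measurable_tor)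
  have "integrable tor (\<lambda>z. shift_series \<alpha> s f z * w z) \<longleftrightarrow> integrable tor (\<lambda>z. \<Sum>\<nu>. F \<nu> z)"
    by (rule integrable_cong_AE) (use eq in auto)
  then show "integrable tor (\<lambda>z. shift_series \<alpha> s f z * w z)"
    using integrable_suminf[OF intF sumF norms] by simp
  have "(\<integral>z. shift_series \<alpha> s f z * w z \<partial>tor) = (\<integral>z. (\<Sum>\<nu>. F \<nu> z) \<partial>tor)"
    by (rule integral_cong_AE) (use eq in auto)
  also have "\<dots> = (\<Sum>\<nu>. \<integral>z. F \<nu> z \<partial>tor)" by (rule integral_suminf[OF intF sumF norms])
  also have "\<dots> = (\<Sum>\<nu>. binc \<alpha> \<nu> * (\<integral>z. f (z + s \<nu>) * w z \<partial>tor))"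
    by (simp add: F_def mult.assoc)
  finally show "(\<integral>z. shift_series \<alpha> s f z * w z \<partial>tor) = (\<Sum>\<nu>. binc \<alpha> \<nu> * (\<integral>z. f (z + s \<nu>) * w z \<partial>tor))" .
qed

lemma shift_series_integrable:
  assumes "0 < \<alpha>" "f \<in> borel_measurable borel" "periodic2 f" "integrable tor f"
  shows "integrable tor (shift_series \<alpha> s f)"
  using shift_series_integral(1)[OF assms, of "\<lambda>_. 1" s] by simp

text \<open>The bound by the series of absolute values holds at every point in [0, \<infinity>];
  then the averaging inequality applies, because all translates of \<open>f\<close> have the same
  norm.\<close>

lemma shift_series_powr_bound:
  assumes \<alpha>: "0 < \<alpha>" and p: "1 < p" and f [measurable]: "f \<in> borel_measurable borel" and per: "periodic2 f"
  shows "(\<integral>\<^sup>+z. ennreal_powr (ennreal \<bar>shift_series \<alpha> s f z\<bar>) p \<partial>tor)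
    \<le> ennreal_powr (ennreal (\<Sum>\<nu>. \<bar>binc \<alpha> \<nu>\<bar>)) p * (\<integral>\<^sup>+z. ennreal_powr (ennreal \<bar>f z\<bar>) p \<partial>tor)"
proof -
  have e: "ennreal \<bar>binc \<alpha> \<nu> * f (z + s \<nu>)\<bar> = ennreal \<bar>binc \<alpha> \<nu>\<bar> * ennreal \<bar>f (z + s \<nu>)\<bar>" for \<nu> z
    by (simp add: abs_mult ennreal_mult)
  have pt: "ennreal \<bar>shift_series \<alpha> s f z\<bar> \<le> (\<integral>\<^sup>+\<nu>. ennreal \<bar>binc \<alpha> \<nu>\<bar> * ennreal \<bar>f (z + s \<nu>)\<bar> \<partial>count_space UNIV)" for z
  proof (cases "summable (\<lambda>\<nu>. \<bar>binc \<alpha> \<nu> * f (z + s \<nu>)\<bar>)")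
    case True
    have "\<bar>shift_series \<alpha> s f z\<bar> \<le> (\<Sum>\<nu>. \<bar>binc \<alpha> \<nu> * f (z + s \<nu>)\<bar>)"
      unfolding shift_series_def by (rule summable_rabs[OF True])
    then have "ennreal \<bar>shift_series \<alpha> s f z\<bar> \<le> ennreal (\<Sum>\<nu>. \<bar>binc \<alpha> \<nu> * f (z + s \<nu>)\<bar>)"
      by (rule ennreal_leI)
    also have "\<dots> = (\<Sum>\<nu>. ennreal \<bar>binc \<alpha> \<nu> * f (z + s \<nu>)\<bar>)"
      using True by (intro suminf_ennreal2[symmetric]) auto
    finally show ?thesis by (simp only: nn_integral_count_space_nat e)
  next
    \<comment> \<open>Without absolute convergence the right-hand side is infinite, whatever value
      \<open>suminf\<close> takes.\<close>
    case False
    have "(\<Sum>\<nu>. ennreal \<bar>binc \<alpha> \<nu> * f (z + s \<nu>)\<bar>) = top"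
    proof (rule ccontr)
      assume "(\<Sum>\<nu>. ennreal \<bar>binc \<alpha> \<nu> * f (z + s \<nu>)\<bar>) \<noteq> top"
      from summable_suminf_not_top[OF abs_ge_zero this] False show False by contradiction
    qed
    then have "(\<integral>\<^sup>+\<nu>. ennreal \<bar>binc \<alpha> \<nu>\<bar> * ennreal \<bar>f (z + s \<nu>)\<bar> \<partial>count_space UNIV) = top"
      by (simp only: nn_integral_count_space_nat e)
    then show ?thesis by simp
  qed
  have "(\<integral>\<^sup>+z. ennreal_powr (ennreal \<bar>shift_series \<alpha> s f z\<bar>) p \<partial>tor)
    \<le> (\<integral>\<^sup>+z. ennreal_powr (\<integral>\<^sup>+\<nu>. ennreal \<bar>binc \<alpha> \<nu>\<bar> * ennreal \<bar>f (z + s \<nu>)\<bar> \<partial>count_space UNIV) p \<partial>tor)"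
    using p by (intro nn_integral_mono ennreal_powr_mono pt) auto
  also have "\<dots> \<le> ennreal_powr (ennreal (\<Sum>\<nu>. \<bar>binc \<alpha> \<nu>\<bar>)) p * (\<integral>\<^sup>+z. ennreal_powr (ennreal \<bar>f z\<bar>) p \<partial>tor)"
  proof (rule nn_integral_weighted_sum_powr[OF p])
    show "(\<integral>\<^sup>+\<nu>. ennreal \<bar>binc \<alpha> \<nu>\<bar> \<partial>count_space UNIV) = ennreal (\<Sum>\<nu>. \<bar>binc \<alpha> \<nu>\<bar>)"
      using summable_binc[OF \<alpha>] by (simp add: nn_integral_count_space_nat suminf_ennreal2)
    show "(\<integral>\<^sup>+z. ennreal_powr (ennreal \<bar>f (z + s \<nu>)\<bar>) p \<partial>tor) \<le> (\<integral>\<^sup>+z. ennreal_powr (ennreal \<bar>f z\<bar>) p \<partial>tor)" for \<nu>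
      using per by (subst nn_integral_tor_shift[of "\<lambda>z. ennreal_powr (ennreal \<bar>f z\<bar>) p"]) (auto simp: periodic2_def)
  qed (auto simp: borel_measurable_tor tor.P.sigma_finite_measure_axioms)
  finally show ?thesis .
qed

text \<open>The counterpart of \<open>has_cosine_Fourier_series\<close> for \<open>tor\<close>,
  cleared of the normalising factors; those of index 0 drop out because the integrals vanish
  there.\<close>

definition cosine_coeffs :: "(real \<times> real \<Rightarrow> real) \<Rightarrow> (nat \<Rightarrow> nat \<Rightarrow> real) \<Rightarrow> bool" where
  "cosine_coeffs f a \<longleftrightarrow> (\<forall>i j.
     (\<integral>z. f z * cos (real i * fst z) * cos (real j * snd z) \<partial>tor) = (if i \<ge> 1 \<and> j \<ge> 1 then pi\<^sup>2 * a i j else 0)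
   \<and> (\<integral>z. f z * cos (real i * fst z) * sin (real j * snd z) \<partial>tor) = 0
   \<and> (\<integral>z. f z * sin (real i * fst z) * cos (real j * snd z) \<partial>tor) = 0
   \<and> (\<integral>z. f z * sin (real i * fst z) * sin (real j * snd z) \<partial>tor) = 0)"

lemma integrable_tor_mult:
  fixes f :: "real \<times> real \<Rightarrow> real"
  assumes "integrable tor f" and [measurable]: "w \<in> borel_measurable borel" and bnd: "\<And>z. \<bar>w z\<bar> \<le> B"
  shows "integrable tor (\<lambda>z. f z * w z)"
proof (rule Bochner_Integration.integrable_bound[where f = "\<lambda>z. B * f z"])
  have [measurable]: "f \<in> borel_measurable borel" using assms(1) by (auto simp flip: borel_measurable_tor)
  show "(\<lambda>z. f z * w z) \<in> borel_measurable tor" by (simp add: borel_measurable_tor)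
  show "AE z in tor. norm (f z * w z) \<le> norm (B * f z)"
    using bnd by (auto simp: abs_mult mult.commute[of B] intro!: mult_left_mono order.trans[OF bnd])
qed (use assms in simp)

lemma cosine_coeffs_phase:
  assumes int: "integrable tor f" and a: "cosine_coeffs f a" and ij: "1 \<le> i" "1 \<le> j"
  shows "(\<integral>z. f z * (cos (real i * fst z + \<theta>) * cos (real j * snd z + \<theta>')) \<partial>tor) = pi\<^sup>2 * a i j * cos \<theta> * cos \<theta>'"
proof -
  have I: "integrable tor (\<lambda>z. f z * u (real i * fst z) * v (real j * snd z))"
    if [measurable]: "u \<in> borel_measurable borel" "v \<in> borel_measurable borel" and "\<And>x. \<bar>u x\<bar> \<le> 1" "\<And>x. \<bar>v x\<bar> \<le> 1" for u v :: "real \<Rightarrow> real"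
  proof -
    have "\<bar>u x * v y\<bar> \<le> 1" for x y
      using mult_mono[of "\<bar>u x\<bar>" 1 "\<bar>v y\<bar>" 1] that(3,4) by (simp add: abs_mult)
    then show ?thesis
      using integrable_tor_mult[OF int, of "\<lambda>z. u (real i * fst z) * v (real j * snd z)" 1] by (simp add: mult.assoc)
  qed
  have "(\<integral>z. f z * (cos (real i * fst z + \<theta>) * cos (real j * snd z + \<theta>')) \<partial>tor)
    = (\<integral>z. (cos \<theta> * cos \<theta>') * (f z * cos (real i * fst z) * cos (real j * snd z))
        - (cos \<theta> * sin \<theta>') * (f z * cos (real i * fst z) * sin (real j * snd z))
        - (sin \<theta> * cos \<theta>') * (f z * sin (real i * fst z) * cos (real j * snd z))
        + (sin \<theta> * sin \<theta>') * (f z * sin (real i * fst z) * sin (real j * snd z)) \<partial>tor)"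
    by (intro Bochner_Integration.integral_cong refl) (simp add: cos_add algebra_simps)
  also have "\<dots> = (cos \<theta> * cos \<theta>') * (pi\<^sup>2 * a i j)"
    using a ij by (simp add: I cosine_coeffs_def)
  finally show ?thesis by (simp add: mult_ac)
qed

text \<open>Periodicity moves the translation from \<open>f\<close> to the test function, where it
  only changes phases.\<close>

lemma shift_cos_integral:
  assumes f [measurable]: "f \<in> borel_measurable borel" and per: "periodic2 f" and int: "integrable tor f"
  shows "(\<integral>z. f (z + (s, t)) * (cos (real i * fst z + \<theta>) * cos (real j * snd z + \<theta>')) \<partial>tor)
     = (\<integral>z. f z * (cos (real i * fst z + (\<theta> - real i * s)) * cos (real j * snd z + (\<theta>' - real j * t))) \<partial>tor)"
proof -
  define F where "F z = f z * (cos (real i * fst z + (\<theta> - real i * s)) * cos (real j * snd z + (\<theta>' - real j * t)))" for z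
  have "(\<integral>z. F (z + (s, t)) \<partial>tor) = (\<integral>z. F z \<partial>tor)"
  proof (rule integrable_tor_shift(2))
    have per_cos: "cos (real k * (x + 2 * pi) + c) = cos (real k * x + c)" for k x c
    proof -
      have "real k * (x + 2 * pi) + c = (real k * x + c) + 2 * of_int (int k) * pi" by (simp add: algebra_simps)
      then show ?thesis by (simp only: cos_add sin_int_2pin cos_int_2pin) simp
    qed
    show "periodic2 F" using per by (simp add: periodic2_def F_def per_cos)
    show "F \<in> borel_measurable borel" unfolding F_def by measurable
    have "\<bar>cos x * cos y\<bar> \<le> 1" for x y :: real
      using mult_mono[of "\<bar>cos x\<bar>" 1 "\<bar>cos y\<bar>" 1] by (simp add: abs_mult)
    then show "integrable tor F"
      unfolding F_def by (intro integrable_tor_mult[OF int, where B = 1]) auto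
  qed
  then show ?thesis by (simp add: F_def algebra_simps)
qed

text \<open>By \<open>suminf_binc_cos\<close> this is the real part of cis \<theta> times the
  conjugate of \<open>diff_mult\<close>; it attains the modulus of the multiplier when \<theta> is
  the argument.\<close>

definition phase_mult :: "real \<Rightarrow> real \<Rightarrow> nat \<Rightarrow> real \<Rightarrow> real" where
  "phase_mult \<alpha> h j \<theta> = (\<Sum>\<nu>. binc \<alpha> \<nu> * cos (\<theta> - real j * ((\<alpha> - real \<nu>) * h)))"

lemma frac_diff_cos_integral:
  assumes \<alpha>: "0 < \<alpha>1" "0 < \<alpha>2" and f [measurable]: "f \<in> borel_measurable borel" and per: "periodic2 f" and int: "integrable tor f"
    and a: "cosine_coeffs f a" and ij: "1 \<le> i" "1 \<le> j"
  shows "(\<integral>z. frac_diff1 \<alpha>1 h1 (frac_diff2 \<alpha>2 h2 f) z * (cos (real i * fst z + \<theta>) * cos (real j * snd z + \<theta>')) \<partial>tor)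
    = pi\<^sup>2 * a i j * phase_mult \<alpha>1 h1 i \<theta> * phase_mult \<alpha>2 h2 j \<theta>'"
proof -
  define g where "g = frac_diff2 \<alpha>2 h2 f"
  have g [measurable]: "g \<in> borel_measurable borel" and per_g: "periodic2 g" and int_g: "integrable tor g"
    unfolding g_def frac_diff2_eq using assms by (auto intro!: periodic2_shift_series shift_series_integrable)
  have b: "\<bar>cos x * cos y\<bar> \<le> 1" for x y :: real
    using mult_mono[of "\<bar>cos x\<bar>" 1 "\<bar>cos y\<bar>" 1] by (simp add: abs_mult)
  have summ: "summable (\<lambda>\<nu>. binc \<alpha> \<nu> * cos (c \<nu>))" if "0 < \<alpha>" for \<alpha> and c :: "nat \<Rightarrow> real"
    using summable_binc_mult[OF that, of "\<lambda>\<nu>. cos (c \<nu>)" 1] by simp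
  have G: "(\<integral>z. g z * (cos (real i * fst z + \<theta>) * cos (real j * snd z + \<theta>')) \<partial>tor) = pi\<^sup>2 * a i j * cos \<theta> * phase_mult \<alpha>2 h2 j \<theta>'" for \<theta>
  proof -
    have "(\<integral>z. g z * (cos (real i * fst z + \<theta>) * cos (real j * snd z + \<theta>')) \<partial>tor)
      = (\<Sum>\<nu>. binc \<alpha>2 \<nu> * (\<integral>z. f (z + (0, (\<alpha>2 - real \<nu>) * h2)) * (cos (real i * fst z + \<theta>) * cos (real j * snd z + \<theta>')) \<partial>tor))"
      unfolding g_def frac_diff2_eq using b by (intro shift_series_integral(2) assms) auto
    also have "\<dots> = (\<Sum>\<nu>. (pi\<^sup>2 * a i j * cos \<theta>) * (binc \<alpha>2 \<nu> * cos (\<theta>' - real j * ((\<alpha>2 - real \<nu>) * h2))))"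
      by (simp only: shift_cos_integral[OF f per int] cosine_coeffs_phase[OF int a ij]) (simp add: mult_ac)
    also have "\<dots> = (pi\<^sup>2 * a i j * cos \<theta>) * phase_mult \<alpha>2 h2 j \<theta>'"
      unfolding phase_mult_def by (rule suminf_mult[OF summ[OF \<alpha>(2)]])
    finally show ?thesis .
  qed
  have "(\<integral>z. frac_diff1 \<alpha>1 h1 g z * (cos (real i * fst z + \<theta>) * cos (real j * snd z + \<theta>')) \<partial>tor)
      = (\<Sum>\<nu>. binc \<alpha>1 \<nu> * (\<integral>z. g (z + ((\<alpha>1 - real \<nu>) * h1, 0)) * (cos (real i * fst z + \<theta>) * cos (real j * snd z + \<theta>')) \<partial>tor))"
    unfolding frac_diff1_eq using b by (intro shift_series_integral(2) \<alpha> g per_g int_g) auto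
  also have "\<dots> = (\<Sum>\<nu>. (pi\<^sup>2 * a i j * phase_mult \<alpha>2 h2 j \<theta>') * (binc \<alpha>1 \<nu> * cos (\<theta> - real i * ((\<alpha>1 - real \<nu>) * h1))))"
    by (simp only: shift_cos_integral[OF g per_g int_g] mult_zero_right diff_zero G) (simp add: mult_ac)
  also have "\<dots> = (pi\<^sup>2 * a i j * phase_mult \<alpha>2 h2 j \<theta>') * phase_mult \<alpha>1 h1 i \<theta>"
    unfolding phase_mult_def[of \<alpha>1] by (rule suminf_mult[OF summ[OF \<alpha>(1)]])
  finally show ?thesis by (simp add: g_def mult_ac)
qed

section \<open>Uniqueness of Fourier coefficients\<close>

text \<open>N times the Fejer kernel; the division by N is postponed until the limit is
  taken.\<close>

definition fejer :: "nat \<Rightarrow> real \<Rightarrow> real" where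
  "fejer N t = (\<Sum>m<N. 1 + 2 * (\<Sum>k=1..m. cos (real k * t)))"

text \<open>The closed form of the kernel, multiplied out so that it also holds at zeros of the
  sine.\<close>

lemma fejer_sin_sq: "fejer N t * (sin (t / 2))\<^sup>2 = (sin (real N * t / 2))\<^sup>2"
proof -
  have step: "(1 + 2 * (\<Sum>k=1..m. cos (real k * t))) * sin (t / 2) = sin ((real m + 1 / 2) * t)" for m
  proof -
    have "2 * sin (t / 2) * (\<Sum>k=1..m. cos (real k * t)) = sin ((real m + 1 / 2) * t) - sin (t / 2)"
      using sum_cos_times_sin[where z = t and q = m and \<theta> = 0] by (simp only: add_0_right)
    moreover have "(1 + 2 * S) * r = r + 2 * r * S" for r S :: real by (simp add: algebra_simps)
    ultimately show ?thesis by simp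
  qed
  have "fejer N t * (sin (t / 2))\<^sup>2 = (\<Sum>m<N. sin ((real m + 1 / 2) * t) * sin (t / 2))"
    by (simp only: fejer_def sum_distrib_right step[symmetric] power2_eq_square mult.assoc)
  also have "\<dots> = (sin (real N * t / 2))\<^sup>2"
  proof (induction N)
    case (Suc N)
    define A where "A = real N * t / 2"
    define B where "B = t / 2"
    have e: "(real N + 1 / 2) * t = 2 * A + B" "real (Suc N) * t / 2 = A + B"
      by (simp_all add: A_def B_def field_simps)
    have "(sin (A + B))\<^sup>2 - (sin A)\<^sup>2 = sin (2 * A + B) * sin B"
    proof -
      have "(cos B)\<^sup>2 = 1 - (sin B)\<^sup>2" by (rule cos_squared_eq)
      then show ?thesis unfolding sin_add sin_double cos_double by algebra
    qed
    then show ?case using Suc by (simp add: e A_def[symmetric] B_def[symmetric] del: of_nat_Suc)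
  qed simp
  finally show ?thesis .
qed

lemma fejer_nonneg: "0 \<le> fejer N t"
proof (cases "sin (t / 2) = 0")
  case True
  then obtain i :: int where i: "t / 2 = of_int i * pi" by (auto simp: sin_zero_iff_int2)
  have "cos (real k * t) = 1" for k
  proof -
    have "real k * t = 2 * pi * of_int (int k * i)" using i by (simp add: field_simps)
    then show ?thesis by (simp only: cos_int_2pin)
  qed
  then show ?thesis by (simp add: fejer_def sum_nonneg)
next
  case False
  then have "0 < (sin (t / 2))\<^sup>2" by simp
  moreover have "0 \<le> fejer N t * (sin (t / 2))\<^sup>2" by (simp add: fejer_sin_sq)
  ultimately show ?thesis by (simp add: zero_le_mult_iff)
qed

lemma fejer_le: assumes "0 < \<delta>" "\<delta> \<le> \<bar>sin (t / 2)\<bar>" shows "fejer N t \<le> 1 / \<delta>\<^sup>2"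
proof -
  have "fejer N t * \<delta>\<^sup>2 \<le> fejer N t * (sin (t / 2))\<^sup>2"
    using assms by (intro mult_left_mono fejer_nonneg) (auto simp: abs_le_square_iff[symmetric])
  also have "\<dots> \<le> 1" unfolding fejer_sin_sq by (simp add: power2_eq_1_iff abs_square_le_1)
  finally show ?thesis using assms by (simp add: field_simps)
qed

text \<open>\<open>fejer_interval N c d x / (2 * pi * N)\<close> is the Fejer mean of the indicator of \<open>{c..d}\<close>.\<close>

definition fejer_interval :: "nat \<Rightarrow> real \<Rightarrow> real \<Rightarrow> real \<Rightarrow> real" where
  "fejer_interval N c d x = integral {c..d} (\<lambda>s. fejer N (x - s))"

lemma continuous_on_fejer: "continuous_on A (\<lambda>s. fejer N (x - s))"
  unfolding fejer_def by (intro continuous_intros)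

lemma fejer_interval_eq:
  assumes "c \<le> d"
  shows "fejer_interval N c d x = (\<Sum>m<N. (d - c) + 2 * (\<Sum>k=1..m. cos (real k * x) * integral {c..d} (\<lambda>s. cos (real k * s))
      + sin (real k * x) * integral {c..d} (\<lambda>s. sin (real k * s))))"
proof -
  have eq: "fejer N (x - s) = (\<Sum>m<N. 1 + 2 * (\<Sum>k=1..m. cos (real k * x) * cos (real k * s) + sin (real k * x) * sin (real k * s)))" for s
    by (simp add: fejer_def right_diff_distrib cos_diff)
  have "((\<lambda>s. fejer N (x - s)) has_integral (\<Sum>m<N. (d - c) + 2 * (\<Sum>k=1..m. cos (real k * x) * integral {c..d} (\<lambda>s. cos (real k * s))
      + sin (real k * x) * integral {c..d} (\<lambda>s. sin (real k * s))))) {c..d}"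
    unfolding eq
  proof (intro has_integral_sum has_integral_add has_integral_mult_right integrable_integral integrable_continuous_interval continuous_intros)
    show "((\<lambda>s. 1) has_integral d - c) {c..d}" using has_integral_const_real[of "1 :: real" c d] assms by simp
  qed auto
  then show ?thesis unfolding fejer_interval_def by (rule integral_unique)
qed

lemma measurable_fejer_interval [measurable]: "c \<le> d \<Longrightarrow> fejer_interval N c d \<in> borel_measurable borel"
proof -
  assume "c \<le> d"
  then have "fejer_interval N c d = (\<lambda>x. \<Sum>m<N. (d - c) + 2 * (\<Sum>k=1..m. cos (real k * x) * integral {c..d} (\<lambda>s. cos (real k * s))
      + sin (real k * x) * integral {c..d} (\<lambda>s. sin (real k * s))))"
    by (intro ext fejer_interval_eq)
  then show ?thesis by simp
qed

lemma fejer_interval_nonneg: "0 \<le> fejer_interval N c d x"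
  unfolding fejer_interval_def
  by (intro integral_nonneg integrable_continuous_interval continuous_on_fejer fejer_nonneg)

lemma fejer_interval_combine:
  assumes "c \<le> e" "e \<le> d"
  shows "fejer_interval N c e x + fejer_interval N e d x = fejer_interval N c d x"
  unfolding fejer_interval_def
  by (intro Henstock_Kurzweil_Integration.integral_combine assms integrable_continuous_interval continuous_on_fejer)

lemma integral_trig_period:
  assumes "1 \<le> k"
  shows "integral {0..2 * pi} (\<lambda>s. cos (real k * s + \<theta>)) = 0"
proof -
  have "((\<lambda>s. cos (real k * s + \<theta>)) has_integral sin (real k * (2 * pi) + \<theta>) / real k - sin (real k * 0 + \<theta>) / real k) {0..2 * pi}"
    using assms by (intro fundamental_theorem_of_calculus)
      (auto simp: has_real_derivative_iff_has_vector_derivative[symmetric] intro!: derivative_eq_intros)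
  moreover have "sin (real k * (2 * pi) + \<theta>) = sin \<theta>"
  proof -
    have "real k * (2 * pi) + \<theta> = \<theta> + 2 * of_int (int k) * pi" by simp
    then show ?thesis by (simp only: sin_add sin_int_2pin cos_int_2pin) simp
  qed
  ultimately show ?thesis by (auto intro: integral_unique)
qed

lemma fejer_interval_period: "fejer_interval N 0 (2 * pi) x = 2 * pi * real N"
proof -
  have "integral {0..2 * pi} (\<lambda>s. cos (real k * s)) = 0" "integral {0..2 * pi} (\<lambda>s. sin (real k * s)) = 0" if "1 \<le> k" for k
    using integral_trig_period[OF that, of 0] integral_trig_period[OF that, of "- (pi / 2)"]
    by (simp_all add: cos_diff)
  then show ?thesis by (subst fejer_interval_eq) auto
qed

lemma fejer_interval_le:
  assumes "0 \<le> c" "c \<le> d" "d \<le> 2 * pi"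
  shows "fejer_interval N c d x \<le> 2 * pi * real N"
proof -
  have "fejer_interval N 0 c x + fejer_interval N c d x + fejer_interval N d (2 * pi) x = 2 * pi * real N"
    using assms by (simp add: fejer_interval_combine fejer_interval_period)
  then show ?thesis using fejer_interval_nonneg[of N 0 c x] fejer_interval_nonneg[of N d "2 * pi" x] by linarith
qed

text \<open>By compactness |sin ((x - s) / 2)| is bounded below on the interval, so the kernel stays
  bounded there while the normalisation grows. As 0 and 2 \<pi> are the same point of the circle, x
  is kept inside the open period.\<close>

lemma fejer_interval_off:
  assumes cd: "0 \<le> c" "c \<le> d" "d \<le> 2 * pi" and x: "0 < x" "x < 2 * pi" "x \<notin> {c..d}"
  shows "(\<lambda>N. fejer_interval N c d x / (2 * pi * real N)) \<longlonglongrightarrow> 0"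
proof -
  have pos: "0 < \<bar>sin ((x - s) / 2)\<bar>" if "s \<in> {c..d}" for s
  proof -
    have "x - s \<noteq> 0" "\<bar>x - s\<bar> < 2 * pi" using that cd x by auto
    show ?thesis
    proof (cases "s < x")
      case True
      then have "0 < sin ((x - s) / 2)" using \<open>\<bar>x - s\<bar> < 2 * pi\<close> by (intro sin_gt_zero) auto
      then show ?thesis by simp
    next
      case False
      then have "0 < sin ((s - x) / 2)" using \<open>\<bar>x - s\<bar> < 2 * pi\<close> \<open>x - s \<noteq> 0\<close> by (intro sin_gt_zero) auto
      moreover have "sin ((x - s) / 2) = - sin ((s - x) / 2)"
      proof -
        have "(x - s) / 2 = - ((s - x) / 2)" by (simp add: field_simps)
        then show ?thesis by (simp only: sin_minus)
      qed
      ultimately show ?thesis by simp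
    qed
  qed
  have "\<exists>s0\<in>{c..d}. \<forall>s\<in>{c..d}. \<bar>sin ((x - s0) / 2)\<bar> \<le> \<bar>sin ((x - s) / 2)\<bar>"
    using cd by (intro continuous_attains_inf continuous_intros) auto
  then obtain \<delta> where \<delta>: "0 < \<delta>" "\<And>s. s \<in> {c..d} \<Longrightarrow> \<delta> \<le> \<bar>sin ((x - s) / 2)\<bar>"
    using pos by metis
  have "fejer_interval N c d x \<le> (d - c) * (1 / \<delta>\<^sup>2)" for N
  proof -
    have "fejer_interval N c d x \<le> integral {c..d} (\<lambda>s. 1 / \<delta>\<^sup>2)"
      unfolding fejer_interval_def
      by (intro integral_le integrable_continuous_interval continuous_on_fejer fejer_le \<delta>) auto
    then show ?thesis using cd by simp
  qed
  then have "fejer_interval N c d x / (2 * pi * real N) \<le> (d - c) * (1 / \<delta>\<^sup>2) / (2 * pi * real N)" for N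
    by (intro divide_right_mono) auto
  then have A: "\<forall>N. norm (fejer_interval N c d x / (2 * pi * real N)) \<le> (d - c) * (1 / \<delta>\<^sup>2) / (2 * pi) * (1 / real N)"
    using fejer_interval_nonneg[of _ c d x] by (simp add: mult.assoc)
  have B: "(\<lambda>N. (d - c) * (1 / \<delta>\<^sup>2) / (2 * pi) * (1 / real N)) \<longlonglongrightarrow> 0"
    by (intro tendsto_mult_right_zero lim_1_over_n)
  show ?thesis by (rule Lim_null_comparison[OF always_eventually[OF A] B])
qed

text \<open>For x inside the interval, the means over the two complementary intervals decay, and the
  three means add up to 1.\<close>

lemma fejer_interval_tendsto:
  assumes cd: "0 \<le> c" "c \<le> d" "d \<le> 2 * pi" and x: "0 < x" "x < 2 * pi" "x \<noteq> c" "x \<noteq> d"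
  shows "(\<lambda>N. fejer_interval N c d x / (2 * pi * real N)) \<longlonglongrightarrow> indicator {c<..<d} x"
proof (cases "x \<in> {c<..<d}")
  case True
  have "(\<lambda>N. 1 - fejer_interval N 0 c x / (2 * pi * real N) - fejer_interval N d (2 * pi) x / (2 * pi * real N)) \<longlonglongrightarrow> 1 - 0 - 0"
    using True cd by (intro tendsto_diff tendsto_const fejer_interval_off) auto
  moreover have "\<forall>\<^sub>F N in sequentially. 1 - fejer_interval N 0 c x / (2 * pi * real N) - fejer_interval N d (2 * pi) x / (2 * pi * real N)
      = fejer_interval N c d x / (2 * pi * real N)"
    using eventually_gt_at_top[of 0]
  proof eventually_elim
    case (elim N)
    have "fejer_interval N 0 c x + fejer_interval N c d x + fejer_interval N d (2 * pi) x = 2 * pi * real N"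
      using cd by (simp add: fejer_interval_combine fejer_interval_period)
    then have "(fejer_interval N 0 c x + fejer_interval N c d x + fejer_interval N d (2 * pi) x) / (2 * pi * real N) = 1"
      using elim by simp
    then show ?case by (simp add: add_divide_distrib)
  qed
  ultimately show ?thesis using True by (auto intro: Lim_transform_eventually)
next
  case False
  then show ?thesis using fejer_interval_off[OF cd x(1,2)] x by auto
qed

text \<open>An arbitrary measure and coordinate map \<open>b\<close> allow the two variables to be
  treated one after the other, with the factor in the other variable absorbed in
  \<open>G\<close>.\<close>

lemma integral_mult_fejer_interval_zero:
  assumes int: "\<And>u. u \<in> borel_measurable borel \<Longrightarrow> (\<And>x. \<bar>u x\<bar> \<le> 1) \<Longrightarrow> integrable M (\<lambda>z. G z * u (b z))"
    and 0: "\<And>k :: nat. (\<integral>z. G z * cos (real k * b z) \<partial>M) = 0" "\<And>k :: nat. (\<integral>z. G z * sin (real k * b z) \<partial>M) = 0"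
    and "c \<le> d"
  shows "(\<integral>z. G z * fejer_interval N c d (b z) \<partial>M) = (0 :: real)"
proof -
  have i [simp]: "integrable M (\<lambda>z. G z * cos (real k * b z))" "integrable M (\<lambda>z. G z * sin (real k * b z))" for k :: nat
    by (rule int; simp)+
  have i1 [simp]: "integrable M G" using int[of "\<lambda>_. 1"] by simp
  have 1 [simp]: "(\<integral>z. G z \<partial>M) = 0" using 0(1)[of 0] by simp
  have "G z * fejer_interval N c d (b z) = (\<Sum>m<N. (d - c) * G z + 2 * (\<Sum>k=1..m. integral {c..d} (\<lambda>s. cos (real k * s)) * (G z * cos (real k * b z))
      + integral {c..d} (\<lambda>s. sin (real k * s)) * (G z * sin (real k * b z))))" for z
    unfolding fejer_interval_eq[OF \<open>c \<le> d\<close>] sum_distrib_left by (intro sum.cong refl) (simp add: distrib_left sum_distrib_left mult_ac)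
  then show ?thesis by (simp add: 0)
qed

text \<open>Products of Fejer means of indicators are trigonometric polynomials, so their integrals
  against \<open>F\<close> vanish; dominated convergence gives integral 0 over every rectangle.
  Rectangles generate the Borel sets, hence the positive and the negative part of \<open>F\<close>
  define the same measure.\<close>

lemma trig_uniqueness:
  assumes F: "integrable tor F"
    and 0: "\<And>i j :: nat. (\<integral>z. F z * cos (real i * fst z) * cos (real j * snd z) \<partial>tor) = 0"
      "\<And>i j :: nat. (\<integral>z. F z * cos (real i * fst z) * sin (real j * snd z) \<partial>tor) = 0"
      "\<And>i j :: nat. (\<integral>z. F z * sin (real i * fst z) * cos (real j * snd z) \<partial>tor) = 0"
      "\<And>i j :: nat. (\<integral>z. F z * sin (real i * fst z) * sin (real j * snd z) \<partial>tor) = 0"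
  shows "AE z in tor. F z = (0 :: real)"
proof -
  have Fm [measurable]: "F \<in> borel_measurable borel" using F by (auto simp flip: borel_measurable_tor)
  have Fe: "integrable tor (\<lambda>z. F z * u (fst z) * v (snd z))"
    if [measurable]: "u \<in> borel_measurable borel" "v \<in> borel_measurable borel" and "\<And>x. \<bar>u x\<bar> \<le> A" "\<And>x. \<bar>v x\<bar> \<le> B" for u v :: "real \<Rightarrow> real" and A B
  proof -
    have "\<bar>u (fst z) * v (snd z)\<bar> \<le> A * B" for z
      using that(3,4) order.trans[OF abs_ge_zero that(3)] by (simp add: abs_mult mult_mono)
    then have "integrable tor (\<lambda>z. F z * (u (fst z) * v (snd z)))"
      by (intro integrable_tor_mult[OF F, where B = "A * B"]) auto
    then show ?thesis by (simp add: mult.assoc)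
  qed
  have rect: "(\<integral>z. F z * indicator {c<..<d} (fst z) * indicator {c'<..<d'} (snd z) \<partial>tor) = 0"
    if cd: "0 \<le> c" "c \<le> d" "d \<le> 2 * pi" and cd': "0 \<le> c'" "c' \<le> d'" "d' \<le> 2 * pi" for c d c' d'
  proof -
    define V where "V N x = fejer_interval N c d x / (2 * pi * real N)" for N x
    define V' where "V' N x = fejer_interval N c' d' x / (2 * pi * real N)" for N x
    have [measurable]: "V N \<in> borel_measurable borel" "V' N \<in> borel_measurable borel" for N
      using cd cd' unfolding V_def V'_def by measurable
    have bV: "\<bar>V N x\<bar> \<le> 1" for N x
      using fejer_interval_le[OF cd, of N x] fejer_interval_nonneg[of N c d x]
      by (cases "N = 0") (auto simp: V_def field_simps)
    have bV': "\<bar>V' N x\<bar> \<le> 1" for N x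
      using fejer_interval_le[OF cd', of N x] fejer_interval_nonneg[of N c' d' x]
      by (cases "N = 0") (auto simp: V'_def field_simps)
    have bF: "\<bar>fejer_interval N c d x\<bar> \<le> 2 * pi * real N" for N x
      using fejer_interval_le[OF cd, of N x] fejer_interval_nonneg[of N c d x] by simp
    have [measurable]: "fejer_interval N c d \<in> borel_measurable borel" for N using cd by simp
    have Z1: "(\<integral>z. (F z * v (snd z)) * fejer_interval N c d (fst z) \<partial>tor) = 0"
      if v: "v = (\<lambda>y. cos (real j * y)) \<or> v = (\<lambda>y. sin (real j * y))" for v and j N :: nat
    proof (rule integral_mult_fejer_interval_zero)
      have vm [measurable]: "v \<in> borel_measurable borel" using v by auto
      have vb: "\<bar>v y\<bar> \<le> 1" for y using v by auto
      show "integrable tor (\<lambda>z. F z * v (snd z) * u (fst z))" if "u \<in> borel_measurable borel" "\<And>x. \<bar>u x\<bar> \<le> 1" for u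
        using Fe[OF that(1) vm that(2) vb] by (simp add: mult_ac)
      show "(\<integral>z. F z * v (snd z) * cos (real k * fst z) \<partial>tor) = 0" "(\<integral>z. F z * v (snd z) * sin (real k * fst z) \<partial>tor) = 0" for k :: nat
        using v 0[of k j] by (auto simp: mult_ac)
    qed (use cd in auto)
    have Z2: "(\<integral>z. (F z * fejer_interval N c d (fst z)) * fejer_interval N c' d' (snd z) \<partial>tor) = 0" for N
    proof (rule integral_mult_fejer_interval_zero)
      show "integrable tor (\<lambda>z. F z * fejer_interval N c d (fst z) * u (snd z))" if "u \<in> borel_measurable borel" "\<And>x. \<bar>u x\<bar> \<le> 1" for u
        using that(2) by (intro Fe[where u = "fejer_interval N c d" and v = u, OF _ that(1) bF]) auto
      show "(\<integral>z. F z * fejer_interval N c d (fst z) * cos (real k * snd z) \<partial>tor) = 0" "(\<integral>z. F z * fejer_interval N c d (fst z) * sin (real k * snd z) \<partial>tor) = 0" for k :: nat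
        using Z1[of "\<lambda>y. cos (real k * y)" k N] Z1[of "\<lambda>y. sin (real k * y)" k N] by (simp_all add: mult_ac)
    qed (use cd' in auto)
    have Z: "(\<integral>z. F z * V N (fst z) * V' N (snd z) \<partial>tor) = 0" for N
    proof -
      have "F z * V N (fst z) * V' N (snd z) = (F z * fejer_interval N c d (fst z)) * fejer_interval N c' d' (snd z) / ((2 * pi * real N) * (2 * pi * real N))" for z
        by (simp add: V_def V'_def)
      then show ?thesis using Z2[of N] by simp
    qed
    have ne: "AE x in circ. x \<noteq> e" for e
      by (intro AE_circ AE_lborel_singleton)
    have "AE x in circ. x \<in> {0<..<2 * pi}"
    proof -
      have "AE x in circ. x \<in> {0..2 * pi}"
        unfolding circ_def by (subst AE_density) (auto simp: indicator_def)
      then show ?thesis using ne[of 0] ne[of "2 * pi"] by eventually_elim auto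
    qed
    note int = this
    have lim1: "AE x in circ. (\<lambda>N. V N x) \<longlonglongrightarrow> indicator {c<..<d} x"
      unfolding V_def using int ne[of c] ne[of d] by eventually_elim (intro fejer_interval_tendsto cd, auto)
    have lim2: "AE x in circ. (\<lambda>N. V' N x) \<longlonglongrightarrow> indicator {c'<..<d'} x"
      unfolding V'_def using int ne[of c'] ne[of d'] by eventually_elim (intro fejer_interval_tendsto cd', auto)
    have "(\<lambda>N. \<integral>z. F z * V N (fst z) * V' N (snd z) \<partial>tor) \<longlonglongrightarrow> (\<integral>z. F z * indicator {c<..<d} (fst z) * indicator {c'<..<d'} (snd z) \<partial>tor)"
    proof (rule integral_dominated_convergence)
      show "integrable tor (\<lambda>z. \<bar>F z\<bar>)" using F by simp
      show "AE z in tor. (\<lambda>N. F z * V N (fst z) * V' N (snd z)) \<longlonglongrightarrow> F z * indicator {c<..<d} (fst z) * indicator {c'<..<d'} (snd z)"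
        using AE_pair_conj[OF sigma_finite_circ lim1 lim2] by eventually_elim (auto intro!: tendsto_intros)
      show "AE z in tor. norm (F z * V N (fst z) * V' N (snd z)) \<le> \<bar>F z\<bar>" for N
        using mult_mono[OF bV bV'] by (auto simp: abs_mult mult.assoc intro!: mult_left_le)
    qed (auto simp: borel_measurable_tor)
    then show ?thesis by (simp add: Z LIMSEQ_const_iff)
  qed
  have in_tor: "AE z in tor. fst z \<in> {0<..<2 * pi} \<and> snd z \<in> {0<..<2 * pi}"
  proof -
    have "AE x in circ. x \<in> {0..2 * pi}"
      unfolding circ_def by (subst AE_density) (auto simp: indicator_def)
    then have "AE x in circ. x \<in> {0<..<2 * pi}"
      using AE_circ[OF AE_lborel_singleton, of 0] AE_circ[OF AE_lborel_singleton, of "2 * pi"] by eventually_elim auto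
    from AE_pair_conj[OF sigma_finite_circ this this] show ?thesis .
  qed
  have box0: "(\<integral>z. F z * indicator (box l u) z \<partial>tor) = 0" for l u
  proof -
    obtain l1 l2 u1 u2 where lu: "l = (l1, l2)" "u = (u1, u2)" by (cases l; cases u)
    have mem: "z \<in> box l u \<longleftrightarrow> l1 < fst z \<and> fst z < u1 \<and> l2 < snd z \<and> snd z < u2" for z
      by (cases z) (auto simp: lu box_def Basis_prod_def)
    \<comment> \<open>The box is clipped to the period, where the Fejer means apply; an empty
      intersection becomes c = d.\<close>
    define c where "c = min (2 * pi) (max 0 l1)"
    define d where "d = max c (min (2 * pi) u1)"
    define c' where "c' = min (2 * pi) (max 0 l2)"
    define d' where "d' = max c' (min (2 * pi) u2)"
    have "(\<integral>z. F z * indicator (box l u) z \<partial>tor) = (\<integral>z. F z * indicator {c<..<d} (fst z) * indicator {c'<..<d'} (snd z) \<partial>tor)"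
    proof (rule integral_cong_AE)
      show "AE z in tor. F z * indicator (box l u) z = F z * indicator {c<..<d} (fst z) * indicator {c'<..<d'} (snd z)"
        using in_tor by eventually_elim (auto simp: mem c_def d_def c'_def d'_def indicator_def max_def min_def)
    qed (auto simp: borel_measurable_tor)
    also have "\<dots> = 0" by (rule rect) (auto simp: c_def d_def c'_def d'_def)
    finally show ?thesis .
  qed
  have fin: "(\<integral>\<^sup>+z. ennreal (F z) \<partial>tor) \<noteq> \<infinity>" "(\<integral>\<^sup>+z. ennreal (- F z) \<partial>tor) \<noteq> \<infinity>"
    using F by (auto simp: real_integrable_def)
  \<comment> \<open>\<open>ennreal\<close> truncates at 0, so the densities are the positive and the
    negative part of \<open>F\<close>.\<close>
  have "density tor (\<lambda>z. ennreal (F z)) = density tor (\<lambda>z. ennreal (- F z))"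
  proof (rule measure_eqI_generator_eq)
    let ?E = "range (\<lambda>(a, b). box a b :: (real \<times> real) set)"
    show "Int_stable ?E" by (auto simp: Int_stable_def box_Int_box)
    show "?E \<subseteq> Pow UNIV" "sets (density tor (\<lambda>z. ennreal (F z))) = sigma_sets UNIV ?E" "sets (density tor (\<lambda>z. ennreal (- F z))) = sigma_sets UNIV ?E"
      by (simp_all add: borel_eq_box sets_tor del: sets_pair_measure_cong)
    let ?A = "\<lambda>n::nat. box (- (real n *\<^sub>R One)) (real n *\<^sub>R One) :: (real \<times> real) set"
    show "range ?A \<subseteq> ?E" "(\<Union>i. ?A i) = UNIV" unfolding UN_box_eq_UNIV by auto
    have em: "emeasure (density tor (\<lambda>z. ennreal (G z))) X = (\<integral>\<^sup>+z. ennreal (G z * indicator X z) \<partial>tor)"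
      if [measurable]: "X \<in> sets borel" "G \<in> borel_measurable borel" for X G
    proof -
      have "X \<in> sets tor" using that(1) by (simp only: sets_tor)
      then have "emeasure (density tor (\<lambda>z. ennreal (G z))) X = (\<integral>\<^sup>+z. ennreal (G z) * indicator X z \<partial>tor)"
        by (intro emeasure_density) (auto simp: borel_measurable_tor)
      also have "\<dots> = (\<integral>\<^sup>+z. ennreal (G z * indicator X z) \<partial>tor)"
        by (intro nn_integral_cong) (auto simp: indicator_def)
      finally show ?thesis .
    qed
    have le: "(\<integral>\<^sup>+z. ennreal (F z * indicator X z) \<partial>tor) \<le> (\<integral>\<^sup>+z. ennreal (F z) \<partial>tor)" for X
      by (intro nn_integral_mono) (auto simp: indicator_def)
    show "emeasure (density tor (\<lambda>z. ennreal (F z))) (?A i) \<noteq> \<infinity>" for i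
      using le[of "?A i"] fin(1) by (subst em) (auto simp: top_unique)
    show "emeasure (density tor (\<lambda>z. ennreal (F z))) X = emeasure (density tor (\<lambda>z. ennreal (- F z))) X" if XE: "X \<in> ?E" for X
    proof -
      obtain q where "X = (case q of (a, b) \<Rightarrow> box a b)" by (rule rangeE[OF XE])
      then have "X = box (fst q) (snd q)" by (simp add: case_prod_beta)
      then obtain l u where X: "X = box l u" ..
      have int: "integrable tor (\<lambda>z. F z * indicator X z)"
        by (rule integrable_tor_mult[OF F, of _ 1]) (auto simp: X indicator_def)
      then have e: "enn2real (\<integral>\<^sup>+z. ennreal (F z * indicator X z) \<partial>tor) - enn2real (\<integral>\<^sup>+z. ennreal (- (F z * indicator X z)) \<partial>tor) = 0"
        using box0[of l u] by (simp add: real_lebesgue_integral_def X)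
      have "(\<integral>\<^sup>+z. ennreal (F z * indicator X z) \<partial>tor) < top" "(\<integral>\<^sup>+z. ennreal (- (F z * indicator X z)) \<partial>tor) < top"
        using int unfolding real_integrable_def infinity_ennreal_def less_top[symmetric] by simp_all
      with e have "(\<integral>\<^sup>+z. ennreal (F z * indicator X z) \<partial>tor) = (\<integral>\<^sup>+z. ennreal (- (F z * indicator X z)) \<partial>tor)"
        by (metis eq_iff_diff_eq_0 ennreal_enn2real)
      then show ?thesis by (subst (1 2) em) (auto simp: X)
    qed
  qed
  then have "AE z in tor. ennreal (F z) = ennreal (- F z)"
    using fin by (subst (asm) finite_density_unique) (auto simp: borel_measurable_tor)
  then show ?thesis
    by eventually_elim (metis ennreal_eq_0_iff ennreal_inj linear neg_0_le_iff_le neg_le_0_iff_le order_antisym_conv)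
qed

section \<open>The estimate from below\<close>

text \<open>The Riemann-Lebesgue lemma for a bounded orthogonal system: Bessel's inequality settles
  bounded functions, and truncation approximates \<open>f\<close> by them in L_1.\<close>

lemma (in finite_measure) integral_orthogonal_tendsto_0:
  fixes e :: "nat \<Rightarrow> 'a \<Rightarrow> real"
  assumes f: "integrable M f" and e [measurable]: "\<And>n. e n \<in> borel_measurable M" and e1: "\<And>n z. \<bar>e n z\<bar> \<le> 1"
    and orth: "\<And>i j. i \<noteq> j \<Longrightarrow> (\<integral>z. e i z * e j z \<partial>M) = 0"
  shows "(\<lambda>n. \<integral>z. f z * e n z \<partial>M) \<longlonglongrightarrow> 0"
proof -
  have fm [measurable]: "f \<in> borel_measurable M" using f by auto
  have int_b: "integrable M g" if [measurable]: "g \<in> borel_measurable M" and "\<And>z. \<bar>g z\<bar> \<le> B" for g :: "'a \<Rightarrow> real" and B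
    using that(2) by (intro integrable_const_bound[where B=B]) auto
  have mult_b: "\<bar>g z * e n z\<bar> \<le> \<bar>g z\<bar>" for g :: "'a \<Rightarrow> real" and n z
    using e1 by (simp add: abs_mult mult_left_le)
  \<comment> \<open>The system is not normalised. K bounds all squared norms, and comparing
    \<open>g\<close> with s / K still yields Bessel's inequality; the summand 1 keeps K
    positive.\<close>
  define K where "K = measure M (space M) + 1"
  have K: "0 < K" by (simp add: K_def add_nonneg_pos)
  have bounded: "(\<lambda>n. \<integral>z. g z * e n z \<partial>M) \<longlonglongrightarrow> 0"
    if gm [measurable]: "g \<in> borel_measurable M" and gB: "\<And>z. \<bar>g z\<bar> \<le> B" for g B
  proof -
    define b where "b n = (\<integral>z. g z * e n z \<partial>M)" for n
    have i1: "integrable M (\<lambda>z. g z * e n z)" for n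
      by (rule int_b[of _ B]) (use order.trans[OF mult_b gB] in auto)
    have i2: "integrable M (\<lambda>z. e i z * e j z)" for i j
      by (rule int_b[of _ 1]) (use order.trans[OF mult_b e1] in auto)
    have i3: "integrable M (\<lambda>z. g z * g z)"
    proof (rule int_b)
      show "\<bar>g z * g z\<bar> \<le> B * B" for z
        unfolding abs_mult using gB order.trans[OF abs_ge_zero gB] by (intro mult_mono) auto
    qed simp
    have "(\<Sum>i<n. b i * b i) \<le> K * (\<integral>z. g z * g z \<partial>M)" for n
    proof -
      define s where "s z = (\<Sum>i<n. b i * e i z)" for z
      have "0 \<le> (\<integral>z. (g z - s z / K) * (g z - s z / K) \<partial>M)" by simp
      also have "\<dots> = (\<integral>z. g z * g z - 2 / K * (\<Sum>i<n. b i * (g z * e i z)) + 1 / (K * K) * (\<Sum>i<n. \<Sum>j<n. b i * b j * (e i z * e j z)) \<partial>M)"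
      proof (rule Bochner_Integration.integral_cong[OF refl])
        fix z
        have "s z * s z = (\<Sum>i<n. \<Sum>j<n. b i * b j * (e i z * e j z))"
          by (simp add: s_def sum_product mult_ac)
        moreover have "g z * s z = (\<Sum>i<n. b i * (g z * e i z))" by (simp add: s_def sum_distrib_left mult_ac)
        moreover have "(g z - s z / K) * (g z - s z / K) = g z * g z - 2 / K * (g z * s z) + 1 / (K * K) * (s z * s z)"
          using K by (simp add: field_simps)
        ultimately show "(g z - s z / K) * (g z - s z / K) = g z * g z - 2 / K * (\<Sum>i<n. b i * (g z * e i z)) + 1 / (K * K) * (\<Sum>i<n. \<Sum>j<n. b i * b j * (e i z * e j z))"
          by simp
      qed
      also have "\<dots> = (\<integral>z. g z * g z \<partial>M) - 2 / K * (\<Sum>i<n. b i * b i) + 1 / (K * K) * (\<Sum>i<n. \<Sum>j<n. b i * b j * (\<integral>z. e i z * e j z \<partial>M))"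
        by (simp add: i1 i2 i3 b_def)
      also have "(\<Sum>i<n. \<Sum>j<n. b i * b j * (\<integral>z. e i z * e j z \<partial>M)) = (\<Sum>i<n. \<Sum>j<n. if i = j then b i * b i * (\<integral>z. e i z * e i z \<partial>M) else 0)"
        by (intro sum.cong refl) (simp add: orth)
      also have "\<dots> = (\<Sum>i<n. b i * b i * (\<integral>z. e i z * e i z \<partial>M))" by simp
      also have "\<dots> \<le> (\<Sum>i<n. b i * b i * K)"
      proof (intro sum_mono mult_left_mono)
        fix i
        have "(\<integral>z. e i z * e i z \<partial>M) \<le> (\<integral>z. 1 \<partial>M)"
          using order.trans[OF abs_ge_self order.trans[OF mult_b e1]] by (intro integral_mono i2) auto
        then show "(\<integral>z. e i z * e i z \<partial>M) \<le> K" by (simp add: K_def)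
      qed auto
      finally have "0 \<le> (\<integral>z. g z * g z \<partial>M) - 2 / K * (\<Sum>i<n. b i * b i) + 1 / (K * K) * ((\<Sum>i<n. b i * b i) * K)"
        using K by (simp add: sum_distrib_right divide_right_mono)
      then show ?thesis using K by (simp add: field_simps)
    qed
    then have "summable (\<lambda>i. b i * b i)" by (intro summableI_nonneg_bounded) auto
    then have "(\<lambda>i. b i * b i) \<longlonglongrightarrow> 0" by (rule summable_LIMSEQ_zero)
    then have "(\<lambda>i. (b i)\<^sup>2) \<longlonglongrightarrow> 0" by (simp add: power2_eq_square)
    from tendsto_real_sqrt[OF this] show ?thesis
      unfolding b_def[symmetric] by (simp add: tendsto_rabs_zero_iff)
  qed
  show ?thesis
  proof (rule LIMSEQ_I)
    fix r :: real assume r: "0 < r"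
    define g where "g R z = max (- real R) (min (real R) (f z))" for R z
    have [measurable]: "g R \<in> borel_measurable M" for R unfolding g_def by measurable
    have "(\<lambda>R. \<integral>z. \<bar>f z - g R z\<bar> \<partial>M) \<longlonglongrightarrow> (\<integral>z. 0 \<partial>M)"
    proof (rule integral_dominated_convergence)
      show "integrable M (\<lambda>z. \<bar>f z\<bar>)" using f by simp
      show "AE z in M. norm \<bar>f z - g R z\<bar> \<le> \<bar>f z\<bar>" for R by (auto simp: g_def max_def min_def)
      show "AE z in M. (\<lambda>R. \<bar>f z - g R z\<bar>) \<longlonglongrightarrow> 0"
      proof (rule AE_I2)
        fix z
        have "\<forall>\<^sub>F R in sequentially. \<bar>f z - g R z\<bar> = 0"
          using eventually_ge_at_top[of "nat \<lceil>\<bar>f z\<bar>\<rceil>"]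
        proof eventually_elim
          case (elim R)
          then have "\<bar>f z\<bar> \<le> real R" by linarith
          then show ?case by (auto simp: g_def max_def min_def)
        qed
        then show "(\<lambda>R. \<bar>f z - g R z\<bar>) \<longlonglongrightarrow> 0" by (rule tendsto_eventually)
      qed
    qed auto
    then have L: "(\<lambda>R. \<integral>z. \<bar>f z - g R z\<bar> \<partial>M) \<longlonglongrightarrow> 0" by simp
    have "0 < r / 2" using r by simp
    from LIMSEQ_D[OF L this] obtain R where R: "norm ((\<integral>z. \<bar>f z - g R z\<bar> \<partial>M) - 0) < r / 2"
      by blast
    have gb: "\<bar>g R z\<bar> \<le> real R" for z by (auto simp: g_def max_def min_def)
    obtain N where N: "\<And>n. n \<ge> N \<Longrightarrow> norm ((\<integral>z. g R z * e n z \<partial>M) - 0) < r / 2"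
      using LIMSEQ_D[OF bounded[of "g R", OF _ gb] \<open>0 < r / 2\<close>] by auto
    have ig: "integrable M (g R)" by (rule int_b[OF _ gb]) simp
    have "norm ((\<integral>z. f z * e n z \<partial>M) - 0) < r" if "n \<ge> N" for n
    proof -
      have ie: "integrable M (\<lambda>z. h z * e n z)" if "integrable M h" for h
        by (rule Bochner_Integration.integrable_bound[OF that]) (use mult_b that in auto)
      have "(\<integral>z. f z * e n z \<partial>M) = (\<integral>z. (f z - g R z) * e n z \<partial>M) + (\<integral>z. g R z * e n z \<partial>M)"
      proof -
        have "integrable M (\<lambda>z. f z - g R z)" using f ig by simp
        then have "(\<integral>z. (f z - g R z) * e n z \<partial>M) + (\<integral>z. g R z * e n z \<partial>M) = (\<integral>z. (f z - g R z) * e n z + g R z * e n z \<partial>M)"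
          by (intro Bochner_Integration.integral_add[symmetric] ie ig)
        then show ?thesis by (simp add: algebra_simps)
      qed
      moreover have "\<bar>\<integral>z. (f z - g R z) * e n z \<partial>M\<bar> \<le> (\<integral>z. \<bar>f z - g R z\<bar> \<partial>M)"
        using mult_b[of "\<lambda>z. f z - g R z" _ n] ie[of "\<lambda>z. f z - g R z"] f ig
        by (intro order.trans[OF integral_abs_bound] integral_mono) auto
      ultimately show ?thesis using R N[OF that] by simp
    qed
    then show "\<exists>no. \<forall>n\<ge>no. norm ((\<integral>z. f z * e n z \<partial>M) - 0) < r" by blast
  qed
qed

section \<open>Orthogonality of the cosines; decay and monotonicity of the coefficients\<close>

lemma integral_circ_cos:
  assumes "1 \<le> k" shows "(\<integral>x. cos (real k * x + \<theta>) \<partial>circ) = 0"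
proof -
  have "circ = density lborel (\<lambda>x. ennreal (indicator {0..2 * pi} x))"
  proof -
    have "(indicator {0..2 * pi} :: real \<Rightarrow> ennreal) = (\<lambda>x. ennreal (indicator {0..2 * pi} x))"
      by (auto simp: fun_eq_iff indicator_def)
    then show ?thesis by (simp only: circ_def)
  qed
  note eq = this
  have "(\<integral>x. cos (real k * x + \<theta>) \<partial>circ) = (LINT x:{0..2 * pi}|lborel. cos (real k * x + \<theta>))"
    unfolding eq set_lebesgue_integral_def by (rule integral_density) auto
  also have "\<dots> = integral {0..2 * pi} (\<lambda>x. cos (real k * x + \<theta>))"
    unfolding set_integrable_def
    by (intro set_borel_integral_eq_integral(2) borel_integrable_atLeastAtMost' continuous_intros)
  finally show ?thesis using integral_trig_period[OF assms] by simp
qed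

lemma emeasure_circ: "emeasure circ UNIV = ennreal (2 * pi)"
  by (simp add: circ_def emeasure_density)

interpretation finite_circ: finite_measure circ
  by standard (simp add: emeasure_circ)

lemma integrable_circ_bounded:
  assumes "u \<in> borel_measurable borel" "\<And>x. \<bar>u x\<bar> \<le> B" shows "integrable circ (u :: real \<Rightarrow> real)"
  using assms by (intro finite_circ.integrable_const_bound[where B = B]) auto

lemma integral_circ_cos_cos:
  assumes "1 \<le> k \<or> 1 \<le> j"
  shows "(\<integral>x. cos (real k * x) * cos (real j * x + b) \<partial>circ) = (if k = j then pi * cos b else 0)"
proof -
  have i: "integrable circ (\<lambda>x. cos (real i * x + c))" for i c
    by (rule integrable_circ_bounded[of _ 1]) auto
  have 0: "(\<integral>x. cos (real k * x - (real j * x + b)) \<partial>circ) = (if k = j then 2 * pi * cos b else 0)"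
    and i0: "integrable circ (\<lambda>x. cos (real k * x - (real j * x + b)))"
  proof -
    show "integrable circ (\<lambda>x. cos (real k * x - (real j * x + b)))"
      by (rule integrable_circ_bounded[of _ 1]) auto
    consider "k = j" | "k < j" | "j < k" by linarith
    then show "(\<integral>x. cos (real k * x - (real j * x + b)) \<partial>circ) = (if k = j then 2 * pi * cos b else 0)"
    proof cases
      case 1
      have "measure circ UNIV = 2 * pi" by (simp add: measure_def emeasure_circ)
      with 1 show ?thesis by simp
    next
      case 2
      have "cos (real k * x - (real j * x + b)) = cos (real (j - k) * x + b)" for x
        using 2 by (subst cos_minus[symmetric]) (simp add: of_nat_diff algebra_simps)
      then show ?thesis using 2 integral_circ_cos[of "j - k" b] by simp
    next
      case 3
      have "cos (real k * x - (real j * x + b)) = cos (real (k - j) * x + - b)" for x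
        using 3 by (simp add: of_nat_diff algebra_simps)
      then show ?thesis using 3 integral_circ_cos[of "k - j" "- b"] by simp
    qed
  qed
  have "(\<integral>x. cos (real k * x) * cos (real j * x + b) \<partial>circ)
    = (\<integral>x. (1 / 2) * cos (real k * x - (real j * x + b)) + (1 / 2) * cos (real (k + j) * x + b) \<partial>circ)"
    by (intro Bochner_Integration.integral_cong refl) (simp add: cos_times_cos algebra_simps)
  also have "\<dots> = (1 / 2) * (\<integral>x. cos (real k * x - (real j * x + b)) \<partial>circ) + (1 / 2) * (\<integral>x. cos (real (k + j) * x + b) \<partial>circ)"
    using i[of "k + j" b] i0 by simp
  also have "\<dots> = (if k = j then pi * cos b else 0)"
    using assms by (subst integral_circ_cos) (auto simp: 0)
  finally show ?thesis .
qed

lemma integral_tor_mult: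
  fixes u v :: "real \<Rightarrow> real"
  assumes [measurable]: "u \<in> borel_measurable borel" "v \<in> borel_measurable borel" and b: "\<And>x. \<bar>u x\<bar> \<le> A" "\<And>x. \<bar>v x\<bar> \<le> B"
  shows "integrable tor (\<lambda>z. u (fst z) * v (snd z))"
    and "(\<integral>z. u (fst z) * v (snd z) \<partial>tor) = (\<integral>x. u x \<partial>circ) * (\<integral>y. v y \<partial>circ)"
proof -
  have "\<bar>u x * v y\<bar> \<le> A * B" for x y
    using b order.trans[OF abs_ge_zero b(1)] by (simp add: abs_mult mult_mono)
  then show int: "integrable tor (\<lambda>z. u (fst z) * v (snd z))"
    by (intro finite_tor.integrable_const_bound[where B = "A * B"]) auto
  show "(\<integral>z. u (fst z) * v (snd z) \<partial>tor) = (\<integral>x. u x \<partial>circ) * (\<integral>y. v y \<partial>circ)"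
    using tor.integral_fst'[OF int] by simp
qed

lemma abs_mult_cos_le_1: "\<bar>cos x * cos y\<bar> \<le> (1 :: real)"
  using mult_mono[of "\<bar>cos x\<bar>" 1 "\<bar>cos y\<bar>" 1] by (simp add: abs_mult)

text \<open>With one frequency fixed, the products of cosines are still a bounded orthogonal system,
  so the Riemann-Lebesgue lemma applies to every row and column.\<close>

lemma cosine_coeffs_tendsto_0:
  assumes f: "integrable tor f" and a: "cosine_coeffs f a" and i: "1 \<le> i"
  shows "(\<lambda>j. a i j) \<longlonglongrightarrow> 0" and "(\<lambda>j. a j i) \<longlonglongrightarrow> 0"
proof -
  have prod: "(\<integral>z. cos (real i * fst z) * cos (real i' * fst z) * (cos (real j * snd z) * cos (real j' * snd z)) \<partial>tor)
      = (\<integral>x. cos (real i * x) * cos (real i' * x) \<partial>circ) * (\<integral>y. cos (real j * y) * cos (real j' * y) \<partial>circ)" for i i' j j'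
    by (rule integral_tor_mult(2)[where A = 1 and B = 1]) (auto intro: abs_mult_cos_le_1)
  have prod1: "(\<integral>z. cos (real i * fst z) * cos (real j * snd z) * (cos (real i * fst z) * cos (real l * snd z)) \<partial>tor)
      = (\<integral>x. cos (real i * x) * cos (real i * x) \<partial>circ) * (\<integral>y. cos (real j * y) * cos (real l * y) \<partial>circ)" for j l
    unfolding prod[symmetric] by (intro Bochner_Integration.integral_cong refl) (simp only: mult_ac)
  have prod2: "(\<integral>z. cos (real j * fst z) * cos (real i * snd z) * (cos (real l * fst z) * cos (real i * snd z)) \<partial>tor)
      = (\<integral>y. cos (real j * y) * cos (real l * y) \<partial>circ) * (\<integral>x. cos (real i * x) * cos (real i * x) \<partial>circ)" for j l
    unfolding prod[symmetric] by (intro Bochner_Integration.integral_cong refl) (simp only: mult_ac)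
  have "(\<lambda>j. \<integral>z. f z * (cos (real i * fst z) * cos (real j * snd z)) \<partial>tor) \<longlonglongrightarrow> 0"
  proof (rule finite_tor.integral_orthogonal_tendsto_0[OF f])
    fix j l :: nat assume "j \<noteq> l"
    then have "(\<integral>y. cos (real j * y) * cos (real l * y) \<partial>circ) = 0"
      using integral_circ_cos_cos[of j l 0] by (cases "j = 0") auto
    then show "(\<integral>z. cos (real i * fst z) * cos (real j * snd z) * (cos (real i * fst z) * cos (real l * snd z)) \<partial>tor) = 0"
      by (simp only: prod1 mult_zero_right)
  qed (auto intro: abs_mult_cos_le_1)
  moreover have "\<forall>\<^sub>F j in sequentially. (\<integral>z. f z * (cos (real i * fst z) * cos (real j * snd z)) \<partial>tor) = pi\<^sup>2 * a i j"
    using eventually_ge_at_top[of 1] by eventually_elim (use a i in \<open>simp add: cosine_coeffs_def mult.assoc\<close>)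
  ultimately have "(\<lambda>j. pi\<^sup>2 * a i j) \<longlonglongrightarrow> 0" by (rule Lim_transform_eventually)
  from tendsto_mult_left[OF this, of "1 / pi\<^sup>2"] show "(\<lambda>j. a i j) \<longlonglongrightarrow> 0" by simp
  have "(\<lambda>j. \<integral>z. f z * (cos (real j * fst z) * cos (real i * snd z)) \<partial>tor) \<longlonglongrightarrow> 0"
  proof (rule finite_tor.integral_orthogonal_tendsto_0[OF f])
    fix j l :: nat assume "j \<noteq> l"
    then have "(\<integral>y. cos (real j * y) * cos (real l * y) \<partial>circ) = 0"
      using integral_circ_cos_cos[of j l 0] by (cases "j = 0") auto
    then show "(\<integral>z. cos (real j * fst z) * cos (real i * snd z) * (cos (real l * fst z) * cos (real i * snd z)) \<partial>tor) = 0"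
      by (simp only: prod2 mult_zero_left)
  qed (auto intro: abs_mult_cos_le_1)
  moreover have "\<forall>\<^sub>F j in sequentially. (\<integral>z. f z * (cos (real j * fst z) * cos (real i * snd z)) \<partial>tor) = pi\<^sup>2 * a j i"
    using eventually_ge_at_top[of 1] by eventually_elim (use a i in \<open>simp add: cosine_coeffs_def mult.assoc\<close>)
  ultimately have "(\<lambda>j. pi\<^sup>2 * a j i) \<longlonglongrightarrow> 0" by (rule Lim_transform_eventually)
  from tendsto_mult_left[OF this, of "1 / pi\<^sup>2"] show "(\<lambda>j. a j i) \<longlonglongrightarrow> 0" by simp
qed

lemma nonneg_of_decreasing_null:
  fixes d :: "nat \<Rightarrow> real"
  assumes "\<And>l. 1 \<le> l \<Longrightarrow> d (Suc l) \<le> d l" "d \<longlonglongrightarrow> 0" "1 \<le> l" shows "0 \<le> d l"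
proof -
  have "decseq (\<lambda>n. d (n + l))" using assms by (intro decseq_SucI) auto
  moreover have "(\<lambda>n. d (n + l)) \<longlonglongrightarrow> 0" using assms by (intro LIMSEQ_ignore_initial_segment)
  ultimately have "0 \<le> d (0 + l)" by (rule decseq_ge)
  then show ?thesis by simp
qed

text \<open>For fixed k the difference a k l - a (k + 1) l decreases in l and tends to 0, hence is
  nonnegative. The same argument works in the other variable and then for the coefficients
  themselves.\<close>

lemma cosine_coeffs_monotone:
  assumes f: "integrable tor f" and a: "cosine_coeffs f a"
    and m: "\<And>k l. 1 \<le> k \<Longrightarrow> 1 \<le> l \<Longrightarrow> 0 \<le> mixed_diff a k l" and kl: "1 \<le> k" "1 \<le> l"
  shows "a (Suc k) l \<le> a k l" "a k (Suc l) \<le> a k l" "0 \<le> a k l"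
proof -
  have 1: "a (Suc k) l \<le> a k l" if "1 \<le> k" "1 \<le> l" for k l
  proof -
    have "0 \<le> a k l - a (Suc k) l"
    proof (rule nonneg_of_decreasing_null[of "\<lambda>l. a k l - a (Suc k) l"])
      show "(\<lambda>l. a k l - a (Suc k) l) \<longlonglongrightarrow> 0"
        using cosine_coeffs_tendsto_0(1)[OF f a] that by (auto intro!: tendsto_eq_intros)
      show "a k (Suc l) - a (Suc k) (Suc l) \<le> a k l - a (Suc k) l" if "1 \<le> l" for l
        using m[OF \<open>1 \<le> k\<close> that] by (simp add: mixed_diff_def)
    qed fact
    then show ?thesis by simp
  qed
  show "a (Suc k) l \<le> a k l" by (rule 1[OF kl])
  have "0 \<le> a k l - a k (Suc l)"
  proof (rule nonneg_of_decreasing_null[of "\<lambda>k. a k l - a k (Suc l)"])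
    show "(\<lambda>k. a k l - a k (Suc l)) \<longlonglongrightarrow> 0"
      using cosine_coeffs_tendsto_0(2)[OF f a] kl by (auto intro!: tendsto_eq_intros)
    show "a (Suc k) l - a (Suc k) (Suc l) \<le> a k l - a k (Suc l)" if "1 \<le> k" for k
      using m[OF that kl(2)] by (simp add: mixed_diff_def)
  qed fact
  then show "a k (Suc l) \<le> a k l" by simp
  show "0 \<le> a k l"
    by (rule nonneg_of_decreasing_null[of "\<lambda>k. a k l"]) (use 1 kl cosine_coeffs_tendsto_0(2)[OF f a] in auto)
qed

lemma cosine_coeffs_antimono:
  assumes f: "integrable tor f" and a: "cosine_coeffs f a"
    and m: "\<And>k l. 1 \<le> k \<Longrightarrow> 1 \<le> l \<Longrightarrow> 0 \<le> mixed_diff a k l" and ij: "1 \<le> i" "i \<le> k" "1 \<le> j" "j \<le> l"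
  shows "a k l \<le> a i j"
proof -
  have "a k l \<le> a i l"
    using ij(2) by (induction k rule: dec_induct)
      (use cosine_coeffs_monotone(1)[OF f a m] ij in \<open>auto intro: order.trans\<close>)
  also have "a i l \<le> a i j"
    using ij(4) by (induction l rule: dec_induct)
      (use cosine_coeffs_monotone(2)[OF f a m] ij in \<open>auto intro: order.trans\<close>)
  finally show ?thesis .
qed


text \<open>The weight 1 / k^2 of \<open>wnat\<close> turns (k a) powr p into a powr p times k powr
  (p - 2). So this is the sum S of the overview, written as an integral over the measure for which
  the Schur test holds.\<close>

definition coeff_sum :: "real \<Rightarrow> real \<Rightarrow> real \<Rightarrow> (nat \<Rightarrow> nat \<Rightarrow> real) \<Rightarrow> nat \<Rightarrow> nat \<Rightarrow> ennreal" where
  "coeff_sum p \<alpha>1 \<alpha>2 a n1 n2 = (\<integral>\<^sup>+k. ennreal_powr (ennreal (real (fst k) * real (snd k) * a (fst k) (snd k)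
      * (damp \<alpha>1 n1 (fst k) * damp \<alpha>2 n2 (snd k)))) p \<partial>(wnat \<Otimes>\<^sub>M wnat))"

interpretation wnat: sigma_finite_measure wnat by (rule sigma_finite_wnat)
interpretation wnat2: pair_sigma_finite wnat wnat ..

lemma count_space_nat_prod: "count_space (UNIV :: nat set) \<Otimes>\<^sub>M count_space (UNIV :: nat set) = count_space UNIV"
  by (subst pair_measure_countable) auto

lemma sets_wnat2 [measurable_cong]: "sets (wnat \<Otimes>\<^sub>M wnat) = sets (count_space UNIV)"
proof -
  have "sets (wnat \<Otimes>\<^sub>M wnat) = sets (count_space (UNIV :: nat set) \<Otimes>\<^sub>M count_space (UNIV :: nat set))"
    by (rule sets_pair_measure_cong) simp_all
  then show ?thesis by (simp only: count_space_nat_prod)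
qed

lemma measurable_wnat2 [measurable, simp]: "f \<in> borel_measurable (wnat \<Otimes>\<^sub>M wnat)"
  by (subst measurable_cong_sets[OF sets_wnat2 refl]) simp

lemma AE_wnat2: "AE k in wnat \<Otimes>\<^sub>M wnat. 0 < fst k \<and> 0 < snd k"
  by (rule AE_pair_conj[OF sigma_finite_wnat AE_wnat AE_wnat])

lemma nn_integral_count_space_mult:
  fixes f g :: "nat \<Rightarrow> ennreal"
  shows "(\<integral>\<^sup>+\<iota>. f (fst \<iota>) * g (snd \<iota>) \<partial>count_space UNIV) = (\<integral>\<^sup>+\<nu>. f \<nu> \<partial>count_space UNIV) * (\<integral>\<^sup>+\<mu>. g \<mu> \<partial>count_space UNIV)"
  unfolding count_space_nat_prod[symmetric]
  by (rule nn_integral_pair_mult[OF sigma_finite_measure_count_space_countable]) auto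

lemma ennreal_peak_sum:
  assumes "0 < \<alpha>" "0 < k"
  shows "ennreal (peak_sum \<alpha> h k x) = (\<integral>\<^sup>+\<nu>. ennreal (shift_weight \<alpha> \<nu>) * ennreal (peak k (x + shift_pos \<alpha> h \<nu>)) \<partial>count_space UNIV)"
  unfolding peak_sum_def nn_integral_count_space_nat
  by (subst suminf_ennreal2[symmetric]) (use summable_peak_sum[OF assms] in \<open>auto simp: ennreal_mult\<close>)

text \<open>The series for the two variables are merged into one over pairs of indices, so that the
  averaging inequality is applied only once.\<close>

definition pair_weight :: "real \<Rightarrow> real \<Rightarrow> nat \<times> nat \<Rightarrow> ennreal" where
  "pair_weight \<alpha>1 \<alpha>2 \<iota> = ennreal (shift_weight \<alpha>1 (fst \<iota>)) * ennreal (shift_weight \<alpha>2 (snd \<iota>))"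

definition pair_peak :: "real \<Rightarrow> real \<Rightarrow> real \<Rightarrow> real \<Rightarrow> nat \<times> nat \<Rightarrow> nat \<times> nat \<Rightarrow> real \<times> real \<Rightarrow> ennreal" where
  "pair_peak \<alpha>1 \<alpha>2 h1 h2 \<iota> k z = ennreal (peak (fst k) (fst z + shift_pos \<alpha>1 h1 (fst \<iota>))) * ennreal (peak (snd k) (snd z + shift_pos \<alpha>2 h2 (snd \<iota>)))"

lemma pair_weight_total:
  assumes "0 < \<alpha>1" "0 < \<alpha>2"
  shows "(\<integral>\<^sup>+\<iota>. pair_weight \<alpha>1 \<alpha>2 \<iota> \<partial>count_space UNIV) = ennreal ((\<Sum>\<nu>. shift_weight \<alpha>1 \<nu>) * (\<Sum>\<nu>. shift_weight \<alpha>2 \<nu>))"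
proof -
  have "(\<integral>\<^sup>+\<nu>. ennreal (shift_weight \<alpha> \<nu>) \<partial>count_space UNIV) = ennreal (\<Sum>\<nu>. shift_weight \<alpha> \<nu>)" if "0 < \<alpha>" for \<alpha>
    unfolding nn_integral_count_space_nat by (rule suminf_ennreal2) (use summable_shift_weight[OF that] in auto)
  then show ?thesis
    unfolding pair_weight_def
    using assms nn_integral_count_space_mult[of "\<lambda>\<nu>. ennreal (shift_weight \<alpha>1 \<nu>)" "\<lambda>\<nu>. ennreal (shift_weight \<alpha>2 \<nu>)"]
    by (simp add: ennreal_mult suminf_nonneg summable_shift_weight)
qed

lemma ennreal_peak_sum_mult:
  assumes "0 < \<alpha>1" "0 < \<alpha>2" "0 < fst k" "0 < snd k"
  shows "ennreal (peak_sum \<alpha>1 h1 (fst k) (fst z)) * ennreal (peak_sum \<alpha>2 h2 (snd k) (snd z))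
    = (\<integral>\<^sup>+\<iota>. pair_weight \<alpha>1 \<alpha>2 \<iota> * pair_peak \<alpha>1 \<alpha>2 h1 h2 \<iota> k z \<partial>count_space UNIV)"
  unfolding ennreal_peak_sum[OF assms(1,3)] ennreal_peak_sum[OF assms(2,4)]
  unfolding nn_integral_count_space_mult[symmetric]
  by (intro nn_integral_cong) (simp add: pair_weight_def pair_peak_def mult_ac)

lemma measurable_pair_peak [measurable]: "pair_peak \<alpha>1 \<alpha>2 h1 h2 \<iota> k \<in> borel_measurable borel"
  unfolding pair_peak_def by measurable

lemma peak_sum_nonneg [simp]: "0 < \<alpha> \<Longrightarrow> 0 < k \<Longrightarrow> 0 \<le> peak_sum \<alpha> h k x"
  unfolding peak_sum_def by (intro suminf_nonneg summable_peak_sum) auto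

text \<open>Testing the difference against the trigonometric polynomials of \<open>lower_polynomial\<close> bounds single
  coefficients; monotonicity of the coefficients makes this sufficient.\<close>

lemma coeff_le_difference:
  assumes \<alpha>: "0 < \<alpha>1" "0 < \<alpha>2"
  obtains C where "0 < C" and "\<And>f a n1 n2 k. \<lbrakk>f \<in> borel_measurable borel; periodic2 f; integrable tor f; cosine_coeffs f a;
     \<And>k l. 1 \<le> k \<Longrightarrow> 1 \<le> l \<Longrightarrow> 0 \<le> mixed_diff a k l; 0 < n1; 0 < n2; 0 < fst k; 0 < snd k\<rbrakk> \<Longrightarrow>
     ennreal (real (fst k) * real (snd k) * a (fst k) (snd k) * (damp \<alpha>1 n1 (fst k) * damp \<alpha>2 n2 (snd k)))
     \<le> ennreal C * (\<integral>\<^sup>+z. ennreal \<bar>frac_diff1 \<alpha>1 (1 / (4 * real n1)) (frac_diff2 \<alpha>2 (1 / (4 * real n2)) f) z\<bar>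
         * (ennreal (peak_sum \<alpha>1 (1 / (4 * real n1)) (fst k) (fst z)) * ennreal (peak_sum \<alpha>2 (1 / (4 * real n2)) (snd k) (snd z))) \<partial>tor)"
proof -
  obtain C1 where C1: "0 < C1" and low1: "\<And>n m. 0 < n \<Longrightarrow> 0 < m \<Longrightarrow> \<exists>v \<theta>.
    (\<forall>x. \<bar>\<Sum>j=1..m. v j * cos (real j * x + \<theta> j)\<bar> \<le> peak_sum \<alpha>1 (1 / (4 * real n)) m x) \<and> (\<forall>j. 0 \<le> v j) \<and>
    (\<forall>j\<in>{1..m}. 0 \<le> phase_mult \<alpha>1 (1 / (4 * real n)) j (\<theta> j)) \<and>
    real m * damp \<alpha>1 n m \<le> C1 * (\<Sum>j=1..m. v j * phase_mult \<alpha>1 (1 / (4 * real n)) j (\<theta> j))"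
  proof -
    show ?thesis by (rule lower_polynomial[OF \<alpha>(1), folded phase_mult_def], fact that)
  qed
  obtain C2 where C2: "0 < C2" and low2: "\<And>n m. 0 < n \<Longrightarrow> 0 < m \<Longrightarrow> \<exists>v \<theta>.
    (\<forall>x. \<bar>\<Sum>j=1..m. v j * cos (real j * x + \<theta> j)\<bar> \<le> peak_sum \<alpha>2 (1 / (4 * real n)) m x) \<and> (\<forall>j. 0 \<le> v j) \<and>
    (\<forall>j\<in>{1..m}. 0 \<le> phase_mult \<alpha>2 (1 / (4 * real n)) j (\<theta> j)) \<and>
    real m * damp \<alpha>2 n m \<le> C2 * (\<Sum>j=1..m. v j * phase_mult \<alpha>2 (1 / (4 * real n)) j (\<theta> j))"
  proof -
    show ?thesis by (rule lower_polynomial[OF \<alpha>(2), folded phase_mult_def], fact that)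
  qed
  show thesis
  proof (rule that[of "C1 * C2 / pi\<^sup>2"], goal_cases)
    case 1
    then show ?case using C1 C2 by simp
  next
    case (2 f a n1 n2 k)
    note f [measurable] = 2(1) and per = 2(2) and int = 2(3) and a = 2(4) and md = 2(5) and n = 2(6,7)
    obtain m m' where k: "k = (m, m')" by (cases k)
    have m: "0 < m" "0 < m'" using 2 by (auto simp: k)
    define h1 where "h1 = 1 / (4 * real n1)"
    define h2 where "h2 = 1 / (4 * real n2)"
    define G where "G = frac_diff1 \<alpha>1 h1 (frac_diff2 \<alpha>2 h2 f)"
    have Gm [measurable]: "G \<in> borel_measurable borel" and G_int: "integrable tor G"
      unfolding G_def frac_diff1_eq frac_diff2_eq
      using \<alpha> f per int by (auto intro!: shift_series_integrable periodic2_shift_series)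
    obtain v \<theta> where v: "\<And>x. \<bar>\<Sum>j=1..m. v j * cos (real j * x + \<theta> j)\<bar> \<le> peak_sum \<alpha>1 h1 m x" "\<And>j. 0 \<le> v j"
      "\<And>j. j \<in> {1..m} \<Longrightarrow> 0 \<le> phase_mult \<alpha>1 h1 j (\<theta> j)"
      "real m * damp \<alpha>1 n1 m \<le> C1 * (\<Sum>j=1..m. v j * phase_mult \<alpha>1 h1 j (\<theta> j))"
      using low1[OF n(1) m(1)] unfolding h1_def by blast
    obtain v' \<theta>' where v': "\<And>x. \<bar>\<Sum>j=1..m'. v' j * cos (real j * x + \<theta>' j)\<bar> \<le> peak_sum \<alpha>2 h2 m' x" "\<And>j. 0 \<le> v' j"
      "\<And>j. j \<in> {1..m'} \<Longrightarrow> 0 \<le> phase_mult \<alpha>2 h2 j (\<theta>' j)"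
      "real m' * damp \<alpha>2 n2 m' \<le> C2 * (\<Sum>j=1..m'. v' j * phase_mult \<alpha>2 h2 j (\<theta>' j))"
      using low2[OF n(2) m(2)] unfolding h2_def by blast
    define V where "V x = (\<Sum>j=1..m. v j * cos (real j * x + \<theta> j))" for x
    define V' where "V' x = (\<Sum>j=1..m'. v' j * cos (real j * x + \<theta>' j))" for x
    have ii: "integrable tor (\<lambda>z. G z * (cos (real i * fst z + c) * cos (real j * snd z + d)))" for i j c d
      by (rule integrable_tor_mult[OF G_int _ abs_mult_cos_le_1]) simp
    have exp: "G z * (V (fst z) * V' (snd z)) = (\<Sum>i=1..m. \<Sum>j=1..m'. v i * v' j * (G z * (cos (real i * fst z + \<theta> i) * cos (real j * snd z + \<theta>' j))))" for z
      by (simp only: V_def V'_def sum_product) (simp add: sum_distrib_left mult_ac)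
    have intV: "integrable tor (\<lambda>z. G z * (V (fst z) * V' (snd z)))" unfolding exp by (simp add: ii)
    have "(\<integral>z. G z * (V (fst z) * V' (snd z)) \<partial>tor)
      = (\<Sum>i=1..m. \<Sum>j=1..m'. v i * v' j * (pi\<^sup>2 * a i j * phase_mult \<alpha>1 h1 i (\<theta> i) * phase_mult \<alpha>2 h2 j (\<theta>' j)))"
      unfolding exp by (auto simp: ii frac_diff_cos_integral[OF \<alpha> f per int a, where ?h1.0 = h1 and ?h2.0 = h2, folded G_def] intro!: sum.cong)
    \<comment> \<open>Here monotonicity enters: all other factors are nonnegative by the choice of
      phases, so every coefficient up to (m, m') may be replaced by the smallest one.\<close>
    also have "\<dots> \<ge> (\<Sum>i=1..m. \<Sum>j=1..m'. v i * v' j * (pi\<^sup>2 * a m m' * phase_mult \<alpha>1 h1 i (\<theta> i) * phase_mult \<alpha>2 h2 j (\<theta>' j)))"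
      using cosine_coeffs_antimono[OF int a md] v v'
      by (intro sum_mono mult_left_mono mult_right_mono mult_nonneg_nonneg) auto
    also (xtrans) have "(\<Sum>i=1..m. \<Sum>j=1..m'. v i * v' j * (pi\<^sup>2 * a m m' * phase_mult \<alpha>1 h1 i (\<theta> i) * phase_mult \<alpha>2 h2 j (\<theta>' j)))
      = pi\<^sup>2 * a m m' * ((\<Sum>i=1..m. v i * phase_mult \<alpha>1 h1 i (\<theta> i)) * (\<Sum>j=1..m'. v' j * phase_mult \<alpha>2 h2 j (\<theta>' j)))"
      by (simp only: sum_product) (simp add: sum_distrib_left mult_ac)
    finally have low: "pi\<^sup>2 * a m m' * ((\<Sum>i=1..m. v i * phase_mult \<alpha>1 h1 i (\<theta> i)) * (\<Sum>j=1..m'. v' j * phase_mult \<alpha>2 h2 j (\<theta>' j)))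
      \<le> (\<integral>z. G z * (V (fst z) * V' (snd z)) \<partial>tor)" .
    have a0: "0 \<le> a m m'" using m by (intro cosine_coeffs_monotone(3)[OF int a md]) auto
    have "real m * real m' * a m m' * (damp \<alpha>1 n1 m * damp \<alpha>2 n2 m') = a m m' * ((real m * damp \<alpha>1 n1 m) * (real m' * damp \<alpha>2 n2 m'))"
      by simp
    also have "\<dots> \<le> a m m' * ((C1 * (\<Sum>j=1..m. v j * phase_mult \<alpha>1 h1 j (\<theta> j))) * (C2 * (\<Sum>j=1..m'. v' j * phase_mult \<alpha>2 h2 j (\<theta>' j))))"
      using a0 C1 v(2,3) by (intro mult_left_mono mult_mono[OF v(4) v'(4)] a0) (auto simp: damp_bounds intro!: mult_nonneg_nonneg sum_nonneg)
    also have "\<dots> = C1 * C2 / pi\<^sup>2 * (pi\<^sup>2 * a m m' * ((\<Sum>i=1..m. v i * phase_mult \<alpha>1 h1 i (\<theta> i)) * (\<Sum>j=1..m'. v' j * phase_mult \<alpha>2 h2 j (\<theta>' j))))"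
      by simp
    also have "\<dots> \<le> C1 * C2 / pi\<^sup>2 * (\<integral>z. G z * (V (fst z) * V' (snd z)) \<partial>tor)"
      using low C1 C2 by (intro mult_left_mono) auto
    also have "\<dots> \<le> C1 * C2 / pi\<^sup>2 * norm (\<integral>z. G z * (V (fst z) * V' (snd z)) \<partial>tor)"
      using C1 C2 by (intro mult_left_mono) auto
    finally have "ennreal (real m * real m' * a m m' * (damp \<alpha>1 n1 m * damp \<alpha>2 n2 m'))
      \<le> ennreal (C1 * C2 / pi\<^sup>2 * norm (\<integral>z. G z * (V (fst z) * V' (snd z)) \<partial>tor))"
      by (rule ennreal_leI)
    also have "\<dots> = ennreal (C1 * C2 / pi\<^sup>2) * ennreal (norm (\<integral>z. G z * (V (fst z) * V' (snd z)) \<partial>tor))"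
      using C1 C2 by (intro ennreal_mult) auto
    also have "\<dots> \<le> ennreal (C1 * C2 / pi\<^sup>2) * (\<integral>\<^sup>+z. norm (G z * (V (fst z) * V' (snd z))) \<partial>tor)"
      by (intro mult_left_mono integral_norm_bound_ennreal intV) auto
    also have "\<dots> \<le> ennreal (C1 * C2 / pi\<^sup>2) * (\<integral>\<^sup>+z. ennreal \<bar>G z\<bar> * (ennreal (peak_sum \<alpha>1 h1 m (fst z)) * ennreal (peak_sum \<alpha>2 h2 m' (snd z))) \<partial>tor)"
    proof (intro mult_left_mono nn_integral_mono)
      fix z
      have "norm (G z * (V (fst z) * V' (snd z))) \<le> \<bar>G z\<bar> * (peak_sum \<alpha>1 h1 m (fst z) * peak_sum \<alpha>2 h2 m' (snd z))"
        using v(1) v'(1) \<alpha> m by (auto simp: abs_mult V_def V'_def intro!: mult_left_mono mult_mono)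
      then show "ennreal (norm (G z * (V (fst z) * V' (snd z)))) \<le> ennreal \<bar>G z\<bar> * (ennreal (peak_sum \<alpha>1 h1 m (fst z)) * ennreal (peak_sum \<alpha>2 h2 m' (snd z)))"
        using \<alpha> m by (simp add: ennreal_leI flip: ennreal_mult)
    qed simp
    finally show ?case by (simp add: k G_def h1_def h2_def)
  qed
qed

text \<open>By Tonelli's theorem the bound for a single coefficient becomes an average, over pairs
  of translations, of kernel integrals of the difference. The averaging inequality reduces this to
  one pair, to which \<open>Schur_down\<close> applies.\<close>

lemma lower_estimate:
  assumes p: "1 < p" and \<alpha>: "0 < \<alpha>1" "0 < \<alpha>2"
  obtains C where "0 < C" and "\<And>f a n1 n2. \<lbrakk>f \<in> borel_measurable borel; periodic2 f; integrable tor f; cosine_coeffs f a;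
     \<And>k l. 1 \<le> k \<Longrightarrow> 1 \<le> l \<Longrightarrow> 0 \<le> mixed_diff a k l; 0 < n1; 0 < n2\<rbrakk> \<Longrightarrow>
     coeff_sum p \<alpha>1 \<alpha>2 a n1 n2 \<le> ennreal C *
       (\<integral>\<^sup>+z. ennreal_powr (ennreal \<bar>frac_diff1 \<alpha>1 (1 / (4 * real n1)) (frac_diff2 \<alpha>2 (1 / (4 * real n2)) f) z\<bar>) p \<partial>tor)"
proof -
  obtain B where B: "0 < B" and schur: "\<And>t1 t2 g. g \<in> borel_measurable tor \<Longrightarrow>
    (\<integral>\<^sup>+k. ennreal_powr (\<integral>\<^sup>+z. ennreal (peak (fst k) (fst z + t1)) * ennreal (peak (snd k) (snd z + t2)) * g z \<partial>tor) p \<partial>(wnat \<Otimes>\<^sub>M wnat))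
     \<le> ennreal B * (\<integral>\<^sup>+z. ennreal_powr (g z) p \<partial>tor)"
  proof -
    show ?thesis by (rule Schur_down[OF p], fact that)
  qed
  obtain C0 where C0: "0 < C0" and pt: "\<And>f a n1 n2 k. \<lbrakk>f \<in> borel_measurable borel; periodic2 f; integrable tor f; cosine_coeffs f a;
     \<And>k l. 1 \<le> k \<Longrightarrow> 1 \<le> l \<Longrightarrow> 0 \<le> mixed_diff a k l; 0 < n1; 0 < n2; 0 < fst k; 0 < snd k\<rbrakk> \<Longrightarrow>
     ennreal (real (fst k) * real (snd k) * a (fst k) (snd k) * (damp \<alpha>1 n1 (fst k) * damp \<alpha>2 n2 (snd k)))
     \<le> ennreal C0 * (\<integral>\<^sup>+z. ennreal \<bar>frac_diff1 \<alpha>1 (1 / (4 * real n1)) (frac_diff2 \<alpha>2 (1 / (4 * real n2)) f) z\<bar>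
         * (ennreal (peak_sum \<alpha>1 (1 / (4 * real n1)) (fst k) (fst z)) * ennreal (peak_sum \<alpha>2 (1 / (4 * real n2)) (snd k) (snd z))) \<partial>tor)"
  proof -
    show ?thesis by (rule coeff_le_difference[OF \<alpha>], fact that)
  qed
  define W where "W = (\<Sum>\<nu>. shift_weight \<alpha>1 \<nu>) * (\<Sum>\<nu>. shift_weight \<alpha>2 \<nu>)"
  have W0: "0 \<le> W" using \<alpha> by (simp add: W_def suminf_nonneg summable_shift_weight)
  define C where "C = C0 powr p * (W powr p * B) + 1"
  have C: "0 < C" using B by (simp add: C_def add_nonneg_pos)
  show thesis
  proof (rule that[OF C], goal_cases)
    case (1 f a n1 n2)
    note f [measurable] = 1(1)
    define h1 where "h1 = 1 / (4 * real n1)"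
    define h2 where "h2 = 1 / (4 * real n2)"
    define G where "G = frac_diff1 \<alpha>1 h1 (frac_diff2 \<alpha>2 h2 f)"
    have Gm [measurable]: "G \<in> borel_measurable borel"
      unfolding G_def frac_diff1_eq frac_diff2_eq by measurable
    define F where "F \<iota> k = (\<integral>\<^sup>+z. pair_peak \<alpha>1 \<alpha>2 h1 h2 \<iota> k z * ennreal \<bar>G z\<bar> \<partial>tor)" for \<iota> k
    interpret C: sigma_finite_measure "count_space (UNIV :: (nat \<times> nat) set)"
      by (rule sigma_finite_measure_count_space_countable) simp
    interpret Ct: pair_sigma_finite "count_space (UNIV :: (nat \<times> nat) set)" tor ..
    have AE: "AE k in wnat \<Otimes>\<^sub>M wnat. ennreal (real (fst k) * real (snd k) * a (fst k) (snd k) * (damp \<alpha>1 n1 (fst k) * damp \<alpha>2 n2 (snd k)))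
       \<le> ennreal C0 * (\<integral>\<^sup>+\<iota>. pair_weight \<alpha>1 \<alpha>2 \<iota> * F \<iota> k \<partial>count_space UNIV)"
      using AE_wnat2
    proof eventually_elim
      case (elim k)
      have "ennreal (real (fst k) * real (snd k) * a (fst k) (snd k) * (damp \<alpha>1 n1 (fst k) * damp \<alpha>2 n2 (snd k)))
        \<le> ennreal C0 * (\<integral>\<^sup>+z. ennreal \<bar>G z\<bar> * (ennreal (peak_sum \<alpha>1 h1 (fst k) (fst z)) * ennreal (peak_sum \<alpha>2 h2 (snd k) (snd z))) \<partial>tor)"
        unfolding G_def h1_def h2_def using elim by (intro pt 1) auto
      also have "(\<integral>\<^sup>+z. ennreal \<bar>G z\<bar> * (ennreal (peak_sum \<alpha>1 h1 (fst k) (fst z)) * ennreal (peak_sum \<alpha>2 h2 (snd k) (snd z))) \<partial>tor)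
        = (\<integral>\<^sup>+z. \<integral>\<^sup>+\<iota>. pair_weight \<alpha>1 \<alpha>2 \<iota> * (pair_peak \<alpha>1 \<alpha>2 h1 h2 \<iota> k z * ennreal \<bar>G z\<bar>) \<partial>count_space UNIV \<partial>tor)"
        using elim \<alpha> by (intro nn_integral_cong)
          (simp add: ennreal_peak_sum_mult nn_integral_cmult[symmetric] mult_ac)
      also have "\<dots> = (\<integral>\<^sup>+\<iota>. \<integral>\<^sup>+z. pair_weight \<alpha>1 \<alpha>2 \<iota> * (pair_peak \<alpha>1 \<alpha>2 h1 h2 \<iota> k z * ennreal \<bar>G z\<bar>) \<partial>tor \<partial>count_space UNIV)"
      proof (rule Ct.Fubini')
        show "(\<lambda>(\<iota>, z). pair_weight \<alpha>1 \<alpha>2 \<iota> * (pair_peak \<alpha>1 \<alpha>2 h1 h2 \<iota> k z * ennreal \<bar>G z\<bar>)) \<in> borel_measurable (count_space UNIV \<Otimes>\<^sub>M tor)"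
          by (rule measurable_pair_measure_countable1) (auto simp: borel_measurable_tor)
      qed
      also have "\<dots> = (\<integral>\<^sup>+\<iota>. pair_weight \<alpha>1 \<alpha>2 \<iota> * F \<iota> k \<partial>count_space UNIV)"
        unfolding F_def by (intro nn_integral_cong nn_integral_cmult) (simp add: borel_measurable_tor)
      finally show ?case .
    qed
    have "coeff_sum p \<alpha>1 \<alpha>2 a n1 n2 \<le> (\<integral>\<^sup>+k. ennreal_powr (ennreal C0 * (\<integral>\<^sup>+\<iota>. pair_weight \<alpha>1 \<alpha>2 \<iota> * F \<iota> k \<partial>count_space UNIV)) p \<partial>(wnat \<Otimes>\<^sub>M wnat))"
      unfolding coeff_sum_def using AE p by (intro nn_integral_mono_AE) (auto intro!: ennreal_powr_mono)
    also have "\<dots> = ennreal (C0 powr p) * (\<integral>\<^sup>+k. ennreal_powr (\<integral>\<^sup>+\<iota>. pair_weight \<alpha>1 \<alpha>2 \<iota> * F \<iota> k \<partial>count_space UNIV) p \<partial>(wnat \<Otimes>\<^sub>M wnat))"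
      using p C0 by (simp add: ennreal_powr_mult ennreal_powr_ennreal nn_integral_cmult)
    also have "\<dots> \<le> ennreal (C0 powr p) * (ennreal_powr (ennreal W) p * (ennreal B * (\<integral>\<^sup>+z. ennreal_powr (ennreal \<bar>G z\<bar>) p \<partial>tor)))"
    proof (intro mult_left_mono nn_integral_weighted_sum_powr[OF p])
      show "(\<integral>\<^sup>+\<iota>. pair_weight \<alpha>1 \<alpha>2 \<iota> \<partial>count_space UNIV) = ennreal W"
        unfolding W_def by (rule pair_weight_total[OF \<alpha>])
      show "(\<integral>\<^sup>+k. ennreal_powr (F \<iota> k) p \<partial>(wnat \<Otimes>\<^sub>M wnat)) \<le> ennreal B * (\<integral>\<^sup>+z. ennreal_powr (ennreal \<bar>G z\<bar>) p \<partial>tor)" for \<iota>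
        unfolding F_def pair_peak_def by (rule schur) (simp add: borel_measurable_tor)
    qed (auto simp: wnat2.P.sigma_finite_measure_axioms)
    also have "\<dots> = ennreal (C0 powr p * (W powr p * B)) * (\<integral>\<^sup>+z. ennreal_powr (ennreal \<bar>G z\<bar>) p \<partial>tor)"
      using W0 B by (simp add: ennreal_powr_ennreal ennreal_mult mult_ac)
    also have "\<dots> \<le> ennreal C * (\<integral>\<^sup>+z. ennreal_powr (ennreal \<bar>G z\<bar>) p \<partial>tor)"
      by (intro mult_right_mono ennreal_leI) (auto simp: C_def)
    finally show ?case by (simp add: G_def h1_def h2_def)
  qed
qed

section \<open>Partial summation\<close>

text \<open>With the weights 1 / k^2 and 1 / l^2 of \<open>wnat\<close> this is the series of
  coefficients times \<open>damp\<close> and \<open>peak\<close>, divided by k l, as on the right of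
  \<open>sum_mixed_diff_peak_le\<close>.\<close>

definition majorant :: "real \<Rightarrow> real \<Rightarrow> (nat \<Rightarrow> nat \<Rightarrow> real) \<Rightarrow> nat \<Rightarrow> nat \<Rightarrow> real \<times> real \<Rightarrow> ennreal" where
  "majorant \<alpha>1 \<alpha>2 a n1 n2 z = (\<integral>\<^sup>+k. ennreal (peak (fst k) (fst z)) * ennreal (peak (snd k) (snd z))
     * ennreal (real (fst k) * real (snd k) * a (fst k) (snd k) * (damp \<alpha>1 n1 (fst k) * damp \<alpha>2 n2 (snd k))) \<partial>(wnat \<Otimes>\<^sub>M wnat))"

lemma nn_integral_wnat2:
  "(\<integral>\<^sup>+k. f k \<partial>(wnat \<Otimes>\<^sub>M wnat)) = (\<Sum>k. ennreal (1 / (real k)\<^sup>2) * (\<Sum>l. ennreal (1 / (real l)\<^sup>2) * f (k, l)))"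
  by (subst wnat.nn_integral_fst[symmetric]) (simp_all add: nn_integral_wnat)

lemma measurable_majorant [measurable]: "majorant \<alpha>1 \<alpha>2 a n1 n2 \<in> borel_measurable borel"
  unfolding majorant_def nn_integral_wnat2 by measurable

lemma periodic2_majorant: "periodic2 (majorant \<alpha>1 \<alpha>2 a n1 n2)"
  by (simp add: periodic2_def majorant_def)

text \<open>The translation \<open>c\<close> is absorbed by the shifts in \<open>Schur_up\<close>,
  so the constant does not depend on it.\<close>

lemma nn_integral_majorant_shift:
  assumes p: "1 < p"
  obtains B where "0 < B" and "\<And>\<alpha>1 \<alpha>2 a n1 n2 c.
    (\<integral>\<^sup>+z. ennreal_powr (majorant \<alpha>1 \<alpha>2 a n1 n2 (z + c)) p \<partial>tor) \<le> ennreal B * coeff_sum p \<alpha>1 \<alpha>2 a n1 n2"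
proof -
  obtain B where B: "0 < B" and schur: "\<And>t1 t2 g. g \<in> borel_measurable (wnat \<Otimes>\<^sub>M wnat) \<Longrightarrow>
    (\<integral>\<^sup>+z. ennreal_powr (\<integral>\<^sup>+k. ennreal (peak (fst k) (fst z + t1)) * ennreal (peak (snd k) (snd z + t2)) * g k
        \<partial>(wnat \<Otimes>\<^sub>M wnat)) p \<partial>tor) \<le> ennreal B * (\<integral>\<^sup>+k. ennreal_powr (g k) p \<partial>(wnat \<Otimes>\<^sub>M wnat))"
  proof -
    show ?thesis by (rule Schur_up[OF p], fact that)
  qed
  show thesis
  proof (rule that[OF B])
    fix \<alpha>1 \<alpha>2 a n1 n2 and c :: "real \<times> real"
    show "(\<integral>\<^sup>+z. ennreal_powr (majorant \<alpha>1 \<alpha>2 a n1 n2 (z + c)) p \<partial>tor) \<le> ennreal B * coeff_sum p \<alpha>1 \<alpha>2 a n1 n2"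
      unfolding majorant_def coeff_sum_def fst_add snd_add by (rule schur) simp
  qed
qed

lemma nn_integral_weighted_majorant:
  fixes w1 w2 :: "nat \<Rightarrow> real"
  assumes p: "1 < p" and B: "\<And>c. (\<integral>\<^sup>+z. ennreal_powr (majorant \<alpha>1 \<alpha>2 a n1 n2 (z + c)) p \<partial>tor) \<le> R"
    and w: "summable w1" "summable w2" "\<And>\<nu>. 0 \<le> w1 \<nu>" "\<And>\<nu>. 0 \<le> w2 \<nu>"
  shows "(\<integral>\<^sup>+z. ennreal_powr (\<integral>\<^sup>+\<iota>. ennreal (w1 (fst \<iota>)) * ennreal (w2 (snd \<iota>)) * majorant \<alpha>1 \<alpha>2 a n1 n2 (z + (t1 (fst \<iota>), t2 (snd \<iota>))) \<partial>count_space UNIV) p \<partial>tor)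
    \<le> ennreal_powr (ennreal (suminf w1 * suminf w2)) p * R"
proof (rule nn_integral_weighted_sum_powr[OF p])
  show "(\<integral>\<^sup>+\<iota>. ennreal (w1 (fst \<iota>)) * ennreal (w2 (snd \<iota>)) \<partial>count_space UNIV) = ennreal (suminf w1 * suminf w2)"
    using nn_integral_count_space_mult[of "\<lambda>\<nu>. ennreal (w1 \<nu>)" "\<lambda>\<nu>. ennreal (w2 \<nu>)"] w
    by (simp add: nn_integral_count_space_nat suminf_ennreal2 ennreal_mult suminf_nonneg)
qed (use B in \<open>auto simp: tor.P.sigma_finite_measure_axioms borel_measurable_tor\<close>)

lemma sum_mixed_diff_le_majorant:
  assumes \<alpha>: "0 < \<alpha>1" "0 < \<alpha>2"
    and a0: "\<And>k l. 1 \<le> k \<Longrightarrow> 1 \<le> l \<Longrightarrow> 0 \<le> a k l"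
    and a1: "\<And>k l. 1 \<le> k \<Longrightarrow> 1 \<le> l \<Longrightarrow> a (Suc k) l \<le> a k l"
  shows "ennreal (\<Sum>k=1..N. \<Sum>l=1..N. mixed_diff a k l * (damp \<alpha>1 n1 k * peak k (fst z)) * (damp \<alpha>2 n2 l * peak l (snd z)))
    \<le> ennreal ((1 + \<alpha>1) * (1 + \<alpha>2)) * majorant \<alpha>1 \<alpha>2 a n1 n2 z"
proof -
  let ?x = "fst z" and ?y = "snd z"
  define g where "g k l = ennreal (1 / (real l)\<^sup>2) * (ennreal (peak k ?x) * ennreal (peak l ?y) * ennreal (real k * real l * a k l * (damp \<alpha>1 n1 k * damp \<alpha>2 n2 l)))" for k l
  have "ennreal (\<Sum>k=1..N. \<Sum>l=1..N. a k l * (damp \<alpha>1 n1 k * peak k ?x) * (damp \<alpha>2 n2 l * peak l ?y) / (real k * real l))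
    = (\<Sum>k=1..N. \<Sum>l=1..N. ennreal (a k l * (damp \<alpha>1 n1 k * peak k ?x) * (damp \<alpha>2 n2 l * peak l ?y) / (real k * real l)))"
    using a0 by (subst sum_ennreal[symmetric], force intro!: sum_nonneg mult_nonneg_nonneg divide_nonneg_nonneg simp: damp_bounds)
      (intro sum.cong refl sum_ennreal[symmetric], force intro!: mult_nonneg_nonneg divide_nonneg_nonneg simp: damp_bounds)
  also have "\<dots> = (\<Sum>k=1..N. ennreal (1 / (real k)\<^sup>2) * (\<Sum>l=1..N. g k l))"
    unfolding sum_distrib_left
  proof (intro sum.cong refl)
    fix k l assume kl: "k \<in> {1..N}" "l \<in> {1..N}"
    have "a k l * (damp \<alpha>1 n1 k * peak k ?x) * (damp \<alpha>2 n2 l * peak l ?y) / (real k * real l)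
      = 1 / (real k)\<^sup>2 * (1 / (real l)\<^sup>2 * (peak k ?x * peak l ?y * (real k * real l * a k l * (damp \<alpha>1 n1 k * damp \<alpha>2 n2 l))))"
      using kl by (simp add: power2_eq_square)
    then show "ennreal (a k l * (damp \<alpha>1 n1 k * peak k ?x) * (damp \<alpha>2 n2 l * peak l ?y) / (real k * real l)) = ennreal (1 / (real k)\<^sup>2) * g k l"
      using a0 kl unfolding g_def by (simp only:) (subst ennreal_mult[symmetric], auto simp: damp_bounds)+
  qed
  also have "\<dots> \<le> (\<Sum>k=1..N. ennreal (1 / (real k)\<^sup>2) * (\<Sum>l. g k l))"
    by (intro sum_mono mult_left_mono sum_le_suminf summableI) auto
  also have "\<dots> \<le> (\<Sum>k. ennreal (1 / (real k)\<^sup>2) * (\<Sum>l. g k l))"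
    by (intro sum_le_suminf summableI) auto
  also have "\<dots> = majorant \<alpha>1 \<alpha>2 a n1 n2 z"
    unfolding majorant_def nn_integral_wnat2 g_def by simp
  finally have le: "ennreal (\<Sum>k=1..N. \<Sum>l=1..N. a k l * (damp \<alpha>1 n1 k * peak k ?x) * (damp \<alpha>2 n2 l * peak l ?y) / (real k * real l)) \<le> majorant \<alpha>1 \<alpha>2 a n1 n2 z" .
  have "ennreal (\<Sum>k=1..N. \<Sum>l=1..N. mixed_diff a k l * (damp \<alpha>1 n1 k * peak k ?x) * (damp \<alpha>2 n2 l * peak l ?y))
    \<le> ennreal ((1 + \<alpha>1) * (1 + \<alpha>2) * (\<Sum>k=1..N. \<Sum>l=1..N. a k l * (damp \<alpha>1 n1 k * peak k ?x) * (damp \<alpha>2 n2 l * peak l ?y) / (real k * real l)))"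
    by (intro ennreal_leI sum_mixed_diff_peak_le \<alpha> a0 a1)
  also have "\<dots> = ennreal ((1 + \<alpha>1) * (1 + \<alpha>2)) * ennreal (\<Sum>k=1..N. \<Sum>l=1..N. a k l * (damp \<alpha>1 n1 k * peak k ?x) * (damp \<alpha>2 n2 l * peak l ?y) / (real k * real l))"
    using \<alpha> a0 by (intro ennreal_mult sum_nonneg divide_nonneg_nonneg mult_nonneg_nonneg) (auto simp: damp_bounds)
  also have "\<dots> \<le> ennreal ((1 + \<alpha>1) * (1 + \<alpha>2)) * majorant \<alpha>1 \<alpha>2 a n1 n2 z"
    by (intro mult_left_mono le) auto
  finally show ?thesis .
qed

section \<open>The partial sums and their limit\<close>

definition dirichlet :: "nat \<Rightarrow> real \<Rightarrow> real" where
  "dirichlet k x = (\<Sum>j=1..k. cos (real j * x))"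

lemma abs_dirichlet_le: "1 \<le> k \<Longrightarrow> \<bar>dirichlet k x\<bar> \<le> peak k x"
  using abs_sum_cos_le_peak[of k x 0] by (simp add: dirichlet_def)

lemma measurable_dirichlet [measurable]: "dirichlet k \<in> borel_measurable borel"
  unfolding dirichlet_def by measurable

text \<open>The partial sums of \<open>f\<close>, after summation by parts in both variables, up to terms that vanish in the limit.\<close>

definition abel_sum :: "(nat \<Rightarrow> nat \<Rightarrow> real) \<Rightarrow> nat \<Rightarrow> real \<times> real \<Rightarrow> real" where
  "abel_sum a N z = (\<Sum>k=1..N. \<Sum>l=1..N. mixed_diff a k l * (dirichlet k (fst z) * dirichlet l (snd z)))"

lemma measurable_abel_sum [measurable]: "abel_sum a N \<in> borel_measurable borel"
  unfolding abel_sum_def by measurable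

lemma dirichlet_periodic: "dirichlet k (x + 2 * pi) = dirichlet k x"
proof -
  have "cos (real j * (x + 2 * pi)) = cos (real j * x)" for j
  proof -
    have "real j * (x + 2 * pi) = real j * x + 2 * of_int (int j) * pi" by (simp add: algebra_simps)
    then show ?thesis by (simp only: cos_add sin_int_2pin cos_int_2pin) simp
  qed
  then show ?thesis by (simp add: dirichlet_def)
qed

lemma periodic2_abel_sum: "periodic2 (abel_sum a N)"
  by (simp add: periodic2_def abel_sum_def dirichlet_periodic)

text \<open>Square sums of nonnegative terms increase; in general \<open>t\<close> is the difference
  of the nonnegative arrays t + u and u.\<close>

lemma convergent_square_sums:
  fixes t u :: "nat \<Rightarrow> nat \<Rightarrow> real"
  assumes tu: "\<And>k l. 1 \<le> k \<Longrightarrow> 1 \<le> l \<Longrightarrow> \<bar>t k l\<bar> \<le> u k l" and B: "\<And>N. (\<Sum>k=1..N. \<Sum>l=1..N. u k l) \<le> B"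
  shows "convergent (\<lambda>N. \<Sum>k=1..N. \<Sum>l=1..N. t k l)"
proof -
  have conv: "convergent (\<lambda>N. \<Sum>k=1..N. \<Sum>l=1..N. v k l)"
    if v: "\<And>k l. 1 \<le> k \<Longrightarrow> 1 \<le> l \<Longrightarrow> 0 \<le> v k l" and vB: "\<And>N. (\<Sum>k=1..N. \<Sum>l=1..N. v k l) \<le> B'" for v :: "nat \<Rightarrow> nat \<Rightarrow> real" and B'
  proof -
    have inc: "incseq (\<lambda>N. \<Sum>k=1..N. \<Sum>l=1..N. v k l)"
    proof (rule incseq_SucI)
      fix N
      have "(\<Sum>k=1..N. \<Sum>l=1..N. v k l) \<le> (\<Sum>k=1..N. \<Sum>l=1..Suc N. v k l)"
        using v by (intro sum_mono sum_mono2) auto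
      also have "\<dots> \<le> (\<Sum>k=1..Suc N. \<Sum>l=1..Suc N. v k l)"
        using v by (intro sum_mono2 sum_nonneg) auto
      finally show "(\<Sum>k=1..N. \<Sum>l=1..N. v k l) \<le> (\<Sum>k=1..Suc N. \<Sum>l=1..Suc N. v k l)" .
    qed
    obtain L where "(\<lambda>N. \<Sum>k=1..N. \<Sum>l=1..N. v k l) \<longlonglongrightarrow> L"
      using incseq_convergent[OF inc allI[OF vB]] by blast
    then show ?thesis by (rule convergentI)
  qed
  have "convergent (\<lambda>N. \<Sum>k=1..N. \<Sum>l=1..N. u k l)"
    by (rule conv[OF _ B]) (use tu in \<open>auto intro: order.trans[OF abs_ge_zero]\<close>)
  moreover have "convergent (\<lambda>N. \<Sum>k=1..N. \<Sum>l=1..N. t k l + u k l)"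
  proof (rule conv)
    show "0 \<le> t k l + u k l" if "1 \<le> k" "1 \<le> l" for k l using tu[OF that] by linarith
    have "(\<Sum>k=1..N. \<Sum>l=1..N. t k l + u k l) \<le> (\<Sum>k=1..N. \<Sum>l=1..N. 2 * u k l)" for N
    proof (intro sum_mono)
      fix k l assume "k \<in> {1..N}" "l \<in> {1..N}"
      then show "t k l + u k l \<le> 2 * u k l" using tu[of k l] by auto
    qed
    note le = this
    show "(\<Sum>k=1..N. \<Sum>l=1..N. t k l + u k l) \<le> 2 * B" for N
    proof -
      have "(\<Sum>k=1..N. \<Sum>l=1..N. 2 * u k l) = 2 * (\<Sum>k=1..N. \<Sum>l=1..N. u k l)"
        by (simp only: sum_distrib_left)
      then show ?thesis using B[of N] le[of N] by linarith
    qed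
  qed
  ultimately have "convergent (\<lambda>N. (\<Sum>k=1..N. \<Sum>l=1..N. t k l + u k l) - (\<Sum>k=1..N. \<Sum>l=1..N. u k l))"
    by (intro convergent_diff)
  then show ?thesis by (simp add: sum.distrib)
qed

text \<open>At n = 1 the damping disappears, so the majorant for n1 = n2 = 1 dominates the series of
  \<open>f\<close> itself, without any difference.\<close>

lemma damp_1: "1 \<le> k \<Longrightarrow> damp \<alpha> 1 k = 1"
  by (simp add: damp_def)

lemma abel_sum_bound:
  assumes \<alpha>: "0 < \<alpha>1" "0 < \<alpha>2"
    and md: "\<And>k l. 1 \<le> k \<Longrightarrow> 1 \<le> l \<Longrightarrow> 0 \<le> mixed_diff a k l"
    and a0: "\<And>k l. 1 \<le> k \<Longrightarrow> 1 \<le> l \<Longrightarrow> 0 \<le> a k l"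
    and a1: "\<And>k l. 1 \<le> k \<Longrightarrow> 1 \<le> l \<Longrightarrow> a (Suc k) l \<le> a k l"
    and fin: "majorant \<alpha>1 \<alpha>2 a 1 1 z < top"
  shows "\<bar>abel_sum a N z\<bar> \<le> (1 + \<alpha>1) * (1 + \<alpha>2) * enn2real (majorant \<alpha>1 \<alpha>2 a 1 1 z)"
    and "convergent (\<lambda>N. abel_sum a N z)"
proof -
  define u where "u k l = mixed_diff a k l * peak k (fst z) * peak l (snd z)" for k l
  have tu: "\<bar>mixed_diff a k l * (dirichlet k (fst z) * dirichlet l (snd z))\<bar> \<le> u k l" if "1 \<le> k" "1 \<le> l" for k l
    using md[OF that] abs_dirichlet_le[OF that(1), of "fst z"] abs_dirichlet_le[OF that(2), of "snd z"]
    by (auto simp: u_def abs_mult mult.assoc intro!: mult_left_mono mult_mono)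
  obtain r where r: "0 \<le> r" "majorant \<alpha>1 \<alpha>2 a 1 1 z = ennreal r" using fin by (auto simp: less_top_ennreal)
  have B: "(\<Sum>k=1..N. \<Sum>l=1..N. u k l) \<le> (1 + \<alpha>1) * (1 + \<alpha>2) * r" for N
  proof -
    have "(\<Sum>k=1..N. \<Sum>l=1..N. u k l) = (\<Sum>k=1..N. \<Sum>l=1..N. mixed_diff a k l * (damp \<alpha>1 1 k * peak k (fst z)) * (damp \<alpha>2 1 l * peak l (snd z)))"
      by (intro sum.cong refl) (simp add: u_def damp_1[unfolded One_nat_def])
    then have "ennreal (\<Sum>k=1..N. \<Sum>l=1..N. u k l) \<le> ennreal ((1 + \<alpha>1) * (1 + \<alpha>2)) * ennreal r"
      using sum_mixed_diff_le_majorant[where a = a, OF \<alpha> a0 a1, where z = z and N = N and ?n1.0 = 1 and ?n2.0 = 1] r(2) by simp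
    then have "ennreal (\<Sum>k=1..N. \<Sum>l=1..N. u k l) \<le> ennreal ((1 + \<alpha>1) * (1 + \<alpha>2) * r)"
      using r \<alpha> by (simp flip: ennreal_mult)
    then show ?thesis by (subst (asm) ennreal_le_iff) (use r \<alpha> in auto)
  qed
  show "convergent (\<lambda>N. abel_sum a N z)"
    unfolding abel_sum_def by (rule convergent_square_sums[OF tu B])
  have "\<bar>abel_sum a N z\<bar> \<le> (\<Sum>k=1..N. \<Sum>l=1..N. u k l)"
    unfolding abel_sum_def using tu
    by (intro order.trans[OF sum_abs] sum_mono) auto
  then show "\<bar>abel_sum a N z\<bar> \<le> (1 + \<alpha>1) * (1 + \<alpha>2) * enn2real (majorant \<alpha>1 \<alpha>2 a 1 1 z)"
    using B[of N] r by simp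
qed

lemma integral_dirichlet_cos:
  "(\<integral>x. dirichlet k x * cos (real i * x + \<theta>) \<partial>circ) = (if 1 \<le> i \<and> i \<le> k then pi * cos \<theta> else 0)"
proof -
  have "integrable circ (\<lambda>x. cos (real j * x) * cos (real i * x + \<theta>))" for j
    by (rule integrable_circ_bounded[OF _ abs_mult_cos_le_1]) simp
  then have "(\<integral>x. dirichlet k x * cos (real i * x + \<theta>) \<partial>circ) = (\<Sum>j=1..k. \<integral>x. cos (real j * x) * cos (real i * x + \<theta>) \<partial>circ)"
    by (simp add: dirichlet_def sum_distrib_right)
  also have "\<dots> = (\<Sum>j=1..k. if j = i then pi * cos \<theta> else 0)"
    by (intro sum.cong refl integral_circ_cos_cos) auto
  also have "\<dots> = (if 1 \<le> i \<and> i \<le> k then pi * cos \<theta> else 0)"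
    by (simp add: sum.delta)
  finally show ?thesis .
qed

lemma abs_dirichlet_le_nat: "\<bar>dirichlet k x\<bar> \<le> real k"
  unfolding dirichlet_def by (rule order.trans[OF sum_abs]) (use sum_mono[of "{1..k}" "\<lambda>j. \<bar>cos (real j * x)\<bar>" "\<lambda>_. 1"] in auto)

lemma sum_if_telescope:
  fixes c :: "nat \<Rightarrow> real"
  assumes "1 \<le> j" "j \<le> N"
  shows "(\<Sum>l=1..N. if j \<le> l then c l - c (Suc l) else 0) = c j - c (Suc N)"
  using assms(2,1)
proof (induction N rule: dec_induct)
  case base
  then have "(\<Sum>l=1..j. if j \<le> l then c l - c (Suc l) else 0) = (\<Sum>l\<in>{j}. c l - c (Suc l))"
    by (intro sum.mono_neutral_cong_right) auto
  then show ?case by simp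
qed auto

text \<open>Orthogonality leaves a rectangle of mixed differences, which telescopes to its four
  corners. The three corners with index N + 1 are the boundary terms that vanish in the
  limit.\<close>

lemma abel_sum_cos_integral:
  "(\<integral>z. abel_sum a N z * (cos (real i * fst z + \<theta>) * cos (real j * snd z + \<theta>')) \<partial>tor)
    = (if 1 \<le> i \<and> i \<le> N \<and> 1 \<le> j \<and> j \<le> N then pi\<^sup>2 * cos \<theta> * cos \<theta>' * (a i j - a (Suc N) j - a i (Suc N) + a (Suc N) (Suc N)) else 0)"
proof -
  have b: "\<bar>dirichlet k x * cos y\<bar> \<le> real k" for k x y
    using mult_mono[OF abs_dirichlet_le_nat[of k x] abs_cos_le_one[of y]] by (simp add: abs_mult)
  have int: "integrable tor (\<lambda>z. dirichlet k (fst z) * cos (real i * fst z + \<theta>) * (dirichlet l (snd z) * cos (real j * snd z + \<theta>')))"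
    and eq: "(\<integral>z. dirichlet k (fst z) * cos (real i * fst z + \<theta>) * (dirichlet l (snd z) * cos (real j * snd z + \<theta>')) \<partial>tor)
      = (if 1 \<le> i \<and> i \<le> k then pi * cos \<theta> else 0) * (if 1 \<le> j \<and> j \<le> l then pi * cos \<theta>' else 0)" for k l
    using integral_tor_mult[of "\<lambda>x. dirichlet k x * cos (real i * x + \<theta>)" "\<lambda>y. dirichlet l y * cos (real j * y + \<theta>')", OF _ _ b b]
    by (simp_all add: integral_dirichlet_cos)
  have "(\<integral>z. abel_sum a N z * (cos (real i * fst z + \<theta>) * cos (real j * snd z + \<theta>')) \<partial>tor)
    = (\<integral>z. (\<Sum>k=1..N. \<Sum>l=1..N. mixed_diff a k l * (dirichlet k (fst z) * cos (real i * fst z + \<theta>) * (dirichlet l (snd z) * cos (real j * snd z + \<theta>')))) \<partial>tor)"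
    by (intro Bochner_Integration.integral_cong refl) (simp add: abel_sum_def sum_distrib_left sum_distrib_right mult_ac)
  also have "\<dots> = (\<Sum>k=1..N. \<Sum>l=1..N. mixed_diff a k l * ((if 1 \<le> i \<and> i \<le> k then pi * cos \<theta> else 0) * (if 1 \<le> j \<and> j \<le> l then pi * cos \<theta>' else 0)))"
    by (simp add: int eq)
  also have "\<dots> = (if 1 \<le> i \<and> i \<le> N \<and> 1 \<le> j \<and> j \<le> N then pi\<^sup>2 * cos \<theta> * cos \<theta>' * (a i j - a (Suc N) j - a i (Suc N) + a (Suc N) (Suc N)) else 0)"
  proof (cases "1 \<le> i \<and> i \<le> N \<and> 1 \<le> j \<and> j \<le> N")
    case True
    have "(\<Sum>k=1..N. \<Sum>l=1..N. mixed_diff a k l * ((if 1 \<le> i \<and> i \<le> k then pi * cos \<theta> else 0) * (if 1 \<le> j \<and> j \<le> l then pi * cos \<theta>' else 0)))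
      = (\<Sum>k=1..N. pi\<^sup>2 * cos \<theta> * cos \<theta>' * (if i \<le> k then (\<Sum>l=1..N. if j \<le> l then (a k l - a (Suc k) l) - (a k (Suc l) - a (Suc k) (Suc l)) else 0) else 0))"
      unfolding sum_distrib_left using True
      by (intro sum.cong refl) (auto simp: mixed_diff_def sum_distrib_left power2_eq_square algebra_simps intro!: sum.cong)
    also have "\<dots> = (\<Sum>k=1..N. pi\<^sup>2 * cos \<theta> * cos \<theta>' * (if i \<le> k then (a k j - a k (Suc N)) - (a (Suc k) j - a (Suc k) (Suc N)) else 0))"
      using True sum_if_telescope[of j N "\<lambda>l. a _ l - a (Suc _) l"] by (intro sum.cong refl) auto
    also have "\<dots> = pi\<^sup>2 * cos \<theta> * cos \<theta>' * ((a i j - a i (Suc N)) - (a (Suc N) j - a (Suc N) (Suc N)))"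
      using True sum_if_telescope[of i N "\<lambda>k. a k j - a k (Suc N)"] by (simp flip: sum_distrib_left)
    finally show ?thesis using True by (simp add: algebra_simps)
  next
    case False
    then show ?thesis by (auto intro!: sum.neutral)
  qed
  finally show ?thesis .
qed


lemma enn2real_majorant_integrable:
  assumes p: "1 < p" and fin: "(\<integral>\<^sup>+z. ennreal_powr (majorant \<alpha>1 \<alpha>2 a n1 n2 z) p \<partial>tor) < top"
  shows "AE z in tor. majorant \<alpha>1 \<alpha>2 a n1 n2 z < top" and "integrable tor (\<lambda>z. enn2real (majorant \<alpha>1 \<alpha>2 a n1 n2 z))"
proof -
  have "(\<integral>\<^sup>+z. majorant \<alpha>1 \<alpha>2 a n1 n2 z \<partial>tor) \<le> (\<integral>\<^sup>+z. 1 + ennreal_powr (majorant \<alpha>1 \<alpha>2 a n1 n2 z) p \<partial>tor)"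
    by (intro nn_integral_mono le_one_plus_ennreal_powr p)
  also have "\<dots> = (\<integral>\<^sup>+z. 1 \<partial>tor) + (\<integral>\<^sup>+z. ennreal_powr (majorant \<alpha>1 \<alpha>2 a n1 n2 z) p \<partial>tor)"
    by (rule nn_integral_add) (simp_all add: borel_measurable_tor)
  also have "\<dots> < top" using fin emeasure_tor by (simp add: space_pair_measure)
  finally have fin1: "(\<integral>\<^sup>+z. majorant \<alpha>1 \<alpha>2 a n1 n2 z \<partial>tor) < top" .
  have "AE z in tor. majorant \<alpha>1 \<alpha>2 a n1 n2 z \<noteq> top"
    by (rule nn_integral_PInf_AE[unfolded infinity_ennreal_def]) (use fin1 in \<open>simp_all add: borel_measurable_tor\<close>)
  then show "AE z in tor. majorant \<alpha>1 \<alpha>2 a n1 n2 z < top"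
    by (simp add: less_top)
  show "integrable tor (\<lambda>z. enn2real (majorant \<alpha>1 \<alpha>2 a n1 n2 z))"
  proof (rule integrableI_bounded)
    have "(\<integral>\<^sup>+z. ennreal (norm (enn2real (majorant \<alpha>1 \<alpha>2 a n1 n2 z))) \<partial>tor) \<le> (\<integral>\<^sup>+z. majorant \<alpha>1 \<alpha>2 a n1 n2 z \<partial>tor)"
    proof (intro nn_integral_mono)
      fix z show "ennreal (norm (enn2real (majorant \<alpha>1 \<alpha>2 a n1 n2 z))) \<le> majorant \<alpha>1 \<alpha>2 a n1 n2 z"
        by (cases "majorant \<alpha>1 \<alpha>2 a n1 n2 z") auto
    qed
    then show "(\<integral>\<^sup>+z. ennreal (norm (enn2real (majorant \<alpha>1 \<alpha>2 a n1 n2 z))) \<partial>tor) < \<infinity>"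
      using fin1 by (simp add: less_le_trans le_less_trans)
  qed (simp add: borel_measurable_tor)
qed

text \<open>The majorant for n1 = n2 = 1 is integrable and dominates the partial sums. Hence these
  converge almost everywhere, their limit has the Fourier coefficients of \<open>f\<close>, and
  uniqueness identifies it with \<open>f\<close>.\<close>

lemma abel_sum_tendsto:
  assumes p: "1 < p" and \<alpha>: "0 < \<alpha>1" "0 < \<alpha>2" and f [measurable]: "f \<in> borel_measurable borel" and int: "integrable tor f"
    and a: "cosine_coeffs f a" and md: "\<And>k l. 1 \<le> k \<Longrightarrow> 1 \<le> l \<Longrightarrow> 0 \<le> mixed_diff a k l"
    and fin: "(\<integral>\<^sup>+z. ennreal_powr (majorant \<alpha>1 \<alpha>2 a 1 1 z) p \<partial>tor) < top"
  shows "AE z in tor. (\<lambda>N. abel_sum a N z) \<longlonglongrightarrow> f z"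
proof -
  note a0 = cosine_coeffs_monotone(3)[OF int a md] and a1 = cosine_coeffs_monotone(1)[OF int a md]
  define c where "c = (1 + \<alpha>1) * (1 + \<alpha>2)"
  define g where "g z = lim (\<lambda>N. abel_sum a N z)" for z
  have g_lim: "AE z in tor. (\<lambda>N. abel_sum a N z) \<longlonglongrightarrow> g z"
    using enn2real_majorant_integrable(1)[OF p fin]
  proof eventually_elim
    case (elim z)
    from abel_sum_bound(2)[OF \<alpha> md a0 a1 elim] show ?case unfolding g_def by (simp add: convergent_LIMSEQ_iff)
  qed
  have bnd: "AE z in tor. norm (abel_sum a N z) \<le> c * enn2real (majorant \<alpha>1 \<alpha>2 a 1 1 z)" for N
    using enn2real_majorant_integrable(1)[OF p fin]
  proof eventually_elim
    case (elim z)
    from abel_sum_bound(1)[OF \<alpha> md a0 a1 elim] show ?case by (simp add: c_def)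
  qed
  have ic: "integrable tor (\<lambda>z. c * enn2real (majorant \<alpha>1 \<alpha>2 a 1 1 z))"
    using enn2real_majorant_integrable(2)[OF p fin] by simp
  have [measurable]: "g \<in> borel_measurable borel" unfolding g_def by measurable
  have int_g: "integrable tor g"
    by (rule integrable_dominated_convergence[OF _ _ ic g_lim bnd]) (simp_all add: borel_measurable_tor)
  have coeff: "(\<integral>z. g z * (cos (real i * fst z + \<theta>) * cos (real j * snd z + \<theta>')) \<partial>tor)
      = (if 1 \<le> i \<and> 1 \<le> j then pi\<^sup>2 * cos \<theta> * cos \<theta>' * a i j else 0)" for i j \<theta> \<theta>'
  proof -
    have "(\<lambda>N. \<integral>z. abel_sum a N z * (cos (real i * fst z + \<theta>) * cos (real j * snd z + \<theta>')) \<partial>tor)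
        \<longlonglongrightarrow> (\<integral>z. g z * (cos (real i * fst z + \<theta>) * cos (real j * snd z + \<theta>')) \<partial>tor)"
    proof (rule integral_dominated_convergence[OF _ _ ic])
      show "AE z in tor. (\<lambda>N. abel_sum a N z * (cos (real i * fst z + \<theta>) * cos (real j * snd z + \<theta>'))) \<longlonglongrightarrow> g z * (cos (real i * fst z + \<theta>) * cos (real j * snd z + \<theta>'))"
        using g_lim by eventually_elim (rule tendsto_mult_right)
      show "AE z in tor. norm (abel_sum a N z * (cos (real i * fst z + \<theta>) * cos (real j * snd z + \<theta>'))) \<le> c * enn2real (majorant \<alpha>1 \<alpha>2 a 1 1 z)" for N
        using bnd[of N]
      proof eventually_elim
        case (elim z)
        have "norm (abel_sum a N z * (cos (real i * fst z + \<theta>) * cos (real j * snd z + \<theta>'))) \<le> norm (abel_sum a N z)"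
          unfolding real_norm_def abs_mult[of "abel_sum a N z"] by (rule mult_left_le[OF abs_mult_cos_le_1 abs_ge_zero])
        with elim show ?case by linarith
      qed
    qed (simp_all add: borel_measurable_tor)
    moreover have "(\<lambda>N. \<integral>z. abel_sum a N z * (cos (real i * fst z + \<theta>) * cos (real j * snd z + \<theta>')) \<partial>tor)
        \<longlonglongrightarrow> (if 1 \<le> i \<and> 1 \<le> j then pi\<^sup>2 * cos \<theta> * cos \<theta>' * a i j else 0)"
    proof (cases "1 \<le> i \<and> 1 \<le> j")
      case True
      \<comment> \<open>Decay along the diagonal follows from monotonicity and the decay for l =
        1.\<close>
      have t0: "(\<lambda>N. a (Suc N) (Suc N)) \<longlonglongrightarrow> 0"
      proof (rule tendsto_sandwich[OF _ _ tendsto_const])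
        show "(\<lambda>N. a (Suc N) 1) \<longlonglongrightarrow> 0"
          using cosine_coeffs_tendsto_0(2)[OF int a, of 1] by (intro LIMSEQ_Suc) simp
        show "\<forall>\<^sub>F N in sequentially. 0 \<le> a (Suc N) (Suc N)" using a0 by simp
        show "\<forall>\<^sub>F N in sequentially. a (Suc N) (Suc N) \<le> a (Suc N) 1"
          using cosine_coeffs_antimono[OF int a md] by simp
      qed
      have "(\<lambda>N. pi\<^sup>2 * cos \<theta> * cos \<theta>' * (a i j - a (Suc N) j - a i (Suc N) + a (Suc N) (Suc N))) \<longlonglongrightarrow> pi\<^sup>2 * cos \<theta> * cos \<theta>' * (a i j - 0 - 0 + 0)"
        using True cosine_coeffs_tendsto_0(1)[OF int a, of i] cosine_coeffs_tendsto_0(2)[OF int a, of j]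
        by (intro tendsto_intros t0) (auto intro: LIMSEQ_Suc)
      moreover have "\<forall>\<^sub>F N in sequentially. pi\<^sup>2 * cos \<theta> * cos \<theta>' * (a i j - a (Suc N) j - a i (Suc N) + a (Suc N) (Suc N))
          = (\<integral>z. abel_sum a N z * (cos (real i * fst z + \<theta>) * cos (real j * snd z + \<theta>')) \<partial>tor)"
        using eventually_ge_at_top[of "max i j"] by eventually_elim (use True in \<open>simp add: abel_sum_cos_integral\<close>)
      ultimately show ?thesis using True by (auto intro: Lim_transform_eventually)
    next
      case False
      then have "(\<integral>z. abel_sum a N z * (cos (real i * fst z + \<theta>) * cos (real j * snd z + \<theta>')) \<partial>tor) = 0" for N
        unfolding abel_sum_cos_integral by auto
      with False show ?thesis by (simp only: if_False tendsto_const)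
    qed
    ultimately show ?thesis by (rule LIMSEQ_unique)
  qed
  \<comment> \<open>Sines are cosines with phase - \<pi> / 2, so \<open>coeff\<close> covers all
    four families of coefficients.\<close>
  have sin_cos: "sin x = cos (x + - (pi / 2))" for x :: real by (simp add: cos_diff)
  have "cosine_coeffs g a"
    unfolding cosine_coeffs_def
  proof (intro allI conjI)
    fix i j :: nat
    show "(\<integral>z. g z * cos (real i * fst z) * cos (real j * snd z) \<partial>tor) = (if i \<ge> 1 \<and> j \<ge> 1 then pi\<^sup>2 * a i j else 0)"
      using coeff[of i 0 j 0] by (simp add: mult.assoc)
    show "(\<integral>z. g z * cos (real i * fst z) * sin (real j * snd z) \<partial>tor) = 0"
      using coeff[of i 0 j "- (pi / 2)"] by (simp only: sin_cos[of "_ * snd _"] mult.assoc) simp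
    show "(\<integral>z. g z * sin (real i * fst z) * cos (real j * snd z) \<partial>tor) = 0"
      using coeff[of i "- (pi / 2)" j 0] by (simp only: sin_cos[of "_ * fst _"] mult.assoc) simp
    show "(\<integral>z. g z * sin (real i * fst z) * sin (real j * snd z) \<partial>tor) = 0"
      using coeff[of i "- (pi / 2)" j "- (pi / 2)"] by (simp only: sin_cos[of "_ * fst _"] sin_cos[of "_ * snd _"] mult.assoc) simp
  qed
  have trig_int: "integrable tor (\<lambda>z. h z * u (real i * fst z) * v (real j * snd z))"
    if "integrable tor h" "u = cos \<or> u = sin" "v = cos \<or> v = sin" for h and u v :: "real \<Rightarrow> real" and i j :: nat
  proof -
    have [measurable]: "u \<in> borel_measurable borel" "v \<in> borel_measurable borel" using that by auto
    have u1: "\<bar>u x\<bar> \<le> 1" "\<bar>v x\<bar> \<le> 1" for x using that by auto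
    have "\<bar>u x * v y\<bar> \<le> 1" for x y
      using mult_mono[OF u1(1)[of x] u1(2)[of y]] by (simp add: abs_mult)
    then have "integrable tor (\<lambda>z. h z * (u (real i * fst z) * v (real j * snd z)))"
      by (intro integrable_tor_mult[OF that(1), where B = 1]) auto
    then show ?thesis by (simp add: mult.assoc)
  qed
  have "AE z in tor. f z - g z = 0"
    by (rule trig_uniqueness)
      (use int int_g a \<open>cosine_coeffs g a\<close> in \<open>simp_all add: left_diff_distrib trig_int cosine_coeffs_def\<close>)
  with g_lim show ?thesis by eventually_elim simp
qed

section \<open>Limits of iterated series\<close>

lemma ennreal_double_suminf:
  fixes q :: "nat \<Rightarrow> nat \<Rightarrow> real"
  assumes q: "\<And>\<nu> \<mu>. 0 \<le> q \<nu> \<mu>" and fin: "(\<Sum>\<nu>. \<Sum>\<mu>. ennreal (q \<nu> \<mu>)) \<noteq> top"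
  shows "summable (q \<nu>)" and "summable (\<lambda>\<nu>. \<Sum>\<mu>. q \<nu> \<mu>)"
proof -
  have "(\<Sum>\<mu>. ennreal (q \<nu> \<mu>)) \<le> (\<Sum>\<nu>. \<Sum>\<mu>. ennreal (q \<nu> \<mu>))" for \<nu>
    using sum_le_suminf[of "\<lambda>\<nu>. \<Sum>\<mu>. ennreal (q \<nu> \<mu>)" "{\<nu>}"] by (simp add: summableI)
  then have "(\<Sum>\<mu>. ennreal (q \<nu> \<mu>)) \<noteq> top" for \<nu> using fin by (metis top_unique)
  then have s: "summable (q \<nu>)" for \<nu> by (rule summable_suminf_not_top[OF q])
  then show "summable (q \<nu>)" .
  have "(\<Sum>\<nu>. ennreal (\<Sum>\<mu>. q \<nu> \<mu>)) \<noteq> top"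
    using fin suminf_ennreal2[OF q s] by simp
  then show "summable (\<lambda>\<nu>. \<Sum>\<mu>. q \<nu> \<mu>)"
    by (rule summable_suminf_not_top[rotated]) (intro suminf_nonneg s q)
qed

text \<open>Tannery's theorem, for each inner series and then for the outer one.\<close>

lemma double_series_tendsto:
  fixes b b' :: "nat \<Rightarrow> real"
  assumes lim: "\<And>\<nu> \<mu>. (\<lambda>N. x N \<nu> \<mu>) \<longlonglongrightarrow> y \<nu> \<mu>" and bnd: "\<And>N \<nu> \<mu>. \<bar>x N \<nu> \<mu>\<bar> \<le> h \<nu> \<mu>"
    and fin: "(\<Sum>\<nu>. \<Sum>\<mu>. ennreal (\<bar>b \<nu>\<bar> * \<bar>b' \<mu>\<bar> * h \<nu> \<mu>)) \<noteq> top"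
  shows "(\<lambda>N. \<Sum>\<nu>. b \<nu> * (\<Sum>\<mu>. b' \<mu> * x N \<nu> \<mu>)) \<longlonglongrightarrow> (\<Sum>\<nu>. b \<nu> * (\<Sum>\<mu>. b' \<mu> * y \<nu> \<mu>))"
proof -
  have h: "0 \<le> h \<nu> \<mu>" for \<nu> \<mu> using bnd[of 0] abs_ge_zero order.trans by blast
  have q0: "0 \<le> \<bar>b \<nu>\<bar> * \<bar>b' \<mu>\<bar> * h \<nu> \<mu>" for \<nu> \<mu> using h by simp
  note s1 = ennreal_double_suminf(1)[OF q0 fin] and s2 = ennreal_double_suminf(2)[OF q0 fin]
  have ev: "eventually (\<lambda>(k, n). P k n) (at_top \<times>\<^sub>F sequentially)" if "\<And>k n. P k n" for P :: "nat \<Rightarrow> nat \<Rightarrow> bool"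
    by (rule always_eventually) (auto simp: that)
  show ?thesis
  proof (rule conjunct2[OF conjunct2[OF tannerys_theorem]])
    fix \<nu>
    show "(\<lambda>N. b \<nu> * (\<Sum>\<mu>. b' \<mu> * x N \<nu> \<mu>)) \<longlonglongrightarrow> b \<nu> * (\<Sum>\<mu>. b' \<mu> * y \<nu> \<mu>)"
    \<comment> \<open>If b \<nu> = 0, then \<open>fin\<close> says nothing about the inner majorant,
      but the whole term vanishes.\<close>
    proof (cases "b \<nu> = 0")
      case False
      have "summable (\<lambda>\<mu>. \<bar>b \<nu>\<bar> * (\<bar>b' \<mu>\<bar> * h \<nu> \<mu>))" using s1[of \<nu>] by (simp add: mult.assoc)
      then have s3: "summable (\<lambda>\<mu>. \<bar>b' \<mu>\<bar> * h \<nu> \<mu>)" by (subst (asm) summable_cmult_iff) (use False in auto)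
      have "(\<lambda>N. \<Sum>\<mu>. b' \<mu> * x N \<nu> \<mu>) \<longlonglongrightarrow> (\<Sum>\<mu>. b' \<mu> * y \<nu> \<mu>)"
      proof (rule conjunct2[OF conjunct2[OF tannerys_theorem[OF _ _ s3]]])
        show "(\<lambda>N. b' \<mu> * x N \<nu> \<mu>) \<longlonglongrightarrow> b' \<mu> * y \<nu> \<mu>" for \<mu> by (intro tendsto_mult_left lim)
        show "\<forall>\<^sub>F (\<mu>, N) in at_top \<times>\<^sub>F sequentially. norm (b' \<mu> * x N \<nu> \<mu>) \<le> \<bar>b' \<mu>\<bar> * h \<nu> \<mu>"
          by (rule ev) (simp add: abs_mult mult_left_mono bnd)
      qed simp
      then show ?thesis by (rule tendsto_mult_left)
    qed simp
  next
    have "norm (b \<nu> * (\<Sum>\<mu>. b' \<mu> * x N \<nu> \<mu>)) \<le> (\<Sum>\<mu>. \<bar>b \<nu>\<bar> * \<bar>b' \<mu>\<bar> * h \<nu> \<mu>)" for \<nu> N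
    proof (cases "b \<nu> = 0")
      case False
      have "summable (\<lambda>\<mu>. \<bar>b \<nu>\<bar> * (\<bar>b' \<mu>\<bar> * h \<nu> \<mu>))" using s1[of \<nu>] by (simp add: mult.assoc)
      then have s3: "summable (\<lambda>\<mu>. \<bar>b' \<mu>\<bar> * h \<nu> \<mu>)" by (subst (asm) summable_cmult_iff) (use False in auto)
      have le: "\<bar>b' \<mu> * x N \<nu> \<mu>\<bar> \<le> \<bar>b' \<mu>\<bar> * h \<nu> \<mu>" for \<mu> by (simp add: abs_mult mult_left_mono bnd)
      have s4: "summable (\<lambda>\<mu>. \<bar>b' \<mu> * x N \<nu> \<mu>\<bar>)"
        by (rule summable_comparison_test[OF _ s3]) (use le in auto)
      have "\<bar>\<Sum>\<mu>. b' \<mu> * x N \<nu> \<mu>\<bar> \<le> (\<Sum>\<mu>. \<bar>b' \<mu>\<bar> * h \<nu> \<mu>)"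
        by (rule order.trans[OF summable_rabs[OF s4] suminf_le[OF le s4 s3]])
      then have "\<bar>b \<nu>\<bar> * \<bar>\<Sum>\<mu>. b' \<mu> * x N \<nu> \<mu>\<bar> \<le> \<bar>b \<nu>\<bar> * (\<Sum>\<mu>. \<bar>b' \<mu>\<bar> * h \<nu> \<mu>)"
        by (rule mult_left_mono) simp
      then show ?thesis by (simp add: abs_mult suminf_mult[OF s3, symmetric] mult.assoc)
    qed (simp add: suminf_nonneg)
    then show "\<forall>\<^sub>F (\<nu>, N) in at_top \<times>\<^sub>F sequentially. norm (b \<nu> * (\<Sum>\<mu>. b' \<mu> * x N \<nu> \<mu>)) \<le> (\<Sum>\<mu>. \<bar>b \<nu>\<bar> * \<bar>b' \<mu>\<bar> * h \<nu> \<mu>)"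
      by (intro ev) auto
  qed (use s2 in auto)
qed

section \<open>The estimate from above\<close>

lemma frac_diff12_eq:
  "frac_diff1 \<alpha>1 h1 (frac_diff2 \<alpha>2 h2 f) z
    = (\<Sum>\<nu>. binc \<alpha>1 \<nu> * (\<Sum>\<mu>. binc \<alpha>2 \<mu> * f (z + ((\<alpha>1 - real \<nu>) * h1, (\<alpha>2 - real \<mu>) * h2))))"
  by (cases z) (simp add: frac_diff1_eq frac_diff2_eq shift_series_def)

lemma diff_dirichlet_sums:
  assumes "0 < \<alpha>"
  shows "(\<lambda>\<nu>. binc \<alpha> \<nu> * dirichlet k (x + (\<alpha> - real \<nu>) * h)) sums diff_dirichlet \<alpha> h k x"
proof -
  have "summable (\<lambda>\<nu>. binc \<alpha> \<nu> * dirichlet k (x + (\<alpha> - real \<nu>) * h))"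
    using summable_binc_mult[OF assms, of "\<lambda>\<nu>. dirichlet k (x + (\<alpha> - real \<nu>) * h)" "real k"]
    by (simp add: abs_dirichlet_le_nat)
  then show ?thesis by (simp add: sums_iff diff_dirichlet_def dirichlet_def)
qed

lemma frac_diff_abel_sum:
  assumes \<alpha>: "0 < \<alpha>1" "0 < \<alpha>2"
  shows "frac_diff1 \<alpha>1 h1 (frac_diff2 \<alpha>2 h2 (abel_sum a N)) z
    = (\<Sum>k=1..N. \<Sum>l=1..N. mixed_diff a k l * (diff_dirichlet \<alpha>1 h1 k (fst z) * diff_dirichlet \<alpha>2 h2 l (snd z)))"
proof -
  have inner: "(\<lambda>\<mu>. binc \<alpha>2 \<mu> * abel_sum a N (z + (s, (\<alpha>2 - real \<mu>) * h2))) sums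
      (\<Sum>k=1..N. \<Sum>l=1..N. mixed_diff a k l * (dirichlet k (fst z + s) * diff_dirichlet \<alpha>2 h2 l (snd z)))" for s
  proof -
    have "(\<lambda>\<mu>. \<Sum>k=1..N. \<Sum>l=1..N. mixed_diff a k l * dirichlet k (fst z + s) * (binc \<alpha>2 \<mu> * dirichlet l (snd z + (\<alpha>2 - real \<mu>) * h2))) sums
      (\<Sum>k=1..N. \<Sum>l=1..N. mixed_diff a k l * dirichlet k (fst z + s) * diff_dirichlet \<alpha>2 h2 l (snd z))"
      by (intro sums_sum sums_mult diff_dirichlet_sums \<alpha>)
    then show ?thesis by (simp add: abel_sum_def sum_distrib_left mult_ac)
  qed
  have "(\<lambda>\<nu>. binc \<alpha>1 \<nu> * (\<Sum>k=1..N. \<Sum>l=1..N. mixed_diff a k l * (dirichlet k (fst z + (\<alpha>1 - real \<nu>) * h1) * diff_dirichlet \<alpha>2 h2 l (snd z)))) sums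
      (\<Sum>k=1..N. \<Sum>l=1..N. mixed_diff a k l * (diff_dirichlet \<alpha>1 h1 k (fst z) * diff_dirichlet \<alpha>2 h2 l (snd z)))"
  proof -
    have "(\<lambda>\<nu>. \<Sum>k=1..N. \<Sum>l=1..N. mixed_diff a k l * diff_dirichlet \<alpha>2 h2 l (snd z) * (binc \<alpha>1 \<nu> * dirichlet k (fst z + (\<alpha>1 - real \<nu>) * h1))) sums
      (\<Sum>k=1..N. \<Sum>l=1..N. mixed_diff a k l * diff_dirichlet \<alpha>2 h2 l (snd z) * diff_dirichlet \<alpha>1 h1 k (fst z))"
      by (intro sums_sum sums_mult diff_dirichlet_sums \<alpha>)
    then show ?thesis by (simp add: sum_distrib_left mult_ac)
  qed
  then show ?thesis unfolding frac_diff12_eq by (simp add: sums_unique[OF inner, symmetric] sums_iff)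
qed

text \<open>For each pair of translations the kernels add up to the sum in
  \<open>sum_mixed_diff_le_majorant\<close>, so the bound does not depend on N. The 4 collects the
  factor 2 of \<open>abs_diff_dirichlet_le\<close> from each variable.\<close>

lemma frac_diff_abel_sum_le:
  assumes \<alpha>: "0 < \<alpha>1" "0 < \<alpha>2" and n: "0 < n1" "0 < n2" and h: "\<bar>h1\<bar> \<le> 1 / real n1" "\<bar>h2\<bar> \<le> 1 / real n2"
    and md: "\<And>k l. 1 \<le> k \<Longrightarrow> 1 \<le> l \<Longrightarrow> 0 \<le> mixed_diff a k l"
    and a0: "\<And>k l. 1 \<le> k \<Longrightarrow> 1 \<le> l \<Longrightarrow> 0 \<le> a k l"
    and a1: "\<And>k l. 1 \<le> k \<Longrightarrow> 1 \<le> l \<Longrightarrow> a (Suc k) l \<le> a k l"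
  shows "ennreal \<bar>frac_diff1 \<alpha>1 h1 (frac_diff2 \<alpha>2 h2 (abel_sum a N)) z\<bar>
    \<le> ennreal (4 * ((1 + \<alpha>1) * (1 + \<alpha>2))) * (\<integral>\<^sup>+\<iota>. pair_weight \<alpha>1 \<alpha>2 \<iota>
        * majorant \<alpha>1 \<alpha>2 a n1 n2 (z + (shift_pos \<alpha>1 h1 (fst \<iota>), shift_pos \<alpha>2 h2 (snd \<iota>))) \<partial>count_space UNIV)"
proof -
  define v where "v k l = mixed_diff a k l * (damp \<alpha>1 n1 k * damp \<alpha>2 n2 l)" for k l
  have v0: "0 \<le> v k l" if "1 \<le> k" "1 \<le> l" for k l using md[OF that] by (simp add: v_def damp_bounds)
  have "\<bar>frac_diff1 \<alpha>1 h1 (frac_diff2 \<alpha>2 h2 (abel_sum a N)) z\<bar>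
    \<le> (\<Sum>k=1..N. \<Sum>l=1..N. \<bar>mixed_diff a k l * (diff_dirichlet \<alpha>1 h1 k (fst z) * diff_dirichlet \<alpha>2 h2 l (snd z))\<bar>)"
    unfolding frac_diff_abel_sum[OF \<alpha>] by (intro order.trans[OF sum_abs] sum_mono) auto
  also have "\<dots> \<le> (\<Sum>k=1..N. \<Sum>l=1..N. 4 * (v k l * (peak_sum \<alpha>1 h1 k (fst z) * peak_sum \<alpha>2 h2 l (snd z))))"
  proof (intro sum_mono)
    fix k l assume kl: "k \<in> {1..N}" "l \<in> {1..N}"
    then have kl': "0 < k" "0 < l" "1 \<le> k" "1 \<le> l" by auto
    have "\<bar>diff_dirichlet \<alpha>1 h1 k (fst z) * diff_dirichlet \<alpha>2 h2 l (snd z)\<bar>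
      \<le> (2 * damp \<alpha>1 n1 k * peak_sum \<alpha>1 h1 k (fst z)) * (2 * damp \<alpha>2 n2 l * peak_sum \<alpha>2 h2 l (snd z))"
      unfolding abs_mult
      by (intro mult_mono abs_diff_dirichlet_le \<alpha> n h kl') (use kl' \<alpha> in \<open>auto simp: damp_bounds\<close>)
    then have "mixed_diff a k l * \<bar>diff_dirichlet \<alpha>1 h1 k (fst z) * diff_dirichlet \<alpha>2 h2 l (snd z)\<bar>
      \<le> mixed_diff a k l * ((2 * damp \<alpha>1 n1 k * peak_sum \<alpha>1 h1 k (fst z)) * (2 * damp \<alpha>2 n2 l * peak_sum \<alpha>2 h2 l (snd z)))"
      by (intro mult_left_mono md kl')
    then show "\<bar>mixed_diff a k l * (diff_dirichlet \<alpha>1 h1 k (fst z) * diff_dirichlet \<alpha>2 h2 l (snd z))\<bar>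
      \<le> 4 * (v k l * (peak_sum \<alpha>1 h1 k (fst z) * peak_sum \<alpha>2 h2 l (snd z)))"
      using md[OF kl'(3,4)] by (simp add: abs_mult v_def mult_ac)
  qed
  also have "\<dots> = 4 * (\<Sum>k=1..N. \<Sum>l=1..N. v k l * (peak_sum \<alpha>1 h1 k (fst z) * peak_sum \<alpha>2 h2 l (snd z)))"
    by (simp only: sum_distrib_left)
  finally have "ennreal \<bar>frac_diff1 \<alpha>1 h1 (frac_diff2 \<alpha>2 h2 (abel_sum a N)) z\<bar>
      \<le> ennreal (4 * (\<Sum>k=1..N. \<Sum>l=1..N. v k l * (peak_sum \<alpha>1 h1 k (fst z) * peak_sum \<alpha>2 h2 l (snd z))))"
    by (rule ennreal_leI)
  also have "\<dots> = ennreal 4 * ennreal (\<Sum>k=1..N. \<Sum>l=1..N. v k l * (peak_sum \<alpha>1 h1 k (fst z) * peak_sum \<alpha>2 h2 l (snd z)))"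
    using v0 \<alpha> by (intro ennreal_mult sum_nonneg mult_nonneg_nonneg) auto
  also have "ennreal (\<Sum>k=1..N. \<Sum>l=1..N. v k l * (peak_sum \<alpha>1 h1 k (fst z) * peak_sum \<alpha>2 h2 l (snd z)))
     = (\<Sum>k=1..N. \<Sum>l=1..N. ennreal (v k l) * (ennreal (peak_sum \<alpha>1 h1 k (fst z)) * ennreal (peak_sum \<alpha>2 h2 l (snd z))))"
  proof -
    have nn: "0 \<le> v k l * (peak_sum \<alpha>1 h1 k (fst z) * peak_sum \<alpha>2 h2 l (snd z))" if "k \<in> {1..N}" "l \<in> {1..N}" for k l
      using v0[of k l] that \<alpha> by (intro mult_nonneg_nonneg) auto
    have "ennreal (\<Sum>k=1..N. \<Sum>l=1..N. v k l * (peak_sum \<alpha>1 h1 k (fst z) * peak_sum \<alpha>2 h2 l (snd z)))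
      = (\<Sum>k=1..N. ennreal (\<Sum>l=1..N. v k l * (peak_sum \<alpha>1 h1 k (fst z) * peak_sum \<alpha>2 h2 l (snd z))))"
      by (intro sum_ennreal[symmetric] sum_nonneg nn)
    also have "\<dots> = (\<Sum>k=1..N. \<Sum>l=1..N. ennreal (v k l * (peak_sum \<alpha>1 h1 k (fst z) * peak_sum \<alpha>2 h2 l (snd z))))"
      by (intro sum.cong refl sum_ennreal[symmetric] nn)
    also have "\<dots> = (\<Sum>k=1..N. \<Sum>l=1..N. ennreal (v k l) * (ennreal (peak_sum \<alpha>1 h1 k (fst z)) * ennreal (peak_sum \<alpha>2 h2 l (snd z))))"
      using v0 \<alpha> by (intro sum.cong refl) (simp add: ennreal_mult)
    finally show ?thesis .
  qed
  also have "\<dots> = (\<Sum>k=1..N. \<Sum>l=1..N. \<integral>\<^sup>+\<iota>. ennreal (v k l) * (pair_weight \<alpha>1 \<alpha>2 \<iota> * pair_peak \<alpha>1 \<alpha>2 h1 h2 \<iota> (k, l) z) \<partial>count_space UNIV)"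
  proof (intro sum.cong refl)
    fix k l assume "k \<in> {1..N}" "l \<in> {1..N}"
    then show "ennreal (v k l) * (ennreal (peak_sum \<alpha>1 h1 k (fst z)) * ennreal (peak_sum \<alpha>2 h2 l (snd z)))
      = (\<integral>\<^sup>+\<iota>. ennreal (v k l) * (pair_weight \<alpha>1 \<alpha>2 \<iota> * pair_peak \<alpha>1 \<alpha>2 h1 h2 \<iota> (k, l) z) \<partial>count_space UNIV)"
      using ennreal_peak_sum_mult[OF \<alpha>, of "(k, l)" h1 z h2] by (subst nn_integral_cmult) auto
  qed
  also have "\<dots> = (\<integral>\<^sup>+\<iota>. (\<Sum>k=1..N. \<Sum>l=1..N. ennreal (v k l) * (pair_weight \<alpha>1 \<alpha>2 \<iota> * pair_peak \<alpha>1 \<alpha>2 h1 h2 \<iota> (k, l) z)) \<partial>count_space UNIV)"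
    by (simp add: nn_integral_sum)
  also have "\<dots> \<le> (\<integral>\<^sup>+\<iota>. ennreal ((1 + \<alpha>1) * (1 + \<alpha>2)) * (pair_weight \<alpha>1 \<alpha>2 \<iota>
        * majorant \<alpha>1 \<alpha>2 a n1 n2 (z + (shift_pos \<alpha>1 h1 (fst \<iota>), shift_pos \<alpha>2 h2 (snd \<iota>)))) \<partial>count_space UNIV)"
  proof (intro nn_integral_mono)
    fix \<iota> :: "nat \<times> nat"
    define z' where "z' = z + (shift_pos \<alpha>1 h1 (fst \<iota>), shift_pos \<alpha>2 h2 (snd \<iota>))"
    have "(\<Sum>k=1..N. \<Sum>l=1..N. ennreal (v k l) * (pair_weight \<alpha>1 \<alpha>2 \<iota> * pair_peak \<alpha>1 \<alpha>2 h1 h2 \<iota> (k, l) z))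
      = pair_weight \<alpha>1 \<alpha>2 \<iota> * (\<Sum>k=1..N. \<Sum>l=1..N. ennreal (mixed_diff a k l * (damp \<alpha>1 n1 k * peak k (fst z')) * (damp \<alpha>2 n2 l * peak l (snd z'))))"
      unfolding sum_distrib_left
    proof (intro sum.cong refl)
      fix k l assume kl: "k \<in> {1..N}" "l \<in> {1..N}"
      have "mixed_diff a k l * (damp \<alpha>1 n1 k * peak k (fst z')) * (damp \<alpha>2 n2 l * peak l (snd z')) = v k l * (peak k (fst z') * peak l (snd z'))"
        by (simp add: v_def mult_ac)
      then have "ennreal (mixed_diff a k l * (damp \<alpha>1 n1 k * peak k (fst z')) * (damp \<alpha>2 n2 l * peak l (snd z'))) = ennreal (v k l) * pair_peak \<alpha>1 \<alpha>2 h1 h2 \<iota> (k, l) z"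
      proof (simp only:)
        show "ennreal (v k l * (peak k (fst z') * peak l (snd z'))) = ennreal (v k l) * pair_peak \<alpha>1 \<alpha>2 h1 h2 \<iota> (k, l) z"
          using v0[of k l] kl by (simp add: pair_peak_def z'_def ennreal_mult)
      qed
      then show "ennreal (v k l) * (pair_weight \<alpha>1 \<alpha>2 \<iota> * pair_peak \<alpha>1 \<alpha>2 h1 h2 \<iota> (k, l) z)
        = pair_weight \<alpha>1 \<alpha>2 \<iota> * ennreal (mixed_diff a k l * (damp \<alpha>1 n1 k * peak k (fst z')) * (damp \<alpha>2 n2 l * peak l (snd z')))"
        by (simp add: mult_ac)
    qed
    also have "(\<Sum>k=1..N. \<Sum>l=1..N. ennreal (mixed_diff a k l * (damp \<alpha>1 n1 k * peak k (fst z')) * (damp \<alpha>2 n2 l * peak l (snd z'))))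
      = ennreal (\<Sum>k=1..N. \<Sum>l=1..N. mixed_diff a k l * (damp \<alpha>1 n1 k * peak k (fst z')) * (damp \<alpha>2 n2 l * peak l (snd z')))"
    proof -
      have nn: "0 \<le> mixed_diff a k l * (damp \<alpha>1 n1 k * peak k (fst z')) * (damp \<alpha>2 n2 l * peak l (snd z'))" if "k \<in> {1..N}" "l \<in> {1..N}" for k l
        using md[of k l] that by (auto simp: damp_bounds)
      have "(\<Sum>k=1..N. \<Sum>l=1..N. ennreal (mixed_diff a k l * (damp \<alpha>1 n1 k * peak k (fst z')) * (damp \<alpha>2 n2 l * peak l (snd z'))))
        = (\<Sum>k=1..N. ennreal (\<Sum>l=1..N. mixed_diff a k l * (damp \<alpha>1 n1 k * peak k (fst z')) * (damp \<alpha>2 n2 l * peak l (snd z'))))"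
        by (intro sum.cong refl sum_ennreal nn)
      also have "\<dots> = ennreal (\<Sum>k=1..N. \<Sum>l=1..N. mixed_diff a k l * (damp \<alpha>1 n1 k * peak k (fst z')) * (damp \<alpha>2 n2 l * peak l (snd z')))"
        by (intro sum_ennreal sum_nonneg nn)
      finally show ?thesis .
    qed
    also have "pair_weight \<alpha>1 \<alpha>2 \<iota> * ennreal (\<Sum>k=1..N. \<Sum>l=1..N. mixed_diff a k l * (damp \<alpha>1 n1 k * peak k (fst z')) * (damp \<alpha>2 n2 l * peak l (snd z')))
      \<le> pair_weight \<alpha>1 \<alpha>2 \<iota> * (ennreal ((1 + \<alpha>1) * (1 + \<alpha>2)) * majorant \<alpha>1 \<alpha>2 a n1 n2 z')"
      by (intro mult_left_mono sum_mixed_diff_le_majorant[where a = a, OF \<alpha> a0 a1]) auto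
    finally show "(\<Sum>k=1..N. \<Sum>l=1..N. ennreal (v k l) * (pair_weight \<alpha>1 \<alpha>2 \<iota> * pair_peak \<alpha>1 \<alpha>2 h1 h2 \<iota> (k, l) z))
      \<le> ennreal ((1 + \<alpha>1) * (1 + \<alpha>2)) * (pair_weight \<alpha>1 \<alpha>2 \<iota> * majorant \<alpha>1 \<alpha>2 a n1 n2 (z + (shift_pos \<alpha>1 h1 (fst \<iota>), shift_pos \<alpha>2 h2 (snd \<iota>))))"
      by (simp add: z'_def mult_ac)
  qed
  also have "\<dots> = ennreal ((1 + \<alpha>1) * (1 + \<alpha>2)) * (\<integral>\<^sup>+\<iota>. pair_weight \<alpha>1 \<alpha>2 \<iota>
        * majorant \<alpha>1 \<alpha>2 a n1 n2 (z + (shift_pos \<alpha>1 h1 (fst \<iota>), shift_pos \<alpha>2 h2 (snd \<iota>))) \<partial>count_space UNIV)"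
    by (rule nn_integral_cmult) simp
  finally have fin: "ennreal \<bar>frac_diff1 \<alpha>1 h1 (frac_diff2 \<alpha>2 h2 (abel_sum a N)) z\<bar>
     \<le> ennreal 4 * (ennreal ((1 + \<alpha>1) * (1 + \<alpha>2)) * (\<integral>\<^sup>+\<iota>. pair_weight \<alpha>1 \<alpha>2 \<iota>
        * majorant \<alpha>1 \<alpha>2 a n1 n2 (z + (shift_pos \<alpha>1 h1 (fst \<iota>), shift_pos \<alpha>2 h2 (snd \<iota>))) \<partial>count_space UNIV))"
    by (simp add: mult_left_mono)
  have "ennreal (4 * ((1 + \<alpha>1) * (1 + \<alpha>2))) = ennreal 4 * ennreal ((1 + \<alpha>1) * (1 + \<alpha>2))"
    using \<alpha> by (intro ennreal_mult) auto
  with fin show ?thesis by (simp only: mult.assoc)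
qed

text \<open>The limit passes through two infinite series at every point where all translates
  converge and the binomially weighted sum of translates of the majorant is finite. The L_p bound
  for that sum shows that this is the case almost everywhere.\<close>

lemma frac_diff_abel_sum_tendsto:
  assumes p: "1 < p" and \<alpha>: "0 < \<alpha>1" "0 < \<alpha>2" and f [measurable]: "f \<in> borel_measurable borel" and per: "periodic2 f" and int: "integrable tor f"
    and a: "cosine_coeffs f a" and md: "\<And>k l. 1 \<le> k \<Longrightarrow> 1 \<le> l \<Longrightarrow> 0 \<le> mixed_diff a k l"
    and fin: "coeff_sum p \<alpha>1 \<alpha>2 a 1 1 < top"
  shows "AE z in tor. (\<lambda>N. frac_diff1 \<alpha>1 h1 (frac_diff2 \<alpha>2 h2 (abel_sum a N)) z) \<longlonglongrightarrow> frac_diff1 \<alpha>1 h1 (frac_diff2 \<alpha>2 h2 f) z"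
proof -
  note a0 = cosine_coeffs_monotone(3)[OF int a md] and a1 = cosine_coeffs_monotone(1)[OF int a md]
  let ?M = "majorant \<alpha>1 \<alpha>2 a 1 1"
  define s where "s \<nu> \<mu> = ((\<alpha>1 - real \<nu>) * h1, (\<alpha>2 - real \<mu>) * h2)" for \<nu> \<mu> :: nat
  define c where "c = (1 + \<alpha>1) * (1 + \<alpha>2)"
  have c: "0 \<le> c" using \<alpha> by (simp add: c_def)
  obtain B where B: "0 < B" and MB: "\<And>\<alpha>1 \<alpha>2 a n1 n2 c.
    (\<integral>\<^sup>+z. ennreal_powr (majorant \<alpha>1 \<alpha>2 a n1 n2 (z + c)) p \<partial>tor) \<le> ennreal B * coeff_sum p \<alpha>1 \<alpha>2 a n1 n2"
  proof -
    show ?thesis by (rule nn_integral_majorant_shift[OF p], fact that)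
  qed
  have R: "ennreal B * coeff_sum p \<alpha>1 \<alpha>2 a 1 1 < top" using fin by (simp add: ennreal_mult_less_top)
  have M_fin: "(\<integral>\<^sup>+z. ennreal_powr (?M z) p \<partial>tor) < top"
    using le_less_trans[OF MB[of \<alpha>1 \<alpha>2 a 1 1 0] R] by simp
  have lim: "AE z in tor. \<forall>\<nu> \<mu>. (\<lambda>N. abel_sum a N (z + s \<nu> \<mu>)) \<longlonglongrightarrow> f (z + s \<nu> \<mu>)"
    unfolding AE_all_countable
  proof (intro allI AE_tor_shift[where P = "\<lambda>z. (\<lambda>N. abel_sum a N z) \<longlonglongrightarrow> f z"])
    show "AE z in tor. (\<lambda>N. abel_sum a N z) \<longlonglongrightarrow> f z"
      by (rule abel_sum_tendsto[OF p \<alpha> f int a md M_fin])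
    show "periodic2 (\<lambda>z. (\<lambda>N. abel_sum a N z) \<longlonglongrightarrow> f z)"
      using per periodic2_abel_sum[of a] by (simp add: periodic2_def)
  qed
  have Ms: "AE z in tor. \<forall>\<nu> \<mu>. ?M (z + s \<nu> \<mu>) < top"
    unfolding AE_all_countable
  proof (intro allI AE_tor_shift[where P = "\<lambda>z. ?M z < top"])
    show "AE z in tor. ?M z < top" by (rule enn2real_majorant_integrable(1)[OF p M_fin])
    show "periodic2 (\<lambda>z. ?M z < top)" using periodic2_majorant[of \<alpha>1 \<alpha>2 a 1 1] by (simp add: periodic2_def)
  qed
  define X where "X z = (\<integral>\<^sup>+\<iota>. ennreal \<bar>binc \<alpha>1 (fst \<iota>)\<bar> * ennreal \<bar>binc \<alpha>2 (snd \<iota>)\<bar> * ?M (z + ((\<alpha>1 - real (fst \<iota>)) * h1, (\<alpha>2 - real (snd \<iota>)) * h2)) \<partial>count_space UNIV)" for z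
  have X_eq: "X z = (\<Sum>\<nu>. \<Sum>\<mu>. ennreal \<bar>binc \<alpha>1 \<nu>\<bar> * ennreal \<bar>binc \<alpha>2 \<mu>\<bar> * ?M (z + s \<nu> \<mu>))" for z
    unfolding X_def by (subst nn_integral_fst_count_space[symmetric]) (simp add: nn_integral_count_space_nat s_def)
  have [measurable]: "X \<in> borel_measurable borel" unfolding X_eq by measurable
  have "(\<integral>\<^sup>+z. ennreal_powr (X z) p \<partial>tor) \<le> ennreal_powr (ennreal ((\<Sum>\<nu>. \<bar>binc \<alpha>1 \<nu>\<bar>) * (\<Sum>\<nu>. \<bar>binc \<alpha>2 \<nu>\<bar>))) p * (ennreal B * coeff_sum p \<alpha>1 \<alpha>2 a 1 1)"
    unfolding X_def by (rule nn_integral_weighted_majorant[OF p MB, where ?w1.0 = "\<lambda>\<nu>. \<bar>binc \<alpha>1 \<nu>\<bar>" and ?w2.0 = "\<lambda>\<nu>. \<bar>binc \<alpha>2 \<nu>\<bar>"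
      and ?t1.0 = "\<lambda>\<nu>. (\<alpha>1 - real \<nu>) * h1" and ?t2.0 = "\<lambda>\<nu>. (\<alpha>2 - real \<nu>) * h2"]) (use \<alpha> in \<open>simp_all add: summable_binc\<close>)
  also have "\<dots> < top"
  proof -
    have "ennreal_powr (ennreal w) p < top" for w by (simp add: less_top[symmetric])
    then show ?thesis using R by (simp add: ennreal_mult_less_top)
  qed
  finally have "AE z in tor. ennreal_powr (X z) p \<noteq> top"
    by (intro nn_integral_PInf_AE[unfolded infinity_ennreal_def]) (simp_all add: borel_measurable_tor)
  then have X_fin: "AE z in tor. X z < top" by (simp add: less_top)
  show ?thesis
    using lim Ms X_fin
  proof eventually_elim
    case (elim z)
    define h where "h \<nu> \<mu> = c * enn2real (?M (z + s \<nu> \<mu>))" for \<nu> \<mu>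
    have "(\<lambda>N. \<Sum>\<nu>. binc \<alpha>1 \<nu> * (\<Sum>\<mu>. binc \<alpha>2 \<mu> * abel_sum a N (z + s \<nu> \<mu>))) \<longlonglongrightarrow> (\<Sum>\<nu>. binc \<alpha>1 \<nu> * (\<Sum>\<mu>. binc \<alpha>2 \<mu> * f (z + s \<nu> \<mu>)))"
    proof (rule double_series_tendsto)
      show "(\<lambda>N. abel_sum a N (z + s \<nu> \<mu>)) \<longlonglongrightarrow> f (z + s \<nu> \<mu>)" for \<nu> \<mu> using elim(1) by simp
      show "\<bar>abel_sum a N (z + s \<nu> \<mu>)\<bar> \<le> h \<nu> \<mu>" for N \<nu> \<mu>
        unfolding h_def c_def using elim(2) by (intro abel_sum_bound(1)[where a = a] \<alpha> md a0 a1) auto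
      have "(\<Sum>\<nu>. \<Sum>\<mu>. ennreal (\<bar>binc \<alpha>1 \<nu>\<bar> * \<bar>binc \<alpha>2 \<mu>\<bar> * h \<nu> \<mu>))
        \<le> (\<Sum>\<nu>. \<Sum>\<mu>. ennreal c * (ennreal \<bar>binc \<alpha>1 \<nu>\<bar> * ennreal \<bar>binc \<alpha>2 \<mu>\<bar> * ?M (z + s \<nu> \<mu>)))"
      proof (intro suminf_le summableI)
        fix \<nu> \<mu>
        have "ennreal (enn2real (?M (z + s \<nu> \<mu>))) = ?M (z + s \<nu> \<mu>)" using elim(2) by simp
        then have "ennreal (\<bar>binc \<alpha>1 \<nu>\<bar> * \<bar>binc \<alpha>2 \<mu>\<bar> * h \<nu> \<mu>) = ennreal c * (ennreal \<bar>binc \<alpha>1 \<nu>\<bar> * ennreal \<bar>binc \<alpha>2 \<mu>\<bar> * ?M (z + s \<nu> \<mu>))"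
          using c by (simp add: h_def ennreal_mult mult_ac)
        then show "ennreal (\<bar>binc \<alpha>1 \<nu>\<bar> * \<bar>binc \<alpha>2 \<mu>\<bar> * h \<nu> \<mu>) \<le> ennreal c * (ennreal \<bar>binc \<alpha>1 \<nu>\<bar> * ennreal \<bar>binc \<alpha>2 \<mu>\<bar> * ?M (z + s \<nu> \<mu>))"
          by simp
      qed
      also have "\<dots> = ennreal c * X z" by (simp only: X_eq ennreal_suminf_cmult)
      also have "\<dots> < top" using elim(3) by (simp add: ennreal_mult_less_top)
      finally show "(\<Sum>\<nu>. \<Sum>\<mu>. ennreal (\<bar>binc \<alpha>1 \<nu>\<bar> * \<bar>binc \<alpha>2 \<mu>\<bar> * h \<nu> \<mu>)) \<noteq> top" by simp
    qed
    then show ?case by (simp add: frac_diff12_eq s_def)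
  qed
qed

text \<open>The bound for the partial sums is pointwise and uniform in N, so it survives in the
  limit almost everywhere; the norm is taken only afterwards.\<close>

lemma upper_estimate:
  assumes p: "1 < p" and \<alpha>: "0 < \<alpha>1" "0 < \<alpha>2"
  obtains C where "0 < C" and "\<And>f a n1 n2 h1 h2. \<lbrakk>f \<in> borel_measurable borel; periodic2 f; integrable tor f; cosine_coeffs f a;
     \<And>k l. 1 \<le> k \<Longrightarrow> 1 \<le> l \<Longrightarrow> 0 \<le> mixed_diff a k l; coeff_sum p \<alpha>1 \<alpha>2 a 1 1 < top; 0 < n1; 0 < n2;
     \<bar>h1\<bar> \<le> 1 / real n1; \<bar>h2\<bar> \<le> 1 / real n2\<rbrakk> \<Longrightarrow>
     (\<integral>\<^sup>+z. ennreal_powr (ennreal \<bar>frac_diff1 \<alpha>1 h1 (frac_diff2 \<alpha>2 h2 f) z\<bar>) p \<partial>tor) \<le> ennreal C * coeff_sum p \<alpha>1 \<alpha>2 a n1 n2"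
proof -
  obtain B where B: "0 < B" and MB: "\<And>\<alpha>1 \<alpha>2 a n1 n2 c.
    (\<integral>\<^sup>+z. ennreal_powr (majorant \<alpha>1 \<alpha>2 a n1 n2 (z + c)) p \<partial>tor) \<le> ennreal B * coeff_sum p \<alpha>1 \<alpha>2 a n1 n2"
  proof -
    show ?thesis by (rule nn_integral_majorant_shift[OF p], fact that)
  qed
  define c where "c = 4 * ((1 + \<alpha>1) * (1 + \<alpha>2))"
  have c: "0 \<le> c" using \<alpha> by (simp add: c_def)
  define W where "W = (\<Sum>\<nu>. shift_weight \<alpha>1 \<nu>) * (\<Sum>\<nu>. shift_weight \<alpha>2 \<nu>)"
  have W: "0 \<le> W" using \<alpha> by (simp add: W_def suminf_nonneg summable_shift_weight)
  define C where "C = c powr p * (W powr p * B) + 1"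
  have C: "0 < C" using B by (simp add: C_def add_nonneg_pos)
  show thesis
  proof (rule that[OF C], goal_cases)
    case (1 f a n1 n2 h1 h2)
    note md = 1(5)
    note a0 = cosine_coeffs_monotone(3)[OF 1(3,4) md] and a1 = cosine_coeffs_monotone(1)[OF 1(3,4) md]
    define X where "X z = (\<integral>\<^sup>+\<iota>. pair_weight \<alpha>1 \<alpha>2 \<iota> * majorant \<alpha>1 \<alpha>2 a n1 n2 (z + (shift_pos \<alpha>1 h1 (fst \<iota>), shift_pos \<alpha>2 h2 (snd \<iota>))) \<partial>count_space UNIV)" for z
    have [measurable]: "X \<in> borel_measurable borel"
      unfolding X_def by (subst nn_integral_fst_count_space[symmetric]) (simp add: nn_integral_count_space_nat)
    have pt: "AE z in tor. ennreal \<bar>frac_diff1 \<alpha>1 h1 (frac_diff2 \<alpha>2 h2 f) z\<bar> \<le> ennreal c * X z"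
    proof -
      have "AE z in tor. (\<lambda>N. frac_diff1 \<alpha>1 h1 (frac_diff2 \<alpha>2 h2 (abel_sum a N)) z) \<longlonglongrightarrow> frac_diff1 \<alpha>1 h1 (frac_diff2 \<alpha>2 h2 f) z"
        by (intro frac_diff_abel_sum_tendsto[OF p \<alpha> 1(1-4) _ 1(6)] md)
      then show ?thesis
      proof eventually_elim
        case (elim z)
        have le: "ennreal \<bar>frac_diff1 \<alpha>1 h1 (frac_diff2 \<alpha>2 h2 (abel_sum a N)) z\<bar> \<le> ennreal c * X z" for N
          unfolding c_def X_def by (rule frac_diff_abel_sum_le[where a = a, OF \<alpha> 1(7-10) md a0 a1]) auto
        show ?case
        proof (cases "ennreal c * X z")
          case (real r)
          then have "\<bar>frac_diff1 \<alpha>1 h1 (frac_diff2 \<alpha>2 h2 (abel_sum a N)) z\<bar> \<le> r" for N using le[of N] by simp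
          then have "\<bar>frac_diff1 \<alpha>1 h1 (frac_diff2 \<alpha>2 h2 f) z\<bar> \<le> r"
            using tendsto_rabs[OF elim] by (intro LIMSEQ_le_const2) auto
          with real show ?thesis by (simp add: ennreal_leI)
        qed simp
      qed
    qed
    have "(\<integral>\<^sup>+z. ennreal_powr (ennreal \<bar>frac_diff1 \<alpha>1 h1 (frac_diff2 \<alpha>2 h2 f) z\<bar>) p \<partial>tor) \<le> (\<integral>\<^sup>+z. ennreal_powr (ennreal c * X z) p \<partial>tor)"
      using p by (intro nn_integral_mono_AE, use pt in eventually_elim) (simp add: ennreal_powr_mono)
    also have "\<dots> = ennreal (c powr p) * (\<integral>\<^sup>+z. ennreal_powr (X z) p \<partial>tor)"
      using p c by (simp add: ennreal_powr_mult ennreal_powr_ennreal nn_integral_cmult borel_measurable_tor)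
    also have "(\<integral>\<^sup>+z. ennreal_powr (X z) p \<partial>tor) \<le> ennreal_powr (ennreal W) p * (ennreal B * coeff_sum p \<alpha>1 \<alpha>2 a n1 n2)"
      unfolding X_def pair_weight_def W_def
      by (rule nn_integral_weighted_majorant[OF p MB, where ?t1.0 = "shift_pos \<alpha>1 h1" and ?t2.0 = "shift_pos \<alpha>2 h2"])
         (use \<alpha> in \<open>simp_all add: summable_shift_weight\<close>)
    also have "ennreal (c powr p) * (ennreal_powr (ennreal W) p * (ennreal B * coeff_sum p \<alpha>1 \<alpha>2 a n1 n2))
       = ennreal (c powr p * (W powr p * B)) * coeff_sum p \<alpha>1 \<alpha>2 a n1 n2"
      using W B by (simp add: ennreal_powr_ennreal ennreal_mult mult_ac)
    also have "\<dots> \<le> ennreal C * coeff_sum p \<alpha>1 \<alpha>2 a n1 n2"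
      by (intro mult_right_mono ennreal_leI) (auto simp: C_def)
    finally show ?case by (simp add: mult_left_mono)
  qed
qed

section \<open>The coefficient sums and the theorem\<close>

lemma infsum_ennreal_nat:
  fixes f :: "nat \<Rightarrow> ennreal"
  shows "infsum f A = (\<Sum>k. f k * indicator A k)"
proof -
  have "infsum f A = infsum (\<lambda>k. f k * indicator A k) UNIV"
    by (rule infsum_cong_neutral) (auto simp: indicator_def)
  moreover have "((\<lambda>k. f k * indicator A k) has_sum infsum (\<lambda>k. f k * indicator A k) UNIV) UNIV"
    by (intro has_sum_infsum nonneg_summable_on_complete) simp
  then have "(\<lambda>k. f k * indicator A k) sums infsum (\<lambda>k. f k * indicator A k) UNIV"
    by (rule has_sum_imp_sums)
  ultimately show ?thesis by (simp add: sums_iff)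
qed

text \<open>Normalise the sum to 1 and use t \<le> t powr r on [0, 1].\<close>

lemma ennreal_powr_add_le:
  assumes r: "0 < r" "r \<le> 1" shows "ennreal_powr (x + y) r \<le> ennreal_powr x r + ennreal_powr y r"
proof (cases x)
  case x: (real a)
  show ?thesis
  proof (cases y)
    case y: (real b)
    have "(a + b) powr r \<le> a powr r + b powr r"
    proof (cases "a + b = 0")
      case False
      define s where "s = a + b"
      have s: "0 < s" using False x y by (simp add: s_def add_nonneg_eq_0_iff less_le)
      have le: "t \<le> t powr r" if "0 \<le> t" "t \<le> 1" for t :: real
        using powr_mono'[OF r(2) that] that by simp
      have "1 = a / s + b / s" using s by (simp add: s_def flip: add_divide_distrib)
      also have "\<dots> \<le> (a / s) powr r + (b / s) powr r"
        using s x y by (intro add_mono le) (auto simp: s_def)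
      also have "\<dots> = (a powr r + b powr r) / s powr r" by (simp add: powr_divide add_divide_distrib)
      finally have "1 \<le> (a powr r + b powr r) / s powr r" .
      then show ?thesis using s by (simp add: s_def field_simps)
    qed (use x y in simp)
    then show ?thesis using x y by (simp add: ennreal_powr_ennreal flip: ennreal_plus)
  qed (use x in simp)
qed simp

section \<open>The four blocks of the coefficient sum\<close>

definition coeff_term :: "real \<Rightarrow> real \<Rightarrow> real \<Rightarrow> (nat \<Rightarrow> nat \<Rightarrow> real) \<Rightarrow> nat \<Rightarrow> nat \<Rightarrow> nat \<Rightarrow> nat \<Rightarrow> ennreal" where
  "coeff_term p \<alpha>1 \<alpha>2 a n1 n2 k l = ennreal (1 / (real k)\<^sup>2 * (1 / (real l)\<^sup>2 *
     (real k * real l * a k l * (damp \<alpha>1 n1 k * damp \<alpha>2 n2 l)) powr p))"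

definition coeff_block :: "real \<Rightarrow> real \<Rightarrow> real \<Rightarrow> (nat \<Rightarrow> nat \<Rightarrow> real) \<Rightarrow> nat \<Rightarrow> nat \<Rightarrow> nat set \<Rightarrow> nat set \<Rightarrow> ennreal" where
  "coeff_block p \<alpha>1 \<alpha>2 a n1 n2 A B = (\<Sum>k. (\<Sum>l. coeff_term p \<alpha>1 \<alpha>2 a n1 n2 k l * indicator B l) * indicator A k)"

lemma coeff_term_0: "coeff_term p \<alpha>1 \<alpha>2 a n1 n2 0 l = 0" "coeff_term p \<alpha>1 \<alpha>2 a n1 n2 k 0 = 0"
  by (simp_all add: coeff_term_def)

lemma coeff_sum_eq:
  assumes "\<And>k l. 1 \<le> k \<Longrightarrow> 1 \<le> l \<Longrightarrow> 0 \<le> a k l"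
  shows "coeff_sum p \<alpha>1 \<alpha>2 a n1 n2 = (\<Sum>k. \<Sum>l. coeff_term p \<alpha>1 \<alpha>2 a n1 n2 k l)"
proof -
  have "ennreal (1 / (real k)\<^sup>2) * (ennreal (1 / (real l)\<^sup>2) * ennreal_powr (ennreal (real k * real l * a k l * (damp \<alpha>1 n1 k * damp \<alpha>2 n2 l))) p)
    = coeff_term p \<alpha>1 \<alpha>2 a n1 n2 k l" for k l
  proof (cases "k = 0 \<or> l = 0")
    case False
    then have "0 \<le> real k * real l * a k l * (damp \<alpha>1 n1 k * damp \<alpha>2 n2 l)"
      using assms[of k l] by (auto simp: damp_bounds)
    moreover have "ennreal A * (ennreal B * ennreal D) = ennreal (A * (B * D))" if "0 \<le> A" "0 \<le> B" "0 \<le> D" for A B D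
      using that by (simp add: ennreal_mult)
    ultimately show ?thesis by (simp only: coeff_term_def ennreal_powr_ennreal zero_le_divide_1_iff zero_le_power2 powr_ge_zero)
  qed (auto simp: coeff_term_def)
  then show ?thesis unfolding coeff_sum_def nn_integral_wnat2 by (simp flip: ennreal_suminf_cmult)
qed

lemma coeff_block_UNIV:
  "(\<Sum>k. \<Sum>l. coeff_term p \<alpha>1 \<alpha>2 a n1 n2 k l)
    = coeff_block p \<alpha>1 \<alpha>2 a n1 n2 {1..n1} {1..n2} + coeff_block p \<alpha>1 \<alpha>2 a n1 n2 {1..n1} {n2+1..}
      + coeff_block p \<alpha>1 \<alpha>2 a n1 n2 {n1+1..} {1..n2} + coeff_block p \<alpha>1 \<alpha>2 a n1 n2 {n1+1..} {n2+1..}"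
proof -
  let ?u = "coeff_term p \<alpha>1 \<alpha>2 a n1 n2"
  have split: "(\<Sum>k. f k) = (\<Sum>k. f k * indicator {1..n} k) + (\<Sum>k. f k * indicator {n+1..} k)"
    if "f 0 = 0" for f :: "nat \<Rightarrow> ennreal" and n
  proof -
    have "f k = f k * indicator {1..n} k + f k * indicator {n+1..} k" for k
      using that by (cases "k = 0") (auto simp: indicator_def)
    then have "(\<Sum>k. f k) = (\<Sum>k. f k * indicator {1..n} k + f k * indicator {n+1..} k)" by presburger
    then show ?thesis by (simp add: suminf_add summableI)
  qed
  have l: "(\<Sum>l. ?u k l) = (\<Sum>l. ?u k l * indicator {1..n2} l) + (\<Sum>l. ?u k l * indicator {n2+1..} l)" for k
    by (rule split) (rule coeff_term_0)
  have k: "(\<Sum>k. \<Sum>l. ?u k l * indicator B l) = coeff_block p \<alpha>1 \<alpha>2 a n1 n2 {1..n1} B + coeff_block p \<alpha>1 \<alpha>2 a n1 n2 {n1+1..} B" for B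
    unfolding coeff_block_def by (rule split) (simp add: coeff_term_0)
  show ?thesis unfolding l by (simp add: suminf_add[symmetric] summableI k add_ac)
qed

text \<open>The factor in front of the root moves inside as c powr p, where it completes the damping
  in the terms.\<close>

lemma coeff_block_powr:
  assumes p: "1 < p" and c: "0 \<le> c"
    and v: "\<And>k l. k \<in> A \<Longrightarrow> l \<in> B \<Longrightarrow> ennreal (c powr p) * v k l = coeff_term p \<alpha>1 \<alpha>2 a n1 n2 k l"
  shows "ennreal c * ennreal_powr (\<Sum>\<^sub>\<infinity>k\<in>A. \<Sum>\<^sub>\<infinity>l\<in>B. v k l) (1 / p) = ennreal_powr (coeff_block p \<alpha>1 \<alpha>2 a n1 n2 A B) (1 / p)"
proof -
  have "ennreal (c powr p) * (\<Sum>\<^sub>\<infinity>k\<in>A. \<Sum>\<^sub>\<infinity>l\<in>B. v k l)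
    = (\<Sum>k. (\<Sum>l. (ennreal (c powr p) * v k l) * indicator B l) * indicator A k)"
    by (simp add: infsum_ennreal_nat mult.assoc)
  also have "\<dots> = coeff_block p \<alpha>1 \<alpha>2 a n1 n2 A B"
    unfolding coeff_block_def
  proof (intro suminf_cong)
    fix k
    show "(\<Sum>l. (ennreal (c powr p) * v k l) * indicator B l) * indicator A k = (\<Sum>l. coeff_term p \<alpha>1 \<alpha>2 a n1 n2 k l * indicator B l) * indicator A k"
    proof (cases "k \<in> A")
      case True
      then have "(ennreal (c powr p) * v k l) * indicator B l = coeff_term p \<alpha>1 \<alpha>2 a n1 n2 k l * indicator B l" for l
        using v by (cases "l \<in> B") auto
      then show ?thesis by simp
    qed simp
  qed
  finally have "coeff_block p \<alpha>1 \<alpha>2 a n1 n2 A B = ennreal (c powr p) * (\<Sum>\<^sub>\<infinity>k\<in>A. \<Sum>\<^sub>\<infinity>l\<in>B. v k l)" ..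
  then have "ennreal_powr (coeff_block p \<alpha>1 \<alpha>2 a n1 n2 A B) (1 / p) = ennreal_powr (ennreal (c powr p)) (1 / p) * ennreal_powr (\<Sum>\<^sub>\<infinity>k\<in>A. \<Sum>\<^sub>\<infinity>l\<in>B. v k l) (1 / p)"
    using p by (simp add: ennreal_powr_mult)
  also have "ennreal_powr (ennreal (c powr p)) (1 / p) = ennreal c"
    using p c by (simp add: ennreal_powr_ennreal powr_powr)
  finally show ?thesis ..
qed

text \<open>Source of the exponent (\<alpha> + 1) p - 2: p comes from the factor k, \<alpha> p from
  the damping, - 2 from the weight of \<open>wnat\<close>. The power of 1 / n becomes the factor in
  front of the root.\<close>

lemma damp_powr_low:
  assumes "1 \<le> k" "k \<le> n" shows "(real k * damp \<alpha> n k) powr p / (real k)\<^sup>2 = (1 / real n powr \<alpha>) powr p * real k powr ((\<alpha> + 1) * p - 2)"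
proof -
  have "damp \<alpha> n k = (real k / real n) powr \<alpha>" using assms by (simp add: damp_def min_absorb2)
  then have "(real k * damp \<alpha> n k) powr p = real k powr p * (real k powr (\<alpha> * p) / real n powr (\<alpha> * p))"
    by (simp add: powr_mult powr_divide powr_powr)
  moreover have "real k powr ((\<alpha> + 1) * p - 2) = real k powr p * real k powr (\<alpha> * p) / (real k)\<^sup>2"
    using assms by (simp add: powr_diff powr_add distrib_right)
  ultimately show ?thesis by (simp add: powr_divide powr_powr)
qed

lemma damp_powr_high:
  assumes "1 \<le> n" "n + 1 \<le> k" shows "(real k * damp \<alpha> n k) powr p / (real k)\<^sup>2 = real k powr (p - 2)"
proof -
  have "damp \<alpha> n k = 1" using assms by (simp add: damp_def min_absorb1)
  then show ?thesis using assms by (simp add: powr_diff)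
qed

lemma coeff_term_eq:
  "0 \<le> a k l \<Longrightarrow> coeff_term p \<alpha>1 \<alpha>2 a n1 n2 k l
    = ennreal (a k l powr p * ((real k * damp \<alpha>1 n1 k) powr p / (real k)\<^sup>2) * ((real l * damp \<alpha>2 n2 l) powr p / (real l)\<^sup>2))"
  by (simp add: coeff_term_def powr_mult damp_bounds mult_ac)

lemma coeff_bound_eq:
  assumes p: "1 < p" and n: "1 \<le> n1" "1 \<le> n2" and a0: "\<And>k l. 1 \<le> k \<Longrightarrow> 1 \<le> l \<Longrightarrow> 0 \<le> a k l"
  shows "coeff_bound p \<alpha>1 \<alpha>2 a n1 n2 = ennreal_powr (coeff_block p \<alpha>1 \<alpha>2 a n1 n2 {1..n1} {1..n2}) (1 / p)
    + ennreal_powr (coeff_block p \<alpha>1 \<alpha>2 a n1 n2 {1..n1} {n2+1..}) (1 / p)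
    + ennreal_powr (coeff_block p \<alpha>1 \<alpha>2 a n1 n2 {n1+1..} {1..n2}) (1 / p)
    + ennreal_powr (coeff_block p \<alpha>1 \<alpha>2 a n1 n2 {n1+1..} {n2+1..}) (1 / p)"
proof -
  have e: "ennreal x * ennreal y = ennreal z" if "0 \<le> x" "x * y = z" for x y z :: real
    using that(1) by (simp add: that(2)[symmetric] ennreal_mult')
  have cp: "(1 / (A * B)) powr p = (1 / A) powr p * (1 / B) powr p" for A B :: real
    by (simp add: powr_divide powr_mult)
  note blk = coeff_block_powr[OF p]
  have 1: "ennreal (1 / (real n1 powr \<alpha>1 * real n2 powr \<alpha>2)) * ennreal_powr (\<Sum>\<^sub>\<infinity>i\<in>{1..n1}. \<Sum>\<^sub>\<infinity>j\<in>{1..n2}.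
         ennreal (a i j powr p * real i powr ((\<alpha>1 + 1) * p - 2) * real j powr ((\<alpha>2 + 1) * p - 2))) (1 / p)
      = ennreal_powr (coeff_block p \<alpha>1 \<alpha>2 a n1 n2 {1..n1} {1..n2}) (1 / p)"
    by (rule blk) (use a0 in \<open>auto simp: coeff_term_eq damp_powr_low cp mult_ac intro!: e\<close>)
  have 2: "ennreal (1 / real n1 powr \<alpha>1) * ennreal_powr (\<Sum>\<^sub>\<infinity>i\<in>{1..n1}. \<Sum>\<^sub>\<infinity>j\<in>{n2+1..}.
         ennreal (a i j powr p * real i powr ((\<alpha>1 + 1) * p - 2) * real j powr (p - 2))) (1 / p)
      = ennreal_powr (coeff_block p \<alpha>1 \<alpha>2 a n1 n2 {1..n1} {n2+1..}) (1 / p)"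
    by (rule blk) (use a0 n in \<open>auto simp: coeff_term_eq damp_powr_low damp_powr_high mult_ac intro!: e\<close>)
  have 3: "ennreal (1 / real n2 powr \<alpha>2) * ennreal_powr (\<Sum>\<^sub>\<infinity>i\<in>{n1+1..}. \<Sum>\<^sub>\<infinity>j\<in>{1..n2}.
         ennreal (a i j powr p * real i powr (p - 2) * real j powr ((\<alpha>2 + 1) * p - 2))) (1 / p)
      = ennreal_powr (coeff_block p \<alpha>1 \<alpha>2 a n1 n2 {n1+1..} {1..n2}) (1 / p)"
    by (rule blk) (use a0 n in \<open>auto simp: coeff_term_eq damp_powr_low damp_powr_high mult_ac intro!: e\<close>)
  have 4: "ennreal 1 * ennreal_powr (\<Sum>\<^sub>\<infinity>i\<in>{n1+1..}. \<Sum>\<^sub>\<infinity>j\<in>{n2+1..}.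
         ennreal (a i j powr p * (real i * real j) powr (p - 2))) (1 / p)
      = ennreal_powr (coeff_block p \<alpha>1 \<alpha>2 a n1 n2 {n1+1..} {n2+1..}) (1 / p)"
    by (rule blk) (use a0 n in \<open>auto simp: coeff_term_eq damp_powr_high powr_mult[of "real _" "real _"] mult_ac\<close>)
  show ?thesis
    unfolding coeff_bound_def 1[symmetric] 2[symmetric] 3[symmetric] 4[symmetric] by (simp add: infsum_finite)
qed

text \<open>The root of each block is at most the root of the total, which gives the 4; conversely
  the root is subadditive because 1 / p \<le> 1.\<close>

lemma coeff_bound_bounds:
  assumes p: "1 < p" and n: "1 \<le> n1" "1 \<le> n2" and a0: "\<And>k l. 1 \<le> k \<Longrightarrow> 1 \<le> l \<Longrightarrow> 0 \<le> a k l"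
  shows "coeff_bound p \<alpha>1 \<alpha>2 a n1 n2 \<le> 4 * ennreal_powr (coeff_sum p \<alpha>1 \<alpha>2 a n1 n2) (1 / p)"
    and "ennreal_powr (coeff_sum p \<alpha>1 \<alpha>2 a n1 n2) (1 / p) \<le> coeff_bound p \<alpha>1 \<alpha>2 a n1 n2"
proof -
  let ?b = "coeff_block p \<alpha>1 \<alpha>2 a n1 n2"
  have sum: "coeff_sum p \<alpha>1 \<alpha>2 a n1 n2 = ?b {1..n1} {1..n2} + ?b {1..n1} {n2+1..} + ?b {n1+1..} {1..n2} + ?b {n1+1..} {n2+1..}"
    by (rule trans[OF coeff_sum_eq[where a = a, OF a0] coeff_block_UNIV])
  have bound: "coeff_bound p \<alpha>1 \<alpha>2 a n1 n2 = ennreal_powr (?b {1..n1} {1..n2}) (1 / p) + ennreal_powr (?b {1..n1} {n2+1..}) (1 / p)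
      + ennreal_powr (?b {n1+1..} {1..n2}) (1 / p) + ennreal_powr (?b {n1+1..} {n2+1..}) (1 / p)"
    by (rule coeff_bound_eq[OF p n a0])
  have r: "0 < 1 / p" "1 / p \<le> 1" using p by auto
  have le: "ennreal_powr x (1 / p) \<le> ennreal_powr (coeff_sum p \<alpha>1 \<alpha>2 a n1 n2) (1 / p)" if "x \<le> coeff_sum p \<alpha>1 \<alpha>2 a n1 n2" for x
    by (rule ennreal_powr_mono[OF r(1) that])
  have four: "4 * x = x + x + x + x" for x :: ennreal
  proof -
    have "(4 :: ennreal) = 1 + 1 + 1 + 1" by simp
    then show ?thesis by (simp only: distrib_right mult_1)
  qed
  show "coeff_bound p \<alpha>1 \<alpha>2 a n1 n2 \<le> 4 * ennreal_powr (coeff_sum p \<alpha>1 \<alpha>2 a n1 n2) (1 / p)"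
    unfolding bound four
    by (intro add_mono le; unfold sum; simp add: add_increasing add_increasing2)
  show "ennreal_powr (coeff_sum p \<alpha>1 \<alpha>2 a n1 n2) (1 / p) \<le> coeff_bound p \<alpha>1 \<alpha>2 a n1 n2"
    unfolding bound sum
    by (intro order.trans[OF ennreal_powr_add_le[OF r]] add_mono order.refl)
qed

section \<open>Borel representatives of Lebesgue measurable functions\<close>

lemma Lp_norm_eq:
  assumes g [measurable]: "g \<in> borel_measurable borel" and ae: "AE z in lborel. f z = g z"
  shows "Lp_norm p f = ennreal_powr (\<integral>\<^sup>+z. ennreal_powr (ennreal \<bar>g z\<bar>) p \<partial>tor) (1 / p)"
proof -
  have "(\<integral>\<^sup>+z\<in>torus. ennreal (\<bar>f z\<bar> powr p) \<partial>lebesgue) = (\<integral>\<^sup>+z. ennreal (\<bar>g z\<bar> powr p) * indicator torus z \<partial>lebesgue)"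
    by (rule nn_integral_cong_AE, use AE_completion[OF ae] in eventually_elim) simp
  also have "\<dots> = (\<integral>\<^sup>+z. indicator torus z * ennreal (\<bar>g z\<bar> powr p) \<partial>lborel)"
    by (simp add: nn_integral_completion mult.commute)
  also have "\<dots> = (\<integral>\<^sup>+z. ennreal (\<bar>g z\<bar> powr p) \<partial>tor)"
    unfolding tor_eq_density by (rule nn_integral_density[symmetric]) simp_all
  also have "\<dots> = (\<integral>\<^sup>+z. ennreal_powr (ennreal \<bar>g z\<bar>) p \<partial>tor)"
    by (simp add: ennreal_powr_ennreal)
  finally show ?thesis by (simp add: Lp_norm_def)
qed

lemma set_integral_torus_eq:
  fixes f g :: "real \<times> real \<Rightarrow> real"
  assumes g [measurable]: "g \<in> borel_measurable borel" and f [measurable]: "f \<in> borel_measurable lebesgue" and ae: "AE z in lborel. f z = g z"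
  shows "(LINT z:torus|lebesgue. f z) = (\<integral>z. g z \<partial>tor)"
proof -
  have gl [measurable]: "g \<in> borel_measurable lebesgue" by (rule measurable_completion) simp
  have t: "torus \<in> sets lebesgue" using torus_borel by (rule sets_completionI_sets[of _ lborel, simplified])
  have "(LINT z:torus|lebesgue. f z) = (\<integral>z. indicator torus z * g z \<partial>lebesgue)"
    unfolding set_lebesgue_integral_def
  proof (rule integral_cong_AE)
    have ind: "(\<lambda>z. indicator torus z :: real) \<in> borel_measurable lebesgue" by (rule borel_measurable_indicator[OF t])
    show "(\<lambda>z. indicator torus z *\<^sub>R f z) \<in> borel_measurable lebesgue" by (intro borel_measurable_scaleR ind f)
    show "(\<lambda>z. indicator torus z * g z) \<in> borel_measurable lebesgue" by (intro borel_measurable_times ind gl)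
    show "AE z in lebesgue. indicator torus z *\<^sub>R f z = indicator torus z * g z"
      using AE_completion[OF ae] by eventually_elim simp
  qed
  also have "\<dots> = (\<integral>z. indicator torus z *\<^sub>R g z \<partial>lborel)"
    by (subst integral_completion) simp_all
  also have "\<dots> = (\<integral>z. g z \<partial>density lborel (\<lambda>z. ennreal (indicator torus z)))"
    by (rule integral_density[symmetric]) simp_all
  also have "(\<lambda>z. ennreal (indicator torus z)) = (indicator torus :: real \<times> real \<Rightarrow> ennreal)"
    by (auto simp: fun_eq_iff indicator_def)
  finally show ?thesis by (simp only: tor_eq_density)
qed

text \<open>The estimates are proved for Borel functions, while \<open>f\<close> is only Lebesgue
  measurable. A Borel version is taken on one period and extended by \<open>wrap\<close>, which
  restores exact periodicity.\<close>

lemma Lp_borel_representative: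
  assumes p: "1 < p" and f: "f \<in> Lp p"
  obtains g where "g \<in> borel_measurable borel" "periodic2 g" "AE z in lborel. f z = g z" "integrable tor g"
    "(\<integral>\<^sup>+z. ennreal_powr (ennreal \<bar>g z\<bar>) p \<partial>tor) < top"
proof -
  have fm: "f \<in> borel_measurable lebesgue" and per: "periodic2 f" and fin: "Lp_norm p f < top"
    using f by (auto simp: Lp_def periodic2_def)
  obtain f0 where f0 [measurable]: "f0 \<in> borel_measurable lborel" and ae0: "AE z in lborel. f z = f0 z"
    using completion_ex_borel_measurable_real[OF fm] by auto
  define g where "g z = f0 (wrap (fst z), wrap (snd z))" for z
  have g [measurable]: "g \<in> borel_measurable borel" unfolding g_def using f0 by simp
  have per_g: "periodic2 g" by (simp add: periodic2_def g_def wrap_periodic)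
  have ae: "AE z in lborel. f z = g z"
    using AE_lborel_wrap[OF AE_tor_of_lborel[OF ae0]]
  proof eventually_elim
    case (elim z)
    then show ?case using periodic2_wrap[OF per, of "fst z" "snd z"] by (simp add: g_def)
  qed
  have "ennreal_powr (\<integral>\<^sup>+z. ennreal_powr (ennreal \<bar>g z\<bar>) p \<partial>tor) (1 / p) < top"
    using fin by (simp add: Lp_norm_eq[OF g ae])
  then have fin_g: "(\<integral>\<^sup>+z. ennreal_powr (ennreal \<bar>g z\<bar>) p \<partial>tor) < top" by (simp add: less_top[symmetric])
  have "(\<integral>\<^sup>+z. ennreal (norm (g z)) \<partial>tor) \<le> (\<integral>\<^sup>+z. 1 + ennreal_powr (ennreal \<bar>g z\<bar>) p \<partial>tor)"
    using le_one_plus_ennreal_powr[OF p] by (intro nn_integral_mono) simp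
  also have "\<dots> = (\<integral>\<^sup>+z. 1 \<partial>tor) + (\<integral>\<^sup>+z. ennreal_powr (ennreal \<bar>g z\<bar>) p \<partial>tor)"
    by (rule nn_integral_add) (simp_all add: borel_measurable_tor)
  also have "\<dots> < \<infinity>" using fin_g emeasure_tor by (simp add: space_pair_measure)
  finally have "integrable tor g" by (intro integrableI_bounded) (simp_all add: borel_measurable_tor)
  from that[OF g per_g ae this fin_g] show thesis .
qed

lemma cosine_coeffs_of_Fourier_series:
  assumes f: "f \<in> borel_measurable lebesgue" and g [measurable]: "g \<in> borel_measurable borel" and ae: "AE z in lborel. f z = g z"
    and a: "has_cosine_Fourier_series f a"
  shows "cosine_coeffs g a"
proof -
  have eq: "(LINT z:torus|lebesgue. f z * u (real i * fst z) * v (real j * snd z)) = (\<integral>z. g z * u (real i * fst z) * v (real j * snd z) \<partial>tor)"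
    if [measurable]: "u \<in> borel_measurable borel" "v \<in> borel_measurable borel" for u v :: "real \<Rightarrow> real" and i j :: nat
  proof (rule set_integral_torus_eq)
    have "(\<lambda>z :: real \<times> real. u (real i * fst z)) \<in> borel_measurable lborel" "(\<lambda>z :: real \<times> real. v (real j * snd z)) \<in> borel_measurable lborel"
      by measurable
    from this[THEN measurable_completion]
    have uv: "(\<lambda>z :: real \<times> real. u (real i * fst z)) \<in> borel_measurable lebesgue" "(\<lambda>z :: real \<times> real. v (real j * snd z)) \<in> borel_measurable lebesgue" .
    show "(\<lambda>z. f z * u (real i * fst z) * v (real j * snd z)) \<in> borel_measurable lebesgue"
      by (intro borel_measurable_times f uv)
    show "AE z in lborel. f z * u (real i * fst z) * v (real j * snd z) = g z * u (real i * fst z) * v (real j * snd z)"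
      using ae by eventually_elim simp
  qed simp
  have F: "(if i = 0 then 1 / 2 else 1) * (if j = 0 then 1 / 2 else 1) / pi\<^sup>2 * (\<integral>z. g z * u (real i * fst z) * v (real j * snd z) \<partial>tor) = Fourier_coeff u v f i j"
    if "u \<in> borel_measurable borel" "v \<in> borel_measurable borel" for u v :: "real \<Rightarrow> real" and i j :: nat
    unfolding Fourier_coeff_def eq[OF that] ..
  have m: "(cos :: real \<Rightarrow> real) \<in> borel_measurable borel" "(sin :: real \<Rightarrow> real) \<in> borel_measurable borel" by auto
  show ?thesis
    unfolding cosine_coeffs_def
  proof (intro allI conjI)
    fix i j :: nat
    show "(\<integral>z. g z * cos (real i * fst z) * cos (real j * snd z) \<partial>tor) = (if i \<ge> 1 \<and> j \<ge> 1 then pi\<^sup>2 * a i j else 0)"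
      using F[OF m(1,1), of i j] a by (auto simp: has_cosine_Fourier_series_def field_simps split: if_splits)
    show "(\<integral>z. g z * cos (real i * fst z) * sin (real j * snd z) \<partial>tor) = 0"
      using F[OF m(1,2), of i j] a by (auto simp: has_cosine_Fourier_series_def split: if_splits)
    show "(\<integral>z. g z * sin (real i * fst z) * cos (real j * snd z) \<partial>tor) = 0"
      using F[OF m(2,1), of i j] a by (auto simp: has_cosine_Fourier_series_def split: if_splits)
    show "(\<integral>z. g z * sin (real i * fst z) * sin (real j * snd z) \<partial>tor) = 0"
      using F[OF m(2,2), of i j] a by (auto simp: has_cosine_Fourier_series_def split: if_splits)
  qed
qed

text \<open>Almost everywhere all of the countably many translates agree, and there both iterated
  series have identical terms, whether or not they converge.\<close>

lemma Lp_norm_frac_diff: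
  assumes g [measurable]: "g \<in> borel_measurable borel" and ae: "AE z in lborel. f z = g z"
  shows "Lp_norm p (frac_diff1 \<alpha>1 h1 (frac_diff2 \<alpha>2 h2 f))
    = ennreal_powr (\<integral>\<^sup>+z. ennreal_powr (ennreal \<bar>frac_diff1 \<alpha>1 h1 (frac_diff2 \<alpha>2 h2 g) z\<bar>) p \<partial>tor) (1 / p)"
proof (rule Lp_norm_eq)
  show "frac_diff1 \<alpha>1 h1 (frac_diff2 \<alpha>2 h2 g) \<in> borel_measurable borel"
    unfolding frac_diff1_eq frac_diff2_eq by measurable
  have "AE z in lborel. \<forall>\<nu> \<mu>. f (z + ((\<alpha>1 - real \<nu>) * h1, (\<alpha>2 - real \<mu>) * h2)) = g (z + ((\<alpha>1 - real \<nu>) * h1, (\<alpha>2 - real \<mu>) * h2))"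
    unfolding AE_all_countable by (intro allI AE_lborel_shift[OF ae])
  then show "AE z in lborel. frac_diff1 \<alpha>1 h1 (frac_diff2 \<alpha>2 h2 f) z = frac_diff1 \<alpha>1 h1 (frac_diff2 \<alpha>2 h2 g) z"
    by eventually_elim (simp add: frac_diff12_eq)
qed

text \<open>Breaks an apparent circle: with \<open>lower_estimate\<close> at n1 = n2 = 1 it makes
  the coefficient sum finite, as \<open>upper_estimate\<close> requires.\<close>

lemma frac_diff_powr_finite:
  assumes \<alpha>: "0 < \<alpha>1" "0 < \<alpha>2" and p: "1 < p" and g: "g \<in> borel_measurable borel" "periodic2 g"
    and fin: "(\<integral>\<^sup>+z. ennreal_powr (ennreal \<bar>g z\<bar>) p \<partial>tor) < top"
  shows "(\<integral>\<^sup>+z. ennreal_powr (ennreal \<bar>frac_diff1 \<alpha>1 h1 (frac_diff2 \<alpha>2 h2 g) z\<bar>) p \<partial>tor) < top"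
proof -
  have w: "ennreal_powr (ennreal w) p < top" for w by (simp add: less_top[symmetric])
  have step: "(\<integral>\<^sup>+z. ennreal_powr (ennreal \<bar>shift_series \<alpha> s f z\<bar>) p \<partial>tor) < top"
    if "0 < \<alpha>" "f \<in> borel_measurable borel" "periodic2 f" "(\<integral>\<^sup>+z. ennreal_powr (ennreal \<bar>f z\<bar>) p \<partial>tor) < top" for \<alpha> s f
    by (rule le_less_trans[OF shift_series_powr_bound[OF that(1) p that(2,3)]]) (use that(4) w in \<open>simp add: ennreal_mult_less_top\<close>)
  show ?thesis
    unfolding frac_diff1_eq frac_diff2_eq
    using \<alpha> g fin by (intro step periodic2_shift_series measurable_shift_series) auto
qed

theorem theorem7p2:
  fixes p \<alpha>1 \<alpha>2 :: real
  assumes "1 < p" and "0 < \<alpha>1" and "0 < \<alpha>2"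
  shows "\<exists>C>0. \<forall>f\<in>M_class p. \<forall>a. has_cosine_Fourier_series f a \<longrightarrow>
    (\<forall>n1\<ge>1. \<forall>n2\<ge>1.
       ennreal (1 / C) * coeff_bound p \<alpha>1 \<alpha>2 a n1 n2
         \<le> mixed_modulus p \<alpha>1 \<alpha>2 f (1 / real n1) (1 / real n2)
     \<and> mixed_modulus p \<alpha>1 \<alpha>2 f (1 / real n1) (1 / real n2)
         \<le> ennreal C * coeff_bound p \<alpha>1 \<alpha>2 a n1 n2)"
proof -
  note p = assms(1) and \<alpha> = assms(2,3)
  obtain C1 where C1: "0 < C1" and lower: "\<And>f a n1 n2. \<lbrakk>f \<in> borel_measurable borel; periodic2 f; integrable tor f; cosine_coeffs f a;
     \<And>k l. 1 \<le> k \<Longrightarrow> 1 \<le> l \<Longrightarrow> 0 \<le> mixed_diff a k l; 0 < n1; 0 < n2\<rbrakk> \<Longrightarrow>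
     coeff_sum p \<alpha>1 \<alpha>2 a n1 n2 \<le> ennreal C1 *
       (\<integral>\<^sup>+z. ennreal_powr (ennreal \<bar>frac_diff1 \<alpha>1 (1 / (4 * real n1)) (frac_diff2 \<alpha>2 (1 / (4 * real n2)) f) z\<bar>) p \<partial>tor)"
  proof -
    show ?thesis by (rule lower_estimate[OF p \<alpha>], fact that)
  qed
  obtain C2 where C2: "0 < C2" and upper: "\<And>f a n1 n2 h1 h2. \<lbrakk>f \<in> borel_measurable borel; periodic2 f; integrable tor f; cosine_coeffs f a;
     \<And>k l. 1 \<le> k \<Longrightarrow> 1 \<le> l \<Longrightarrow> 0 \<le> mixed_diff a k l; coeff_sum p \<alpha>1 \<alpha>2 a 1 1 < top; 0 < n1; 0 < n2;
     \<bar>h1\<bar> \<le> 1 / real n1; \<bar>h2\<bar> \<le> 1 / real n2\<rbrakk> \<Longrightarrow>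
     (\<integral>\<^sup>+z. ennreal_powr (ennreal \<bar>frac_diff1 \<alpha>1 h1 (frac_diff2 \<alpha>2 h2 f) z\<bar>) p \<partial>tor) \<le> ennreal C2 * coeff_sum p \<alpha>1 \<alpha>2 a n1 n2"
  proof -
    show ?thesis by (rule upper_estimate[OF p \<alpha>], fact that)
  qed
  \<comment> \<open>The first summand serves the estimate from below, with the 4 of the four blocks,
    the second the estimate from above.\<close>
  define C where "C = 4 * C1 powr (1 / p) + C2 powr (1 / p)"
  have C: "0 < C" using C1 by (simp add: C_def add_pos_nonneg)
  show ?thesis
  proof (rule exI[of _ C], intro conjI[OF C] ballI allI impI)
    fix f and a :: "nat \<Rightarrow> nat \<Rightarrow> real" and n1 n2 :: nat
    assume f: "f \<in> M_class p" and a: "has_cosine_Fourier_series f a" and n: "1 \<le> n1" "1 \<le> n2"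
    have fLp: "f \<in> Lp p" using f by (simp add: M_class_def Lp0_def)
    then have fm: "f \<in> borel_measurable lebesgue" by (simp add: Lp_def)
    obtain g where g: "g \<in> borel_measurable borel" "periodic2 g" and ae: "AE z in lborel. f z = g z" and int: "integrable tor g"
      and fin: "(\<integral>\<^sup>+z. ennreal_powr (ennreal \<bar>g z\<bar>) p \<partial>tor) < top"
      by (rule Lp_borel_representative[OF p fLp])
    have ga: "cosine_coeffs g a" by (rule cosine_coeffs_of_Fourier_series[OF fm g(1) ae a])
    \<comment> \<open>\<open>M_class\<close> only asserts that some array has nonnegative mixed
      differences; for indices \<ge> 1 it coincides with \<open>a\<close>, as both consist of
      Fourier coefficients of \<open>f\<close>.\<close>
    have md: "0 \<le> mixed_diff a k l" if "1 \<le> k" "1 \<le> l" for k l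
    proof -
      obtain a' where a': "has_cosine_Fourier_series f a'" and d: "\<forall>i\<ge>1. \<forall>j\<ge>1. a' i j - a' (i + 1) j - a' i (j + 1) + a' (i + 1) (j + 1) \<ge> 0"
        using f by (auto simp: M_class_def)
      have "a i j = a' i j" if "1 \<le> i" "1 \<le> j" for i j
        using a a' that unfolding has_cosine_Fourier_series_def by metis
      then show ?thesis using d that by (simp add: mixed_diff_def)
    qed
    have a0: "0 \<le> a k l" if "1 \<le> k" "1 \<le> l" for k l
      using that by (intro cosine_coeffs_monotone(3)[OF int ga md]) auto
    define I where "I h1 h2 = (\<integral>\<^sup>+z. ennreal_powr (ennreal \<bar>frac_diff1 \<alpha>1 h1 (frac_diff2 \<alpha>2 h2 g) z\<bar>) p \<partial>tor)" for h1 h2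
    have norm: "Lp_norm p (frac_diff1 \<alpha>1 h1 (frac_diff2 \<alpha>2 h2 f)) = ennreal_powr (I h1 h2) (1 / p)" for h1 h2
      unfolding I_def by (rule Lp_norm_frac_diff[OF g(1) ae])
    have low: "coeff_sum p \<alpha>1 \<alpha>2 a m1 m2 \<le> ennreal C1 * I (1 / (4 * real m1)) (1 / (4 * real m2))" if "1 \<le> m1" "1 \<le> m2" for m1 m2
      unfolding I_def using that by (intro lower g int ga md) auto
    have sum_fin: "coeff_sum p \<alpha>1 \<alpha>2 a 1 1 < top"
      by (rule le_less_trans[OF low]) (use frac_diff_powr_finite[OF \<alpha> p g fin] in \<open>auto simp: I_def ennreal_mult_less_top\<close>)
    have powr_C: "ennreal_powr (ennreal D * x) (1 / p) = ennreal (D powr (1 / p)) * ennreal_powr x (1 / p)" if "0 < D" for D x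
      using that p by (simp add: ennreal_powr_mult ennreal_powr_ennreal)
    show "ennreal (1 / C) * coeff_bound p \<alpha>1 \<alpha>2 a n1 n2 \<le> mixed_modulus p \<alpha>1 \<alpha>2 f (1 / real n1) (1 / real n2)
     \<and> mixed_modulus p \<alpha>1 \<alpha>2 f (1 / real n1) (1 / real n2) \<le> ennreal C * coeff_bound p \<alpha>1 \<alpha>2 a n1 n2"
    proof
      \<comment> \<open>The steps of the estimate from below are admissible in the supremum, as 1 /
        (4 n) \<le> 1 / n.\<close>
      let ?h1 = "1 / (4 * real n1)" and ?h2 = "1 / (4 * real n2)"
      have "ennreal_powr (I ?h1 ?h2) (1 / p) \<le> mixed_modulus p \<alpha>1 \<alpha>2 f (1 / real n1) (1 / real n2)"
        unfolding mixed_modulus_def norm[symmetric] using n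
        by (intro SUP_upper2[of "(?h1, ?h2)"]) (auto simp: field_simps)
      have "coeff_bound p \<alpha>1 \<alpha>2 a n1 n2 \<le> 4 * ennreal_powr (coeff_sum p \<alpha>1 \<alpha>2 a n1 n2) (1 / p)"
        by (rule coeff_bound_bounds(1)[OF p n a0])
      also have "\<dots> \<le> 4 * ennreal_powr (ennreal C1 * I ?h1 ?h2) (1 / p)"
        using p by (intro mult_left_mono ennreal_powr_mono low n) auto
      also have "\<dots> = ennreal (4 * C1 powr (1 / p)) * ennreal_powr (I ?h1 ?h2) (1 / p)"
        by (simp add: powr_C[OF C1] ennreal_mult mult.assoc)
      also have "\<dots> \<le> ennreal C * mixed_modulus p \<alpha>1 \<alpha>2 f (1 / real n1) (1 / real n2)"
        by (intro mult_mono ennreal_leI) (auto simp: C_def \<open>ennreal_powr (I ?h1 ?h2) (1 / p) \<le> _\<close>)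
      finally have "ennreal (1 / C) * coeff_bound p \<alpha>1 \<alpha>2 a n1 n2 \<le> ennreal (1 / C) * (ennreal C * mixed_modulus p \<alpha>1 \<alpha>2 f (1 / real n1) (1 / real n2))"
        by (intro mult_left_mono) auto
      also have "\<dots> = mixed_modulus p \<alpha>1 \<alpha>2 f (1 / real n1) (1 / real n2)"
        using C by (simp flip: mult.assoc ennreal_mult)
      finally show "ennreal (1 / C) * coeff_bound p \<alpha>1 \<alpha>2 a n1 n2 \<le> mixed_modulus p \<alpha>1 \<alpha>2 f (1 / real n1) (1 / real n2)" .
      have "ennreal_powr (I h1 h2) (1 / p) \<le> ennreal C * coeff_bound p \<alpha>1 \<alpha>2 a n1 n2"
        if h: "\<bar>h1\<bar> \<le> 1 / real n1" "\<bar>h2\<bar> \<le> 1 / real n2" for h1 h2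
      proof -
        have "I h1 h2 \<le> ennreal C2 * coeff_sum p \<alpha>1 \<alpha>2 a n1 n2"
          unfolding I_def using n h by (intro upper g int ga md sum_fin) auto
        then have "ennreal_powr (I h1 h2) (1 / p) \<le> ennreal_powr (ennreal C2 * coeff_sum p \<alpha>1 \<alpha>2 a n1 n2) (1 / p)"
          using p by (intro ennreal_powr_mono) auto
        also have "\<dots> = ennreal (C2 powr (1 / p)) * ennreal_powr (coeff_sum p \<alpha>1 \<alpha>2 a n1 n2) (1 / p)"
          by (rule powr_C[OF C2])
        also have "\<dots> \<le> ennreal C * coeff_bound p \<alpha>1 \<alpha>2 a n1 n2"
          by (intro mult_mono ennreal_leI coeff_bound_bounds(2)[OF p n a0]) (auto simp: C_def)
        finally show ?thesis .
      qed
      then show "mixed_modulus p \<alpha>1 \<alpha>2 f (1 / real n1) (1 / real n2) \<le> ennreal C * coeff_bound p \<alpha>1 \<alpha>2 a n1 n2"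
        unfolding mixed_modulus_def by (intro SUP_least) (auto simp: norm)
    qed
  qed
qed

end
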